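(* Let $\pi$ be a probability distribution on $(\Theta\times\mathsf X,\mathcal B(\Theta)\times\mathcal B(\mathsf X))$ and let $\{\Pi_\theta,\theta\in\Theta\}$ be a family of Markov kernels on $\mathsf X$ such that for any $\theta\in\Theta$, $\Pi_\theta$ is reversible with respect to $\pi_\theta$. Let $\Gamma,\Phi,\Gamma_x,\Phi_x$ be as defined in the context. For $f:\Theta\to\mathbb R$ write $\bar f(x):=\pi_x(f)$. (a) Assume that for some class of functions $\mathcal G\subset\{g:\mathsf X\to\mathbb R:\pi(|g|)<\infty\}$ there exist a function $|\cdot|_{\mathcal G}:\mathcal G\to[0,\infty]$ and $\rho\in[0,1)$ such that for any probability distribution $\nu$ on $(\mathsf X,\mathcal B(\mathsf X))$ there exists $W_\nu\in[0,\infty]$ such that for all $g\in\mathcal G$ and any $k\ge1$, $|\nu\Phi_x^k(g)-\pi(g)|\le|g|_{\mathcal G}W_\nu\rho^k$. Then for any such $\nu$, any $f:\Theta\to\mathbb R$ such that $\bar f\in\mathcal G$, and any $k\ge2$, $|\nu\Phi^k(f)-\pi(f)|\le|\bar f|_{\mathcal G}W_\nu\rho^{k-1}$. (b) For any $f\in L^2(\Theta,\pi)$ (so that $\bar f\in L^2(\mathsf X,\pi)$) and any $k\ge1$, $\langle f,\Phi^kf\rangle_\pi=\langle\bar f,\Phi_x^{k-1}\bar f\rangle_\pi$, and $\mathrm{var}(f,\Phi)=\mathrm{var}_\pi(f)+\mathrm{var}_\pi(\bar f)+\mathrm{var}(\bar f,\Phi_x)$. (c) If $\varrho>0$, where $\displaystyle\varrho:=\inf_{g\in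 L^2(\mathsf X,\pi)}\frac{\int_\Theta\pi(d\theta)\,\mathrm{var}_{\pi_\theta}(g)\,\mathrm{Gap}(\Pi_\theta)}{\int_\Theta\pi(d\theta)\,\mathrm{var}_{\pi_\theta}(g)}$, then for $f\in L^2(\Theta,\pi)$, $$\mathrm{var}(f,\Phi)\le\mathrm{var}_\pi(f)+\varrho^{-1}\mathrm{var}_\pi(\bar f)+\varrho^{-1}\mathrm{var}(\bar f,\Gamma_x)\le(1-\varrho^{-1})\mathrm{var}_\pi(f)+\varrho^{-1}\mathrm{var}(f,\Gamma).$$ (d) If for all $\theta\in\Theta$, $\Pi_\theta$ is a positive operator, then for $f\in L^2(\Theta,\pi)$, $\mathrm{var}(f,\Phi)\ge\mathrm{var}(f,\Gamma)$.
   Context: $\pi_\theta(dx)$ and $\pi_x(d\theta)$ denote the (regular) conditional distributions under $\pi$ of $x$ given $\theta$ and of $\theta$ given $x$; $\pi(d\theta)$, $\pi(dx)$ denote the marginals. All kernels and functions are measurable in all arguments. For $(\theta_0,x)\in\Theta\times\mathsf X$ and $S\in\mathcal B(\Theta)\times\mathcal B(\mathsf X)$, $$\Gamma(\theta_0,x;S):=\int_S\pi_x(d\vartheta)\,\pi_\vartheta(dy),\qquad\Phi(\theta_0,x;S):=\int_S\pi_x(d\vartheta)\,\Pi_\vartheta(x,dy).$$ Neither depends on $\theta_0$, so for a probability $\nu$ on $\mathsf X$, $\nu\Phi^k(f)$ is the expectation of $f$ after $k$ steps of $\Phi$ started with $x\sim\nu$ (and any $\theta_0$). For $B\in\mathcal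 B(\mathsf X)$, $\Gamma_x(x,B):=\Gamma(\theta_0,x;\Theta\times B)$ and $\Phi_x(x,B):=\Phi(\theta_0,x;\Theta\times B)$ (the subscript $x$ in the names is not a variable); both are reversible with respect to $\pi(dx)$. $f\in L^2(\Theta,\pi)$ (resp. $L^2(\mathsf X,\pi)$) means $f$ is a function of $\theta$ (resp. $x$) only, square integrable under the relevant marginal of $\pi$; such functions are also viewed as functions on $\Theta\times\mathsf X$. $\langle f,g\rangle_\pi=\int fg\,d\pi$; $\mathrm{var}_\mu(f):=\mu(f^2)-\mu(f)^2$. For a kernel $\Pi$ with invariant probability $\mu$, $\mathrm{var}(f,\Pi):=\lim_{M\to\infty}\mathrm{var}(M^{-1/2}\sum_{i=1}^M[f(\xi_i)-\mu(f)])$ for the stationary chain $(\xi_i)$ with kernel $\Pi$. For a $\mu$-reversible $\Pi$ on $\mathsf E$, $\mathrm{Gap}(\Pi):=\inf\{\langle f,(I-\Pi)f\rangle_\mu/\|f\|_\mu^2: f\in L^2(\mathsf E,\mu),\mu(f)=0,f\ne0\}$, and $\Pi$ is positive if $\langle f,\Pi f\rangle_\mu\ge0$ for all $f\in L^2(\mathsf E,\mu)$. $\mathrm{Gap}(\Pi_\theta)$ is relative to $\pi_\theta$. The infimum defining $\varrho$ is over $g$ with nonzero denominator. *)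

theory Defs
  imports "HOL-Probability.Probability"
begin

definition L2 :: "'e measure \<Rightarrow> ('e \<Rightarrow> real) set" where
  "L2 \<mu> = {f \<in> borel_measurable \<mu>. integrable \<mu> (\<lambda>x. (f x)\<^sup>2)}"

definition ip :: "'e measure \<Rightarrow> ('e \<Rightarrow> real) \<Rightarrow> ('e \<Rightarrow> real) \<Rightarrow> real" where
  "ip \<mu> f g = (\<integral>x. f x * g x \<partial>\<mu>)"

definition var_of :: "'e measure \<Rightarrow> ('e \<Rightarrow> real) \<Rightarrow> real" where
  "var_of \<mu> f = (\<integral>x. (f x)\<^sup>2 \<partial>\<mu>) - (\<integral>x. f x \<partial>\<mu>)\<^sup>2"

text \<open>A Markov kernel on a measurable space \<open>E\<close> is an element of \<open>E \<rightarrow>\<^sub>M prob_algebra E\<close>.\<close>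

definition reversible :: "'e measure \<Rightarrow> ('e \<Rightarrow> 'e measure) \<Rightarrow> bool" where
  "reversible \<mu> P \<longleftrightarrow> (\<forall>A\<in>sets \<mu>. \<forall>B\<in>sets \<mu>.
     (\<integral>\<^sup>+x. emeasure (P x) B * indicator A x \<partial>\<mu>) = (\<integral>\<^sup>+x. emeasure (P x) A * indicator B x \<partial>\<mu>))"

definition kernel_op :: "('e \<Rightarrow> 'e measure) \<Rightarrow> ('e \<Rightarrow> real) \<Rightarrow> 'e \<Rightarrow> real" where
  "kernel_op P f x = (\<integral>y. f y \<partial>P x)"

primrec kernel_pow :: "'e measure \<Rightarrow> ('e \<Rightarrow> 'e measure) \<Rightarrow> nat \<Rightarrow> 'e \<Rightarrow> 'e measure" where
  "kernel_pow E P 0 = return E"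
| "kernel_pow E P (Suc k) = (\<lambda>x. P x \<bind> kernel_pow E P k)"

definition positive_kernel :: "'e measure \<Rightarrow> ('e \<Rightarrow> 'e measure) \<Rightarrow> bool" where
  "positive_kernel \<mu> P \<longleftrightarrow> (\<forall>f\<in>L2 \<mu>. 0 \<le> ip \<mu> f (kernel_op P f))"

text \<open>If every centred element of \<open>L2 \<mu>\<close> vanishes almost everywhere, the infimum is over the empty
  set and \<open>gap \<mu> P\<close> is an unspecified real number; in the integral below
  it is then multiplied by a variance that is zero.\<close>

definition gap :: "'e measure \<Rightarrow> ('e \<Rightarrow> 'e measure) \<Rightarrow> real" where
  "gap \<mu> P = Inf {ip \<mu> f (\<lambda>x. f x - kernel_op P f x) / ip \<mu> f f | f.
     f \<in> L2 \<mu> \<and> (\<integral>x. f x \<partial>\<mu>) = 0 \<and> ip \<mu> f f \<noteq> 0}"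

text \<open>The law on trajectories of the chain with initial law \<open>\<mu>\<close> and kernel \<open>P\<close>, given by the
  Ionescu-Tulcea theorem. Coordinate \<open>i\<close> of a trajectory is \<open>\<xi>\<close> with index \<open>i + 1\<close>.\<close>

definition chain_step :: "'e measure \<Rightarrow> ('e \<Rightarrow> 'e measure) \<Rightarrow> nat \<Rightarrow> (nat \<Rightarrow> 'e) \<Rightarrow> 'e measure" where
  "chain_step \<mu> P i \<omega> = (if i = 0 then \<mu> else P (\<omega> (i - 1)))"

definition chain_law :: "'e measure \<Rightarrow> ('e \<Rightarrow> 'e measure) \<Rightarrow> (nat \<Rightarrow> 'e) measure" where
  "chain_law \<mu> P =
     projective_family.lim UNIV (Ionescu_Tulcea.CI (chain_step \<mu> P) (\<lambda>_. \<mu>)) (\<lambda>_. \<mu>)"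

lemma Ionescu_Tulcea_chain:
  assumes \<mu>: "prob_space \<mu>" and P: "P \<in> \<mu> \<rightarrow>\<^sub>M prob_algebra \<mu>"
  shows "Ionescu_Tulcea (chain_step \<mu> P) (\<lambda>_. \<mu>)"
proof (rule Ionescu_Tulcea.intro)
  have P': "P \<in> \<mu> \<rightarrow>\<^sub>M subprob_algebra \<mu>"
    using P by (rule measurable_prob_algebraD)
  have \<mu>': "\<mu> \<in> space (subprob_algebra \<mu>)"
    using \<mu> by (simp add: space_subprob_algebra prob_space_imp_subprob_space)
  show "chain_step \<mu> P i \<in> PiM {0..<i} (\<lambda>_. \<mu>) \<rightarrow>\<^sub>M subprob_algebra \<mu>" for i
  proof (cases "i = 0")
    case True
    then show ?thesis using \<mu>' by (simp add: chain_step_def[abs_def])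
  next
    case False
    then have "(\<lambda>\<omega>. P (\<omega> (i - 1))) \<in> PiM {0..<i} (\<lambda>_. \<mu>) \<rightarrow>\<^sub>M subprob_algebra \<mu>"
      by (intro measurable_compose[OF _ P'] measurable_component_singleton) simp
    with False show ?thesis by (simp add: chain_step_def[abs_def])
  qed
  show "prob_space (chain_step \<mu> P i \<omega>)" if \<omega>: "\<omega> \<in> space (PiM {0..<i} (\<lambda>_. \<mu>))" for i \<omega>
  proof (cases "i = 0")
    case True
    with \<mu> show ?thesis by (simp add: chain_step_def)
  next
    case False
    with \<omega> have "\<omega> (i - 1) \<in> space \<mu>"
      by (auto simp: space_PiM PiE_iff)
    with measurable_space[OF P this] False show ?thesis
      by (simp add: chain_step_def space_prob_algebra)
  qed
qed

definition asym_var :: "'e measure \<Rightarrow> ('e \<Rightarrow> 'e measure) \<Rightarrow> ('e \<Rightarrow> real) \<Rightarrow> ereal" where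
  "asym_var \<mu> P f = lim (\<lambda>M. ereal (var_of (chain_law \<mu> P)
     (\<lambda>\<omega>. (1 / sqrt (real M)) * (\<Sum>i<M. f (\<omega> i) - (\<integral>x. f x \<partial>\<mu>)))))"

text \<open>\<open>piT\<close> and \<open>piX\<close> are regular versions under \<open>\<pi>\<close> of the conditional laws of the
  second coordinate given the first, and of the first coordinate given the second.\<close>

definition marg_fst :: "'t measure \<Rightarrow> ('t \<times> 'x) measure \<Rightarrow> 't measure" where
  "marg_fst T \<pi> = distr \<pi> T fst"

definition marg_snd :: "'x measure \<Rightarrow> ('t \<times> 'x) measure \<Rightarrow> 'x measure" where
  "marg_snd X \<pi> = distr \<pi> X snd"

definition cond_snd_given_fst ::
  "'t measure \<Rightarrow> 'x measure \<Rightarrow> ('t \<times> 'x) measure \<Rightarrow> ('t \<Rightarrow> 'x measure) \<Rightarrow> bool" where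
  "cond_snd_given_fst T X \<pi> piT \<longleftrightarrow> piT \<in> T \<rightarrow>\<^sub>M prob_algebra X \<and>
     (\<forall>A\<in>sets T. \<forall>B\<in>sets X.
        emeasure \<pi> (A \<times> B) = (\<integral>\<^sup>+\<theta>. emeasure (piT \<theta>) B * indicator A \<theta> \<partial>marg_fst T \<pi>))"

definition cond_fst_given_snd ::
  "'t measure \<Rightarrow> 'x measure \<Rightarrow> ('t \<times> 'x) measure \<Rightarrow> ('x \<Rightarrow> 't measure) \<Rightarrow> bool" where
  "cond_fst_given_snd T X \<pi> piX \<longleftrightarrow> piX \<in> X \<rightarrow>\<^sub>M prob_algebra T \<and>
     (\<forall>A\<in>sets T. \<forall>B\<in>sets X.
        emeasure \<pi> (A \<times> B) = (\<integral>\<^sup>+x. emeasure (piX x) A * indicator B x \<partial>marg_snd X \<pi>))"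

text \<open>The law \<open>piX x (d\<theta>) Q \<theta> x (dy)\<close> on the product space. It depends on the current state
  \<open>(\<theta>0, x)\<close> only through \<open>x\<close>.\<close>

definition joint_law :: "'t measure \<Rightarrow> 'x measure \<Rightarrow> ('x \<Rightarrow> 't measure) \<Rightarrow>
    ('t \<Rightarrow> 'x \<Rightarrow> 'x measure) \<Rightarrow> 'x \<Rightarrow> ('t \<times> 'x) measure" where
  "joint_law T X piX Q x =
     piX x \<bind> (\<lambda>\<theta>. Q \<theta> x \<bind> (\<lambda>y. return (T \<Otimes>\<^sub>M X) (\<theta>, y)))"

definition Phi :: "'t measure \<Rightarrow> 'x measure \<Rightarrow> ('x \<Rightarrow> 't measure) \<Rightarrow>
    ('t \<Rightarrow> 'x \<Rightarrow> 'x measure) \<Rightarrow> 't \<times> 'x \<Rightarrow> ('t \<times> 'x) measure" where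
  "Phi T X piX Q = (\<lambda>(\<theta>0, x). joint_law T X piX Q x)"

definition Phi_x :: "'t measure \<Rightarrow> 'x measure \<Rightarrow> ('x \<Rightarrow> 't measure) \<Rightarrow>
    ('t \<Rightarrow> 'x \<Rightarrow> 'x measure) \<Rightarrow> 'x \<Rightarrow> 'x measure" where
  "Phi_x T X piX Q x = distr (joint_law T X piX Q x) X snd"

definition Gam :: "'t measure \<Rightarrow> 'x measure \<Rightarrow> ('x \<Rightarrow> 't measure) \<Rightarrow>
    ('t \<Rightarrow> 'x measure) \<Rightarrow> 't \<times> 'x \<Rightarrow> ('t \<times> 'x) measure" where
  "Gam T X piX piT = (\<lambda>(\<theta>0, x). joint_law T X piX (\<lambda>\<theta> _. piT \<theta>) x)"

definition Gam_x :: "'t measure \<Rightarrow> 'x measure \<Rightarrow> ('x \<Rightarrow> 't measure) \<Rightarrow>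
    ('t \<Rightarrow> 'x measure) \<Rightarrow> 'x \<Rightarrow> 'x measure" where
  "Gam_x T X piX piT x = distr (joint_law T X piX (\<lambda>\<theta> _. piT \<theta>) x) X snd"

definition cond_mean :: "('x \<Rightarrow> 't measure) \<Rightarrow> ('t \<Rightarrow> real) \<Rightarrow> 'x \<Rightarrow> real" where
  "cond_mean piX f x = (\<integral>\<theta>. f \<theta> \<partial>piX x)"

text \<open>The map \<open>\<theta> \<mapsto> gap (piT \<theta>) (Q \<theta>)\<close> is understood to be measurable; an integrand that is not
  measurable has integral \<open>0\<close>, which makes \<open>gap_ratio \<le> 0\<close>. If no \<open>g\<close> has a nonzero denominator,
  \<open>gap_ratio\<close> is an unspecified real number.\<close>

definition gap_ratio :: "'t measure \<Rightarrow> 'x measure \<Rightarrow> ('t \<times> 'x) measure \<Rightarrow>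
    ('t \<Rightarrow> 'x measure) \<Rightarrow> ('t \<Rightarrow> 'x \<Rightarrow> 'x measure) \<Rightarrow> real" where
  "gap_ratio T X \<pi> piT Q =
     Inf {(\<integral>\<theta>. var_of (piT \<theta>) g * gap (piT \<theta>) (Q \<theta>) \<partial>marg_fst T \<pi>)
            / (\<integral>\<theta>. var_of (piT \<theta>) g \<partial>marg_fst T \<pi>) | g.
          g \<in> L2 (marg_snd X \<pi>) \<and> (\<integral>\<theta>. var_of (piT \<theta>) g \<partial>marg_fst T \<pi>) \<noteq> 0}"

end

theory Submission
  imports Defs
begin

text \<open>
Each step of \<open>\<Phi>\<close> draws a parameter given the current state and then moves the state with the kernel of that parameter. The
states alone form a chain with kernel \<open>\<Phi>x\<close>, and the parameter drawn in a step is a fresh draw from \<open>piX\<close> given the state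
before it. Averaging over this draw replaces \<open>f\<close> by its conditional mean and uses up one of the \<open>k\<close> steps
(\<open>distr_fst_Phi_pow\<close>). This transfers every geometric bound for \<open>\<Phi>x\<close> to \<open>\<Phi>\<close> with exponent \<open>k - 1\<close>, and it shows that the autocovariances of
\<open>f\<close> under \<open>\<Phi>\<close> are those of the conditional mean under \<open>\<Phi>x\<close>, delayed by one step.

The variance of a normalised sum of a stationary chain is a combination of Cesaro means of partial sums of autocovariances.
For a reversible chain these means converge, possibly to infinity. With \<open>c\<close> the autocovariances of the conditional mean
under \<open>\<Phi>x\<close> and \<open>L\<close> the Cesaro limit of the partial sums \<open>c 0 + \<dots> + c (m - 1)\<close>, the asymptotic variance of the conditional mean is
\<open>2 L - c 0\<close>, and because of the delay that of \<open>f\<close> is \<open>var f + 2 L\<close> (\<open>asym_var_limit\<close>). The variance identity is the difference of these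
two formulas.

The last two parts compare \<open>L\<close> for \<open>\<Phi>\<close> with its value for \<open>\<Gamma>\<close>, which is the same construction with the
exact conditional law in place of \<open>Q\<close>. Formally \<open>L\<close> is \<open>\<langle>g, (I - \<Phi>x)\<^sup>-\<^sup>1 g\<rangle>\<close> for the centred conditional mean \<open>g\<close>, and inversion reverses
the order of positive operators. To make sense of this when the inverse does not exist, note that \<open>L\<close> is also the Abel limit of the series of
autocovariances, the Abel sums are values of the bounded resolvent, and the comparison of resolvents is a completed
square (\<open>resolvent_comparison\<close>). The order between \<open>I - \<Phi>x\<close> and \<open>I - \<Gamma>x\<close> is checked on each fibre: the quadratic form of
\<open>I - \<Phi>x\<close> at \<open>g\<close> is the average over \<open>\<theta>\<close> of the quadratic form of \<open>I - Q \<theta>\<close>, while that of \<open>I - \<Gamma>x\<close> is the average of the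
variance of \<open>g\<close> under \<open>piT \<theta>\<close>. The spectral gap bounds the former below by a multiple of the latter, and positivity
of \<open>Q \<theta>\<close> bounds it above by the latter.
\<close>

section \<open>Weighted averages and Abel limits\<close>

text \<open>The regularity theorem for summation methods, in a form that covers Cesaro means and Abel means at once.
A lower bound for the tail of the nonnegative sequence bounds the average from below, since the weights of the initial
segment tend to zero; this also settles an infinite limit. An upper bound is treated in the same way.\<close>

lemma weighted_average_tendsto:
  fixes w :: "'a \<Rightarrow> nat \<Rightarrow> real" and x :: "nat \<Rightarrow> real" and L :: ereal
  assumes w: "\<forall>\<^sub>F n in F. (\<forall>k. 0 \<le> w n k) \<and> w n sums 1 \<and> summable (\<lambda>k. w n k * x k)"
    and w0: "\<And>k. ((\<lambda>n. w n k) \<longlongrightarrow> 0) F"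
    and x0: "\<And>k. 0 \<le> x k"
    and L: "(\<lambda>k. ereal (x k)) \<longlonglongrightarrow> L"
  shows "((\<lambda>n. ereal (\<Sum>k. w n k * x k)) \<longlongrightarrow> L) F"
proof (rule order_tendstoI)
  have L0: "0 \<le> L"
    using L by (rule Lim_bounded2[where N=0]) (simp add: x0)
  show "\<forall>\<^sub>F n in F. a < ereal (\<Sum>k. w n k * x k)" if aL: "a < L" for a
  proof (cases "a < 0")
    case True
    then show ?thesis
      by (intro eventually_mono[OF w])
         (auto intro!: less_le_trans[OF True] suminf_nonneg mult_nonneg_nonneg x0)
  next
    case False
    obtain l where l: "a < ereal l" "ereal l < L"
      using ereal_dense2[OF aL] by blast
    with False have l0: "0 \<le> l"
      by (metis ereal_less_eq(5) leI less_trans linorder_not_le)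
    obtain N where N: "\<And>k. k \<ge> N \<Longrightarrow> l < x k"
      using order_tendstoD(1)[OF L l(2)] by (auto simp: eventually_sequentially)
    have "((\<lambda>n. ereal (l * (1 - (\<Sum>k<N. w n k)))) \<longlongrightarrow> ereal (l * (1 - (\<Sum>k<N. 0)))) F"
      by (intro tendsto_intros w0)
    then have "((\<lambda>n. ereal (l * (1 - (\<Sum>k<N. w n k)))) \<longlongrightarrow> ereal l) F" by simp
    from order_tendstoD(1)[OF this l(1)] w
    show ?thesis
    proof eventually_elim
      case (elim n)
      then have sm: "summable (w n)" and s1: "suminf (w n) = 1"
        by (auto simp: sums_iff)
      have "l * (1 - (\<Sum>k<N. w n k)) = (\<Sum>k. l * w n (k + N))"
        using suminf_split_initial_segment[OF sm, of N] s1 sm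
        by (subst suminf_mult) (auto simp: summable_iff_shift)
      also have "\<dots> \<le> (\<Sum>k. w n (k + N) * x (k + N))"
      proof (rule suminf_le)
        show "l * w n (k + N) \<le> w n (k + N) * x (k + N)" for k
          using elim mult_left_mono[OF less_imp_le[OF N[of "k+N"]], of "w n (k+N)"]
          by (simp add: mult.commute)
        show "summable (\<lambda>k. l * w n (k + N))"
          using sm by (intro summable_mult) (simp add: summable_iff_shift)
        show "summable (\<lambda>k. w n (k + N) * x (k + N))"
          using elim by (subst summable_iff_shift[of "\<lambda>k. w n k * x k"]) auto
      qed
      also have "\<dots> \<le> (\<Sum>k. w n k * x k)"
        using suminf_split_initial_segment[of "\<lambda>k. w n k * x k" N] elim x0
        by (auto intro!: sum_nonneg)
      finally show ?case using elim(1) by (metis ereal_less_eq(3) less_le_trans)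
    qed
  qed
  show "\<forall>\<^sub>F n in F. ereal (\<Sum>k. w n k * x k) < b" if Lb: "L < b" for b
  proof -
    obtain u where u: "L < ereal u" "ereal u < b"
      using ereal_dense2[OF Lb] by blast
    with L0 have u0: "0 \<le> u"
      by (metis ereal_less_eq(5) less_imp_le order_trans)
    obtain N where N: "\<And>k. k \<ge> N \<Longrightarrow> x k < u"
      using order_tendstoD(2)[OF L u(1)] by (auto simp: eventually_sequentially)
    have "((\<lambda>n. ereal ((\<Sum>k<N. w n k * x k) + u)) \<longlongrightarrow> ereal ((\<Sum>k<N. 0 * x k) + u)) F"
      by (intro tendsto_intros w0)
    then have "((\<lambda>n. ereal ((\<Sum>k<N. w n k * x k) + u)) \<longlongrightarrow> ereal u) F" by simp
    from order_tendstoD(2)[OF this u(2)] w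
    show ?thesis
    proof eventually_elim
      case (elim n)
      then have sm: "summable (w n)" and s1: "suminf (w n) = 1"
        by (auto simp: sums_iff)
      have smx: "summable (\<lambda>k. w n k * x k)" using elim by auto
      have smN: "summable (\<lambda>k. w n (k + N))" using sm by (simp add: summable_iff_shift)
      have "(\<Sum>k. w n (k + N) * x (k + N)) \<le> (\<Sum>k. u * w n (k + N))"
      proof (rule suminf_le)
        show "w n (k + N) * x (k + N) \<le> u * w n (k + N)" for k
          using elim mult_left_mono[OF less_imp_le[OF N[of "k+N"]], of "w n (k+N)"]
          by (simp add: mult.commute)
        show "summable (\<lambda>k. u * w n (k + N))"
          using smN by (rule summable_mult)
        show "summable (\<lambda>k. w n (k + N) * x (k + N))"
          using smx by (subst summable_iff_shift[of "\<lambda>k. w n k * x k"])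
      qed
      also have "\<dots> = u * (\<Sum>k. w n (k + N))"
        using smN by (rule suminf_mult)
      also have "\<dots> \<le> u * 1"
        using suminf_split_initial_segment[OF sm, of N] s1 elim u0 sum_nonneg[of "{..<N}" "w n"]
        by (intro mult_left_mono) simp_all
      finally have "(\<Sum>k. w n k * x k) \<le> (\<Sum>k<N. w n k * x k) + u"
        using suminf_split_initial_segment[OF smx, of N] by simp
      then show ?case using elim(1) by (metis ereal_less_eq(3) le_less_trans)
    qed
  qed
qed

definition cesaro :: "(nat \<Rightarrow> real) \<Rightarrow> nat \<Rightarrow> real" where
  "cesaro x M = (\<Sum>m<M. x m) / real M"

lemma cesaro_tendsto:
  fixes x :: "nat \<Rightarrow> real"
  assumes x0: "\<And>k. 0 \<le> x k" and L: "(\<lambda>k. ereal (x k)) \<longlonglongrightarrow> L"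
  shows "(\<lambda>M. ereal (cesaro x M)) \<longlonglongrightarrow> L"
proof -
  define w where "w M k = (if k < M then 1 / real M else 0)" for M k
  have fin: "(\<lambda>k. w M k * y k) sums (\<Sum>k<M. y k / real M)" for M and y :: "nat \<Rightarrow> real"
    using sums_If_finite_set[of "{..<M}" "\<lambda>k. y k / real M"]
    by (rule back_subst[of "\<lambda>f. f sums _"]) (auto simp: w_def)
  have "(\<lambda>M. ereal (\<Sum>k. w M k * x k)) \<longlonglongrightarrow> L"
  proof (rule weighted_average_tendsto[OF _ _ x0 L])
    show "\<forall>\<^sub>F M in sequentially. (\<forall>k. 0 \<le> w M k) \<and> w M sums 1 \<and> summable (\<lambda>k. w M k * x k)"
      using eventually_gt_at_top[of 0]
    proof eventually_elim
      case (elim M)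
      show ?case
        using fin[of M "\<lambda>_. 1"] fin[of M x] elim
        by (simp add: w_def[abs_def] sums_summable)
    qed
    show "(\<lambda>M. w M k) \<longlonglongrightarrow> 0" for k
      by (rule Lim_transform_eventually[OF lim_1_over_n])
         (use eventually_gt_at_top[of k] in eventually_elim, simp add: w_def)
  qed
  then show ?thesis
    by (simp add: cesaro_def sums_unique[OF fin, symmetric] sum_divide_distrib)
qed

lemma cesaro_Suc:
  assumes "x 0 = 0"
  shows "cesaro (\<lambda>m. x (Suc m)) M = (\<Sum>m<Suc M. x m) / real M"
  by (simp only: cesaro_def sum.lessThan_Suc_shift assms add_0)

text \<open>Needed because the two chains below lead to Cesaro means of the same partial sums that differ by a shift.\<close>

lemma cesaro_Suc_tendsto:
  assumes x0: "x 0 = 0" and L: "(\<lambda>M. ereal (cesaro x M)) \<longlonglongrightarrow> L"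
  shows "(\<lambda>M. ereal (cesaro (\<lambda>m. x (Suc m)) M)) \<longlonglongrightarrow> L"
proof -
  have "(\<lambda>M. ereal (real (Suc M) / real M) * ereal (cesaro x (Suc M))) \<longlonglongrightarrow> ereal 1 * L"
  proof (intro tendsto_mult_ereal LIMSEQ_Suc[OF L])
    show "(\<lambda>M. ereal (real (Suc M) / real M)) \<longlonglongrightarrow> ereal 1"
      using LIMSEQ_Suc_n_over_n[where 'a=real] by simp
  qed auto
  moreover have "\<forall>\<^sub>F M in sequentially. ereal (real (Suc M) / real M) * ereal (cesaro x (Suc M))
      = ereal (cesaro (\<lambda>m. x (Suc m)) M)"
    using eventually_gt_at_top[of 0]
    by eventually_elim (simp only: cesaro_Suc[where x=x, OF x0], simp add: cesaro_def)
  ultimately show ?thesis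
    by (simp add: one_ereal_def[symmetric] Lim_transform_eventually)
qed

lemma cesaro_odd: "(\<lambda>M. cesaro (\<lambda>m. if odd m then a else 0) M) \<longlonglongrightarrow> a / 2"
proof -
  have s: "(\<Sum>m<M. if odd m then a else 0) = real (M div 2) * a" for M
    by (induction M) (auto simp: algebra_simps elim!: oddE evenE)
  have "(\<lambda>M. real (M div 2) / real M - 1/2) \<longlonglongrightarrow> 0"
  proof (rule Lim_null_comparison[OF _ lim_1_over_n])
    show "\<forall>\<^sub>F M in sequentially. norm (real (M div 2) / real M - 1/2) \<le> 1 / real M"
      using eventually_gt_at_top[of 0]
    proof eventually_elim
      case (elim M)
      have "real (M div 2) / real M - 1/2 = (2 * real (M div 2) - real M) / (2 * real M)"
        using elim by (simp add: field_simps)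
      also have "2 * real (M div 2) - real M = - real (M mod 2)"
        using arg_cong[OF div_mult_mod_eq[of M 2], of real] by (simp only: of_nat_add of_nat_mult)
      finally have "real (M div 2) / real M - 1/2 = - (real (M mod 2) / 2) / real M"
        by simp
      also have "norm \<dots> \<le> 1 / real M"
        using elim mod_less_divisor[of 2 M] by (simp add: field_simps)
      finally show ?case .
    qed
  qed
  from tendsto_mult_right[OF this, of a] have "(\<lambda>M. cesaro (\<lambda>m. if odd m then a else 0) M - a/2) \<longlonglongrightarrow> 0"
    by (simp add: cesaro_def s algebra_simps)
  then show ?thesis by (simp add: LIM_zero_iff)
qed

text \<open>The autocovariances of a reversible chain satisfy the hypotheses. Grouping the terms
in consecutive pairs makes the even partial sums increase. If they are unbounded, all partial sums tend to infinity.
Otherwise the partial sums oscillate in the limit between two values, whose difference is the limit of the even terms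
(the spectral mass at \<open>-1\<close>), and the Cesaro means converge to the midpoint.\<close>

lemma cesaro_partial_sums_convergent:
  fixes c :: "nat \<Rightarrow> real"
  assumes even0: "\<And>j. 0 \<le> c (2 * j)" and dec: "\<And>j. c (2 * Suc j) \<le> c (2 * j)"
    and pair0: "\<And>j. 0 \<le> c (2 * j) + c (Suc (2 * j))"
  shows "(\<forall>m. 0 \<le> (\<Sum>k<m. c k)) \<and> (\<exists>L. (\<lambda>M. ereal (cesaro (\<lambda>m. \<Sum>k<m. c k) M)) \<longlonglongrightarrow> L)"
proof -
  define S where "S m = (\<Sum>k<m. c k)" for m
  have S_even: "S (2 * Suc j) = S (2 * j) + (c (2 * j) + c (Suc (2 * j)))" for j
    by (simp add: S_def)
  have S_odd: "S (Suc (2 * j)) = S (2 * j) + c (2 * j)" for j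
    by (simp add: S_def)
  have inc: "incseq (\<lambda>j. S (2 * j))"
    using pair0 by (intro incseq_SucI) (simp add: S_even del: mult_Suc_right)
  have S0: "0 \<le> S (2 * j)" for j
    using incseqD[OF inc, of 0 j] by (simp add: S_def)
  have split: "m = 2 * (m div 2) \<or> m = Suc (2 * (m div 2))" for m :: nat
    by presburger
  have Spos: "0 \<le> S m" for m
    using split[of m] S0[of "m div 2"] even0[of "m div 2"] S_odd[of "m div 2"] by force
  have lim_div2: "filterlim (\<lambda>m::nat. m div 2) at_top sequentially"
    by (rule filterlim_at_top_div_const_nat) simp
  have ex: "\<exists>L. (\<lambda>M. ereal (cesaro S M)) \<longlonglongrightarrow> L"
  proof (cases "bdd_above (range (\<lambda>j. S (2 * j)))")
    case True
    define B where "B = (SUP j. S (2 * j))"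
    have B: "(\<lambda>j. S (2 * j)) \<longlonglongrightarrow> B"
      unfolding B_def by (rule LIMSEQ_incseq_SUP[OF True inc])
    have "decseq (\<lambda>j. c (2 * j))" using dec by (intro decseq_SucI)
    moreover have bdd: "bdd_below (range (\<lambda>j. c (2 * j)))" using even0 by (intro bdd_belowI[of _ 0]) auto
    moreover define a where "a = (INF j. c (2 * j))"
    ultimately have a: "(\<lambda>j. c (2 * j)) \<longlonglongrightarrow> a"
      by (simp add: LIMSEQ_decseq_INF)
    have a_le: "a \<le> c (2 * j)" for j unfolding a_def using bdd by (rule cINF_lower) simp
    \<comment> \<open>Split off the persistent oscillation; the rest converges and stays nonnegative.\<close>
    define e where "e m = (if odd m then a else 0)" for m :: nat
    define r where "r m = (if odd m then c (2 * (m div 2)) - a else 0)" for m :: nat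
    define s where "s m = S (2 * (m div 2)) + r m" for m
    have S_eq: "S m = s m + e m" for m
    proof (cases "odd m")
      case True
      then have "Suc (2 * (m div 2)) = m" by simp
      with True S_odd[of "m div 2"] show ?thesis by (simp add: s_def r_def e_def)
    qed (simp add: s_def r_def e_def)
    have s_lim: "s \<longlonglongrightarrow> B"
    proof -
      have "(\<lambda>m. c (2 * (m div 2)) - a) \<longlonglongrightarrow> a - a"
        by (intro tendsto_intros filterlim_compose[OF a lim_div2])
      then have c0: "(\<lambda>m. c (2 * (m div 2)) - a) \<longlonglongrightarrow> 0" by simp
      have "r \<longlonglongrightarrow> 0"
      proof (rule Lim_null_comparison[OF always_eventually c0], rule allI)
        show "norm (r m) \<le> c (2 * (m div 2)) - a" for m
          using a_le[of "m div 2"] unfolding r_def by (cases "odd m") auto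
      qed
      with filterlim_compose[OF B lim_div2] have "s \<longlonglongrightarrow> B + 0"
        unfolding s_def by (intro tendsto_add) auto
      then show ?thesis by simp
    qed
    have s0: "0 \<le> s m" for m using S0[of "m div 2"] a_le[of "m div 2"]
      unfolding s_def r_def by (cases "odd m") auto
    have "(\<lambda>M. ereal (cesaro s M)) \<longlonglongrightarrow> ereal B"
      using s_lim by (intro cesaro_tendsto s0) simp
    then have "cesaro s \<longlonglongrightarrow> B" by simp
    moreover have "cesaro e \<longlonglongrightarrow> a / 2"
      unfolding e_def by (rule cesaro_odd)
    ultimately have "(\<lambda>M. cesaro s M + cesaro e M) \<longlonglongrightarrow> B + a / 2"
      by (rule tendsto_add)
    then have "cesaro S \<longlonglongrightarrow> B + a / 2"
      by (simp add: cesaro_def[abs_def] S_eq sum.distrib add_divide_distrib)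
    then have "(\<lambda>M. ereal (cesaro S M)) \<longlonglongrightarrow> ereal (B + a / 2)" by simp
    then show ?thesis by blast
  next
    case False
    have "\<forall>\<^sub>F m in sequentially. K < S m" for K
    proof -
      obtain j where j: "K < S (2 * j)"
        using False by (force simp: bdd_above_def not_le)
      show ?thesis
        using eventually_ge_at_top[of "2 * j"]
      proof eventually_elim
        case (elim m)
        then have "j \<le> m div 2" by presburger
        with j have "K < S (2 * (m div 2))" using incseqD[OF inc] by (meson less_le_trans)
        then show ?case using split[of m] S_odd[of "m div 2"] even0[of "m div 2"] by force
      qed
    qed
    then have "(\<lambda>m. ereal (S m)) \<longlonglongrightarrow> \<infinity>"
      by (simp add: tendsto_PInfty)
    from cesaro_tendsto[OF Spos this] show ?thesis by blast
  qed
  from ex Spos show ?thesis by (simp add: S_def[abs_def])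
qed

text \<open>The Abel mean of the series is an average of the Cesaro means of its partial sums with weights
\<open>(1 - l)\<^sup>2 * (k + 1) * l ^ k\<close>; this comes from multiplying twice by the geometric series.\<close>

lemma abel_tendsto_of_cesaro:
  fixes c :: "nat \<Rightarrow> real"
  assumes bnd: "\<And>k. \<bar>c k\<bar> \<le> B" and S0: "\<And>m. 0 \<le> (\<Sum>k<m. c k)"
    and L: "(\<lambda>M. ereal (cesaro (\<lambda>m. \<Sum>k<m. c k) M)) \<longlonglongrightarrow> L"
  shows "((\<lambda>l. ereal (\<Sum>k. l ^ k * c k)) \<longlongrightarrow> L) (at_left 1)"
proof -
  define s where "s m = (\<Sum>k<Suc m. c k)" for m
  define w where "w l k = (1 - l)\<^sup>2 * (real (Suc k) * l ^ k)" for l :: real and k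
  define x where "x k = cesaro s (Suc k)" for k
  have near: "\<forall>\<^sub>F l in at_left (1::real). 0 < l \<and> l < 1"
    unfolding eventually_at_left_field by (intro exI[of _ 0]) auto
  have main: "w l sums 1 \<and> (\<lambda>k. w l k * x k) sums (\<Sum>k. l ^ k * c k)" if l: "0 < l" "l < 1" for l
  proof
    have geo: "summable (\<lambda>k. l ^ k)" "(\<Sum>k. l ^ k) = 1 / (1 - l)"
      using l by (auto simp: summable_geometric suminf_geometric)
    have sc: "summable (\<lambda>k. norm (l ^ k * c k))"
    proof (rule summable_comparison_test')
      show "summable (\<lambda>k. B * l ^ k)" using geo(1) by (rule summable_mult)
      show "norm (norm (l ^ k * c k)) \<le> B * l ^ k" for k
        using bnd[of k] l by (simp add: abs_mult mult.commute mult_left_mono)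
    qed
    have sg: "summable (\<lambda>k. norm (l ^ k))" using geo(1) l by simp
    have "(\<lambda>k. \<Sum>i\<le>k. l ^ i * c i * l ^ (k - i)) sums ((\<Sum>k. l ^ k * c k) * (\<Sum>k. l ^ k))"
      by (rule Cauchy_product_sums[OF sc sg])
    moreover have "(\<Sum>i\<le>k. l ^ i * c i * l ^ (k - i)) = l ^ k * s k" for k
      unfolding s_def sum_distrib_left lessThan_Suc_atMost
      by (intro sum.cong refl) (simp add: power_add[symmetric] mult.assoc mult.left_commute[of _ "c _"] mult.commute)
    ultimately have 1: "(\<lambda>k. l ^ k * s k) sums ((\<Sum>k. l ^ k * c k) / (1 - l))"
      by (simp add: geo)
    have sn: "s k \<ge> 0" for k unfolding s_def by (rule S0)
    have "(\<lambda>k. \<Sum>i\<le>k. l ^ i * s i * l ^ (k - i)) sums ((\<Sum>k. l ^ k * s k) * (\<Sum>k. l ^ k))"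
      using sums_summable[OF 1] sn l by (intro Cauchy_product_sums[OF _ sg]) simp
    moreover have "(\<Sum>i\<le>k. l ^ i * s i * l ^ (k - i)) = l ^ k * (\<Sum>i\<le>k. s i)" for k
      unfolding sum_distrib_left
      by (intro sum.cong refl) (simp add: power_add[symmetric] mult.assoc mult.left_commute[of _ "s _"] mult.commute)
    ultimately have "(\<lambda>k. l ^ k * (\<Sum>i\<le>k. s i)) sums ((\<Sum>k. l ^ k * c k) / (1 - l)\<^sup>2)"
      by (simp add: geo power2_eq_square sums_unique[OF 1, symmetric])
    from sums_mult[OF this, of "(1 - l)\<^sup>2"]
    \<comment> \<open>The factor \<open>k + 1\<close> of the weight cancels the denominator of the Cesaro mean.\<close>
    show "(\<lambda>k. w l k * x k) sums (\<Sum>k. l ^ k * c k)"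
      using l by (simp add: w_def x_def cesaro_def lessThan_Suc_atMost mult.assoc del: sum.lessThan_Suc of_nat_Suc)
    show "w l sums 1"
      using sums_mult[OF geometric_deriv_sums[of l], of "(1 - l)\<^sup>2"] l
      by (simp add: w_def[abs_def] del: of_nat_Suc)
  qed
  have "((\<lambda>l. ereal (\<Sum>k. w l k * x k)) \<longlongrightarrow> L) (at_left 1)"
  proof (rule weighted_average_tendsto)
    show "\<forall>\<^sub>F l in at_left 1. (\<forall>k. 0 \<le> w l k) \<and> w l sums 1 \<and> summable (\<lambda>k. w l k * x k)"
      using near by eventually_elim (use main in \<open>auto simp: w_def sums_iff\<close>)
    have "((\<lambda>l. w l k) \<longlongrightarrow> (1 - 1)\<^sup>2 * (real (Suc k) * 1 ^ k)) (at_left 1)" for k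
      unfolding w_def by (intro tendsto_intros)
    then show "((\<lambda>l. w l k) \<longlongrightarrow> 0) (at_left 1)" for k by simp
    show "0 \<le> x k" for k unfolding x_def cesaro_def s_def by (intro divide_nonneg_nonneg sum_nonneg S0) auto
    have "(\<lambda>M. ereal (cesaro s M)) \<longlonglongrightarrow> L"
      unfolding s_def by (rule cesaro_Suc_tendsto[OF _ L]) simp
    then show "(\<lambda>k. ereal (x k)) \<longlonglongrightarrow> L" unfolding x_def by (rule LIMSEQ_Suc)
  qed
  then show ?thesis
    by (rule Lim_transform_eventually)
       (use near in eventually_elim, use main in \<open>auto simp: sums_iff\<close>)
qed

section \<open>Resolvents of self-adjoint contractions\<close>

lemma L2_measurable [measurable_dest]: "f \<in> L2 \<mu> \<Longrightarrow> f \<in> borel_measurable \<mu>"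
  by (simp add: L2_def)

lemma L2_integrable_power2: "f \<in> L2 \<mu> \<Longrightarrow> integrable \<mu> (\<lambda>x. (f x)\<^sup>2)"
  by (simp add: L2_def)

lemma abs_mult_le_squares: "\<bar>a * b\<bar> \<le> a\<^sup>2 + (b::real)\<^sup>2"
proof -
  have "0 \<le> (\<bar>a\<bar> - \<bar>b\<bar>)\<^sup>2" by simp
  then have "2 * \<bar>a * b\<bar> \<le> a\<^sup>2 + b\<^sup>2" by (simp add: power2_diff abs_mult)
  moreover have "0 \<le> \<bar>a * b\<bar>" by simp
  ultimately show ?thesis by linarith
qed

lemma L2_integrable_mult:
  assumes f: "f \<in> L2 \<mu>" and g: "g \<in> L2 \<mu>"
  shows "integrable \<mu> (\<lambda>x. f x * g x)"
proof (rule Bochner_Integration.integrable_bound)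
  show "integrable \<mu> (\<lambda>x. (f x)\<^sup>2 + (g x)\<^sup>2)"
    using f g by (simp add: L2_integrable_power2)
  show "(\<lambda>x. f x * g x) \<in> borel_measurable \<mu>" using f g by measurable
  show "AE x in \<mu>. norm (f x * g x) \<le> norm ((f x)\<^sup>2 + (g x)\<^sup>2)"
    using abs_mult_le_squares by (intro AE_I2) (simp add: abs_of_nonneg)
qed

lemma L2_lincomb:
  assumes f: "f \<in> L2 \<mu>" and g: "g \<in> L2 \<mu>"
  shows "(\<lambda>x. a * f x + g x) \<in> L2 \<mu>"
proof -
  have "integrable \<mu> (\<lambda>x. a\<^sup>2 * (f x)\<^sup>2 + 2 * a * (f x * g x) + (g x)\<^sup>2)"
    using f g by (intro Bochner_Integration.integrable_add integrable_mult_right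
        L2_integrable_power2 L2_integrable_mult)
  then show ?thesis
    using f g unfolding L2_def
    by (auto simp: power2_sum power_mult_distrib algebra_simps)
qed

lemma L2_zero [simp]: "(\<lambda>x. 0) \<in> L2 \<mu>" by (simp add: L2_def)

lemma L2_diff: "f \<in> L2 \<mu> \<Longrightarrow> g \<in> L2 \<mu> \<Longrightarrow> (\<lambda>x. f x - g x) \<in> L2 \<mu>"
  using L2_lincomb[of g \<mu> f "-1"] by simp

lemma L2_const [simp]: "prob_space \<mu> \<Longrightarrow> (\<lambda>x. c) \<in> L2 \<mu>"
  by (simp add: L2_def prob_space.finite_measure finite_measure.integrable_const)

lemma L2_integrable: "prob_space \<mu> \<Longrightarrow> f \<in> L2 \<mu> \<Longrightarrow> integrable \<mu> f"
  using L2_integrable_mult[of f \<mu> "\<lambda>_. 1"] by simp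

lemma ip_commute: "ip \<mu> f g = ip \<mu> g f"
  by (simp add: ip_def mult.commute)

lemma ip_lincomb_right:
  assumes "f \<in> L2 \<mu>" "g \<in> L2 \<mu>" "h \<in> L2 \<mu>"
  shows "ip \<mu> h (\<lambda>x. a * f x + g x) = a * ip \<mu> h f + ip \<mu> h g"
proof -
  have "ip \<mu> h (\<lambda>x. a * f x + g x) = (\<integral>x. a * (h x * f x) + h x * g x \<partial>\<mu>)"
    unfolding ip_def by (simp add: algebra_simps)
  also have "\<dots> = a * ip \<mu> h f + ip \<mu> h g"
    using assms by (simp add: ip_def L2_integrable_mult)
  finally show ?thesis .
qed

lemma ip_diff_right:
  assumes "f \<in> L2 \<mu>" "g \<in> L2 \<mu>" "h \<in> L2 \<mu>"
  shows "ip \<mu> h (\<lambda>x. f x - g x) = ip \<mu> h f - ip \<mu> h g"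
  using ip_lincomb_right[of g \<mu> f h "-1"] assms by simp

lemma ip_diff_left:
  assumes "f \<in> L2 \<mu>" "g \<in> L2 \<mu>" "h \<in> L2 \<mu>"
  shows "ip \<mu> (\<lambda>x. f x - g x) h = ip \<mu> f h - ip \<mu> g h"
  using ip_diff_right[OF assms] by (simp add: ip_commute)

lemma ip_self_nonneg: "0 \<le> ip \<mu> f f"
  by (simp add: ip_def)

lemma two_abs_ip_le:
  assumes f: "f \<in> L2 \<mu>" and g: "g \<in> L2 \<mu>"
  shows "2 * \<bar>ip \<mu> f g\<bar> \<le> ip \<mu> f f + ip \<mu> g g"
proof -
  have *: "0 \<le> a * a * ip \<mu> f f + 2 * (a * ip \<mu> f g) + ip \<mu> g g" for a
  proof -
    let ?h = "\<lambda>x. a * f x + g x"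
    have "0 \<le> ip \<mu> ?h ?h" by (rule ip_self_nonneg)
    also have "ip \<mu> ?h ?h = a * ip \<mu> ?h f + ip \<mu> ?h g"
      using f g by (intro ip_lincomb_right L2_lincomb)
    also have "\<dots> = a * ip \<mu> f ?h + ip \<mu> g ?h" by (simp add: ip_commute)
    also have "\<dots> = a * a * ip \<mu> f f + 2 * (a * ip \<mu> f g) + ip \<mu> g g"
      unfolding ip_lincomb_right[OF f g f] ip_lincomb_right[OF f g g] ip_commute[of \<mu> g f]
      by (simp add: algebra_simps)
    finally show ?thesis .
  qed
  from *[of 1] *[of "-1"] show ?thesis by (simp add: abs_if)
qed

lemma ip_cong_AE:
  assumes "AE x in \<mu>. f x = f' x" "AE x in \<mu>. g x = g' x"
    and "f \<in> borel_measurable \<mu>" "f' \<in> borel_measurable \<mu>" "g \<in> borel_measurable \<mu>" "g' \<in> borel_measurable \<mu>"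
  shows "ip \<mu> f g = ip \<mu> f' g'"
  unfolding ip_def using assms by (intro integral_cong_AE) auto

text \<open>Elements of \<open>L2\<close> are functions rather than classes of functions, and the operator of a Markov kernel is linear only almost
everywhere. Linearity is therefore required only after taking inner products, which is all that the arguments use.\<close>

locale selfadjoint_contraction =
  fixes \<mu> :: "'e measure" and A :: "('e \<Rightarrow> real) \<Rightarrow> 'e \<Rightarrow> real"
  assumes L2_op: "f \<in> L2 \<mu> \<Longrightarrow> A f \<in> L2 \<mu>"
    and ip_op_lincomb: "f \<in> L2 \<mu> \<Longrightarrow> g \<in> L2 \<mu> \<Longrightarrow> h \<in> L2 \<mu> \<Longrightarrow>
      ip \<mu> h (A (\<lambda>x. a * f x + g x)) = a * ip \<mu> h (A f) + ip \<mu> h (A g)"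
    and ip_op_sym: "f \<in> L2 \<mu> \<Longrightarrow> g \<in> L2 \<mu> \<Longrightarrow> ip \<mu> (A f) g = ip \<mu> f (A g)"
    and op_contraction: "f \<in> L2 \<mu> \<Longrightarrow> ip \<mu> (A f) (A f) \<le> ip \<mu> f f"
begin

lemma L2_pow: "f \<in> L2 \<mu> \<Longrightarrow> (A ^^ k) f \<in> L2 \<mu>"
  by (induction k) (auto intro: L2_op)

lemma ip_op_le: "f \<in> L2 \<mu> \<Longrightarrow> \<bar>ip \<mu> f (A f)\<bar> \<le> ip \<mu> f f"
  using two_abs_ip_le[of f \<mu> "A f"] op_contraction[of f] L2_op[of f] by simp

lemma ip_pow_pow:
  assumes f: "f \<in> L2 \<mu>" and g: "g \<in> L2 \<mu>"
  shows "ip \<mu> ((A ^^ j) f) ((A ^^ k) g) = ip \<mu> f ((A ^^ (j + k)) g)"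
proof (induction j arbitrary: k)
  case (Suc j)
  have "ip \<mu> ((A ^^ Suc j) f) ((A ^^ k) g) = ip \<mu> ((A ^^ j) f) ((A ^^ Suc k) g)"
    using f g by (simp add: ip_op_sym L2_pow)
  with Suc[of "Suc k"] show ?case by simp
qed simp

text \<open>For a centred function and the operator of a reversible kernel this is the autocovariance of the stationary chain, computed with
iterates of the operator instead of powers of the kernel.\<close>

definition autocov :: "('e \<Rightarrow> real) \<Rightarrow> nat \<Rightarrow> real" where
  "autocov f k = ip \<mu> f ((A ^^ k) f)"

text \<open>Moving half of the iterates to the other side by self-adjointness shows the signs: the even terms are squared norms.\<close>

lemma autocov_halves:
  assumes f: "f \<in> L2 \<mu>"
  shows "autocov f (2 * k) = ip \<mu> ((A ^^ k) f) ((A ^^ k) f)"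
    and "autocov f (Suc (2 * k)) = ip \<mu> ((A ^^ k) f) (A ((A ^^ k) f))"
  using ip_pow_pow[OF f f, of k k] ip_pow_pow[OF f f, of k "Suc k"]
  by (simp_all add: autocov_def mult_2)

lemma pow_contraction: "f \<in> L2 \<mu> \<Longrightarrow> ip \<mu> ((A ^^ k) f) ((A ^^ k) f) \<le> ip \<mu> f f"
proof (induction k)
  case (Suc k)
  then show ?case using op_contraction[OF L2_pow[OF Suc.prems], of k] by simp
qed simp

lemma abs_autocov_le:
  assumes "f \<in> L2 \<mu>" shows "\<bar>autocov f k\<bar> \<le> ip \<mu> f f"
  using two_abs_ip_le[of f \<mu> "(A ^^ k) f"] pow_contraction[of f k] L2_pow[of f k] assms
  by (simp add: autocov_def)

text \<open>The common limit stands in for \<open>\<langle>f, (I - A)\<^sup>-\<^sup>1 f\<rangle>\<close>, which need not be finite. The Cesaro form links it to the asymptotic variance,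
the Abel form to the resolvent.\<close>

lemma abel_cesaro_limit:
  assumes f: "f \<in> L2 \<mu>"
  obtains L where "0 \<le> L"
    "(\<lambda>M. ereal (cesaro (\<lambda>m. \<Sum>k<m. autocov f k) M)) \<longlonglongrightarrow> L"
    "((\<lambda>l. ereal (\<Sum>k. l ^ k * autocov f k)) \<longlongrightarrow> L) (at_left 1)"
proof -
  have *: "(\<forall>m. 0 \<le> (\<Sum>k<m. autocov f k)) \<and>
      (\<exists>L. (\<lambda>M. ereal (cesaro (\<lambda>m. \<Sum>k<m. autocov f k) M)) \<longlonglongrightarrow> L)"
  proof (rule cesaro_partial_sums_convergent)
    show "0 \<le> autocov f (2 * j)" for j by (simp add: autocov_halves[OF f] ip_self_nonneg)
    show "autocov f (2 * Suc j) \<le> autocov f (2 * j)" for j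
      unfolding autocov_halves(1)[OF f] using op_contraction[OF L2_pow[OF f]] by simp
    show "0 \<le> autocov f (2 * j) + autocov f (Suc (2 * j))" for j
      using ip_op_le[OF L2_pow[OF f], of j] by (simp add: autocov_halves[OF f])
  qed
  then obtain L where L: "(\<lambda>M. ereal (cesaro (\<lambda>m. \<Sum>k<m. autocov f k) M)) \<longlonglongrightarrow> L" by blast
  show thesis
  proof (rule that[OF _ L abel_tendsto_of_cesaro[OF abs_autocov_le[OF f] _ L]])
    show "0 \<le> L"
    proof (rule Lim_bounded2[OF L, of 0], intro allI impI)
      show "0 \<le> ereal (cesaro (\<lambda>m. \<Sum>k<m. autocov f k) M)" for M
        unfolding cesaro_def using sum_nonneg[of "{..<M}" "\<lambda>m. \<Sum>k<m. autocov f k"] * by simp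
    qed
  qed (use * in blast)
qed

text \<open>Partial sums of the series of \<open>(I - l A)\<^sup>-\<^sup>1 f\<close>. The error in the resolvent equation is a single term,
which vanishes geometrically, so the truncated sums can take the place of the resolvent in all estimates.\<close>

primrec neumann :: "real \<Rightarrow> ('e \<Rightarrow> real) \<Rightarrow> nat \<Rightarrow> 'e \<Rightarrow> real" where
  "neumann l f 0 = (\<lambda>x. 0)"
| "neumann l f (Suc N) = (\<lambda>x. l ^ N * (A ^^ N) f x + neumann l f N x)"

lemma L2_neumann: "f \<in> L2 \<mu> \<Longrightarrow> neumann l f N \<in> L2 \<mu>"
  by (induction N) (auto intro: L2_lincomb L2_pow)

lemma ip_neumann:
  "f \<in> L2 \<mu> \<Longrightarrow> g \<in> L2 \<mu> \<Longrightarrow> ip \<mu> g (neumann l f N) = (\<Sum>k<N. l ^ k * ip \<mu> g ((A ^^ k) f))"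
proof (induction N)
  case 0 then show ?case by (simp add: ip_def)
next
  case (Suc N) then show ?case by (simp add: ip_lincomb_right L2_pow L2_neumann)
qed

lemma ip_op_zero: "h \<in> L2 \<mu> \<Longrightarrow> ip \<mu> h (A (\<lambda>x. 0)) = 0"
  using ip_op_lincomb[of "\<lambda>x. 0" "\<lambda>x. 0" h 1] by simp

lemma resolvent_neumann:
  assumes f: "f \<in> L2 \<mu>" and g: "g \<in> L2 \<mu>"
  shows "ip \<mu> g (neumann l f N) - l * ip \<mu> g (A (neumann l f N)) = ip \<mu> g f - l ^ N * ip \<mu> g ((A ^^ N) f)"
proof (induction N)
  case 0 then show ?case using g by (simp add: ip_op_zero) (simp add: ip_def)
next
  case (Suc N)
  have "ip \<mu> g (neumann l f (Suc N)) = l ^ N * ip \<mu> g ((A ^^ N) f) + ip \<mu> g (neumann l f N)"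
    using f g by (simp add: ip_lincomb_right L2_pow L2_neumann)
  moreover have "ip \<mu> g (A (neumann l f (Suc N))) = l ^ N * ip \<mu> g ((A ^^ Suc N) f) + ip \<mu> g (A (neumann l f N))"
    using f g by (simp add: ip_op_lincomb L2_pow L2_neumann)
  ultimately show ?case using Suc by (simp add: distrib_left)
qed

lemma summable_abel:
  assumes f: "f \<in> L2 \<mu>" and l: "0 \<le> l" "l < 1"
  shows "summable (\<lambda>k. l ^ k * autocov f k)"
proof (rule summable_comparison_test')
  show "summable (\<lambda>k. ip \<mu> f f * l ^ k)" using l by (intro summable_mult summable_geometric) simp
  show "norm (l ^ k * autocov f k) \<le> ip \<mu> f f * l ^ k" for k
    using abs_autocov_le[OF f, of k] l by (simp add: abs_mult mult.commute mult_left_mono)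
qed

lemma abs_ip_neumann_le:
  assumes f: "f \<in> L2 \<mu>" and g: "g \<in> L2 \<mu>" and gf: "ip \<mu> g g \<le> ip \<mu> f f" and l: "0 \<le> l" "l < 1"
  shows "\<bar>ip \<mu> g (neumann l f N)\<bar> \<le> ip \<mu> f f / (1 - l)"
proof -
  have "\<bar>ip \<mu> g ((A ^^ k) f)\<bar> \<le> ip \<mu> f f" for k
    using two_abs_ip_le[OF g L2_pow[OF f], of k] pow_contraction[OF f, of k] gf by simp
  then have "\<bar>ip \<mu> g (neumann l f N)\<bar> \<le> (\<Sum>k<N. l ^ k * ip \<mu> f f)"
    unfolding ip_neumann[OF f g] using l
    by (intro order_trans[OF sum_abs] sum_mono) (simp add: abs_mult mult_left_mono)
  also have "\<dots> = (\<Sum>k<N. l ^ k) * ip \<mu> f f" by (simp add: sum_distrib_right)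
  also have "\<dots> \<le> (1 / (1 - l)) * ip \<mu> f f"
  proof (rule mult_right_mono[OF _ ip_self_nonneg])
    have "(\<Sum>k<N. l ^ k) \<le> (\<Sum>k. l ^ k)"
      using l by (intro sum_le_suminf summable_geometric) auto
    also have "\<dots> = 1 / (1 - l)" using l by (intro suminf_geometric) simp
    finally show "(\<Sum>k<N. l ^ k) \<le> 1 / (1 - l)" .
  qed
  finally show ?thesis by simp
qed

lemma remainder_tendsto:
  assumes f: "f \<in> L2 \<mu>" and l: "0 \<le> l" "l < 1" and l': "0 \<le> l'" "l' < 1"
    and g: "\<And>N. g N \<in> L2 \<mu>" "\<And>N. ip \<mu> (g N) (g N) \<le> ip \<mu> f f"
  shows "(\<lambda>N. l' ^ N * ip \<mu> (neumann l f N) (g N)) \<longlonglongrightarrow> 0"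
proof (rule Lim_null_comparison)
  show "(\<lambda>N. l' ^ N * (ip \<mu> f f / (1 - l))) \<longlonglongrightarrow> 0"
    using l' by (intro tendsto_mult_left_zero LIMSEQ_realpow_zero)
  show "\<forall>\<^sub>F N in sequentially. norm (l' ^ N * ip \<mu> (neumann l f N) (g N)) \<le> l' ^ N * (ip \<mu> f f / (1 - l))"
  proof (intro always_eventually allI)
    fix N
    show "norm (l' ^ N * ip \<mu> (neumann l f N) (g N)) \<le> l' ^ N * (ip \<mu> f f / (1 - l))"
      using mult_left_mono[OF abs_ip_neumann_le[OF f g(1)[of N] g(2)[of N] l, of N], of "l' ^ N"] l'
      by (simp add: abs_mult ip_commute[of \<mu> "g N"])
  qed
qed

lemma neumann_tendsto:
  assumes f: "f \<in> L2 \<mu>" and l: "0 \<le> l" "l < 1"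
  shows "(\<lambda>N. ip \<mu> f (neumann l f N)) \<longlonglongrightarrow> (\<Sum>k. l ^ k * autocov f k)"
  using summable_LIMSEQ[OF summable_abel[OF assms]] by (simp add: ip_neumann f autocov_def)

end

text \<open>Order reversal of the inverse. With \<open>u\<close> and \<open>v\<close> the truncated resolvents of \<open>A\<close> and \<open>B\<close>, expand
\<open>0 \<le> \<langle>v - \<kappa> u, (I - l' B) (v - \<kappa> u)\<rangle>\<close> and replace the quadratic term in \<open>u\<close> by the one for \<open>A\<close> using the
domination hypothesis. The parameter of \<open>B\<close> depends on \<open>r\<close>, because
\<open>(1 - l) I + l r (I - B)\<close> equals \<open>\<kappa> (I - l' B)\<close> exactly for \<open>\<kappa> = 1 - l + l r\<close> and \<open>l' = l r / \<kappa>\<close>.\<close>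

lemma resolvent_comparison:
  assumes A: "selfadjoint_contraction \<mu> A" and B: "selfadjoint_contraction \<mu> B"
    and r: "0 < r"
    and dom: "\<And>g. g \<in> L2 \<mu> \<Longrightarrow> r * (ip \<mu> g g - ip \<mu> g (B g)) \<le> ip \<mu> g g - ip \<mu> g (A g)"
    and f: "f \<in> L2 \<mu>" and l: "0 \<le> l" "l < 1"
  defines "\<kappa> \<equiv> 1 - l + l * r"
  shows "\<kappa> * (\<Sum>k. l ^ k * selfadjoint_contraction.autocov \<mu> A f k)
      \<le> (\<Sum>k. (l * r / \<kappa>) ^ k * selfadjoint_contraction.autocov \<mu> B f k)"
proof -
  interpret A: selfadjoint_contraction \<mu> A by fact
  interpret B: selfadjoint_contraction \<mu> B by fact
  have \<kappa>: "0 < \<kappa>" using r l by (simp add: \<kappa>_def add_pos_nonneg)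
  define l' where "l' = l * r / \<kappa>"
  have \<kappa>l': "\<kappa> * l' = l * r" using \<kappa> by (simp add: l'_def)
  have l': "0 \<le> l'" "l' < 1"
    using l r \<kappa> by (auto simp: l'_def) (simp add: \<kappa>_def)
  define u v where "u N = A.neumann l f N" and "v N = B.neumann l' f N" for N
  have uv: "u N \<in> L2 \<mu>" "v N \<in> L2 \<mu>" for N
    using f by (auto simp: u_def v_def A.L2_neumann B.L2_neumann)
  have key: "0 \<le> ip \<mu> f (v N) - l' ^ N * ip \<mu> (v N) ((B ^^ N) f)
      - 2 * \<kappa> * (ip \<mu> f (u N) - l' ^ N * ip \<mu> (u N) ((B ^^ N) f))
      + \<kappa> * (ip \<mu> f (u N) - l ^ N * ip \<mu> (u N) ((A ^^ N) f))" for N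
  proof -
    \<comment> \<open>If the domination is an equality, \<open>v N\<close> is \<open>\<kappa> * u N\<close> in the limit, and nothing is lost.\<close>
    define d where "d = (\<lambda>x. (- \<kappa>) * u N x + v N x)"
    have d: "d \<in> L2 \<mu>" unfolding d_def by (intro L2_lincomb uv)
    have Bd: "ip \<mu> g (B d) = - \<kappa> * ip \<mu> g (B (u N)) + ip \<mu> g (B (v N))" if "g \<in> L2 \<mu>" for g
      unfolding d_def by (intro B.ip_op_lincomb that uv)
    have gd: "ip \<mu> g d = - \<kappa> * ip \<mu> g (u N) + ip \<mu> g (v N)" if "g \<in> L2 \<mu>" for g
      unfolding d_def by (intro ip_lincomb_right that uv)
    have "l' * ip \<mu> d (B d) \<le> l' * ip \<mu> d d"
      using B.ip_op_le[OF d] l' by (intro mult_left_mono) auto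
    also have "\<dots> \<le> ip \<mu> d d" using l' ip_self_nonneg[of \<mu> d] by (simp add: mult_left_le_one_le)
    finally have pos: "0 \<le> ip \<mu> d d - l' * ip \<mu> d (B d)" by simp
    have Dv: "ip \<mu> g (v N) - l' * ip \<mu> g (B (v N)) = ip \<mu> g f - l' ^ N * ip \<mu> g ((B ^^ N) f)"
      if "g \<in> L2 \<mu>" for g
      unfolding v_def by (rule B.resolvent_neumann[OF f that])
    have Du: "ip \<mu> g (u N) - l * ip \<mu> g (A (u N)) = ip \<mu> g f - l ^ N * ip \<mu> g ((A ^^ N) f)"
      if "g \<in> L2 \<mu>" for g
      unfolding u_def by (rule A.resolvent_neumann[OF f that])
    have ex: "ip \<mu> d d - l' * ip \<mu> d (B d)
        = (ip \<mu> (v N) (v N) - l' * ip \<mu> (v N) (B (v N)))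
          - 2 * \<kappa> * (ip \<mu> (u N) (v N) - l' * ip \<mu> (u N) (B (v N)))
          + \<kappa> * (\<kappa> * ip \<mu> (u N) (u N) - \<kappa> * l' * ip \<mu> (u N) (B (u N)))"
    proof -
      have "ip \<mu> d d = - \<kappa> * ip \<mu> (u N) d + ip \<mu> (v N) d"
        using gd[OF d] ip_commute[of \<mu> d] by metis
      then have dd: "ip \<mu> d d = \<kappa> * \<kappa> * ip \<mu> (u N) (u N) - 2 * \<kappa> * ip \<mu> (u N) (v N) + ip \<mu> (v N) (v N)"
        unfolding gd[OF uv(1)] gd[OF uv(2)] ip_commute[of \<mu> "v N" "u N"] by (simp add: algebra_simps)
      have sym: "ip \<mu> (v N) (B (u N)) = ip \<mu> (u N) (B (v N))"
        using B.ip_op_sym[OF uv(1) uv(2), of N N] ip_commute by metis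
      have "ip \<mu> d (B d) = - \<kappa> * ip \<mu> (u N) (B d) + ip \<mu> (v N) (B d)"
        using gd[OF B.L2_op[OF d]] ip_commute[of \<mu> "B d"] by metis
      then have dBd: "ip \<mu> d (B d) = \<kappa> * \<kappa> * ip \<mu> (u N) (B (u N)) - 2 * \<kappa> * ip \<mu> (u N) (B (v N))
          + ip \<mu> (v N) (B (v N))"
        unfolding Bd[OF uv(1)] Bd[OF uv(2)] sym by (simp add: algebra_simps)
      show ?thesis
        unfolding dd dBd by (simp add: algebra_simps)
    qed
    have "\<kappa> * ip \<mu> (u N) (u N) - \<kappa> * l' * ip \<mu> (u N) (B (u N))
        = (1 - l) * ip \<mu> (u N) (u N) + l * (r * (ip \<mu> (u N) (u N) - ip \<mu> (u N) (B (u N))))"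
      by (simp add: \<kappa>l') (simp add: \<kappa>_def algebra_simps)
    also have "\<dots> \<le> (1 - l) * ip \<mu> (u N) (u N) + l * (ip \<mu> (u N) (u N) - ip \<mu> (u N) (A (u N)))"
      using l by (intro add_left_mono mult_left_mono dom uv)
    also have "\<dots> = ip \<mu> (u N) f - l ^ N * ip \<mu> (u N) ((A ^^ N) f)"
      using Du[OF uv(1)] by (simp add: algebra_simps)
    finally have "\<kappa> * (\<kappa> * ip \<mu> (u N) (u N) - \<kappa> * l' * ip \<mu> (u N) (B (u N)))
        \<le> \<kappa> * (ip \<mu> (u N) f - l ^ N * ip \<mu> (u N) ((A ^^ N) f))"
      using \<kappa> by (intro mult_left_mono) auto
    with pos show ?thesis
      unfolding ex Dv[OF uv(1)] Dv[OF uv(2)] by (simp add: ip_commute[of \<mu> f])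
  qed
  define a b where "a = (\<Sum>k. l ^ k * A.autocov f k)" and "b = (\<Sum>k. l' ^ k * B.autocov f k)"
  have "(\<lambda>N. ip \<mu> f (v N) - l' ^ N * ip \<mu> (v N) ((B ^^ N) f)
      - 2 * \<kappa> * (ip \<mu> f (u N) - l' ^ N * ip \<mu> (u N) ((B ^^ N) f))
      + \<kappa> * (ip \<mu> f (u N) - l ^ N * ip \<mu> (u N) ((A ^^ N) f)))
      \<longlonglongrightarrow> b - 0 - 2 * \<kappa> * (a - 0) + \<kappa> * (a - 0)"
    unfolding u_def v_def a_def b_def using f l l'
    by (intro tendsto_add tendsto_diff tendsto_mult tendsto_const A.remainder_tendsto B.remainder_tendsto
        A.neumann_tendsto B.neumann_tendsto A.L2_pow B.L2_pow A.pow_contraction B.pow_contraction)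
  from LIMSEQ_le_const[OF this] key have "0 \<le> b - 0 - 2 * \<kappa> * (a - 0) + \<kappa> * (a - 0)" by blast
  then have "\<kappa> * a \<le> b" by simp
  then show ?thesis by (simp add: a_def b_def l'_def)
qed

text \<open>As \<open>l\<close> increases to \<open>1\<close>, the factor \<open>\<kappa>\<close> tends to \<open>r\<close> and the parameter \<open>l r / \<kappa>\<close> also increases to \<open>1\<close>.\<close>

lemma resolvent_limit_comparison:
  fixes L L' :: ereal
  assumes A: "selfadjoint_contraction \<mu> A" and B: "selfadjoint_contraction \<mu> B"
    and r: "0 < r"
    and dom: "\<And>g. g \<in> L2 \<mu> \<Longrightarrow> r * (ip \<mu> g g - ip \<mu> g (B g)) \<le> ip \<mu> g g - ip \<mu> g (A g)"
    and f: "f \<in> L2 \<mu>"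
    and L: "((\<lambda>l. ereal (\<Sum>k. l ^ k * selfadjoint_contraction.autocov \<mu> A f k)) \<longlongrightarrow> L) (at_left 1)"
    and L': "((\<lambda>l. ereal (\<Sum>k. l ^ k * selfadjoint_contraction.autocov \<mu> B f k)) \<longlongrightarrow> L') (at_left 1)"
  shows "ereal r * L \<le> L'"
proof -
  define \<kappa> where "\<kappa> l = 1 - l + l * r" for l
  have near: "\<forall>\<^sub>F l in at_left (1::real). 0 < l \<and> l < 1"
    unfolding eventually_at_left_field by (intro exI[of _ 0]) auto
  have k: "(\<kappa> \<longlongrightarrow> 1 - 1 + 1 * r) (at_left 1)"
    unfolding \<kappa>_def by (intro tendsto_intros)
  then have lim1: "((\<lambda>l. ereal (\<kappa> l)) \<longlongrightarrow> ereal r) (at_left 1)" by simp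
  have "((\<lambda>l. l * r / \<kappa> l) \<longlongrightarrow> 1 * r / (1 - 1 + 1 * r)) (at_left 1)"
    using r by (intro tendsto_intros k) auto
  then have "((\<lambda>l. l * r / \<kappa> l) \<longlongrightarrow> 1) (at_left 1)" using r by simp
  moreover have "\<forall>\<^sub>F l in at_left 1. l * r / \<kappa> l < 1"
    using near
  proof eventually_elim
    case (elim l)
    then have "0 < \<kappa> l" using r by (simp add: \<kappa>_def add_pos_nonneg)
    with elim show ?case by (simp add: \<kappa>_def)
  qed
  ultimately have "filterlim (\<lambda>l. l * r / \<kappa> l) (at_left 1) (at_left 1)"
    by (auto simp: filterlim_at elim: eventually_mono)
  from filterlim_compose[OF L' this] have 2: "((\<lambda>l. ereal (\<Sum>k. (l * r / \<kappa> l) ^ k *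
      selfadjoint_contraction.autocov \<mu> B f k)) \<longlongrightarrow> L') (at_left 1)" .
  have 3: "((\<lambda>l. ereal (\<kappa> l) * ereal (\<Sum>k. l ^ k * selfadjoint_contraction.autocov \<mu> A f k)) \<longlongrightarrow> ereal r * L) (at_left 1)"
    using r by (intro tendsto_mult_ereal lim1 L) auto
  show ?thesis
  proof (rule tendsto_le[OF _ 2 3])
    show "\<forall>\<^sub>F l in at_left 1. ereal (\<kappa> l) * ereal (\<Sum>k. l ^ k * selfadjoint_contraction.autocov \<mu> A f k)
        \<le> ereal (\<Sum>k. (l * r / \<kappa> l) ^ k * selfadjoint_contraction.autocov \<mu> B f k)"
      using near
    proof eventually_elim
      case (elim l)
      then show ?case
        using resolvent_comparison[OF A B r dom f, of l] by (simp add: \<kappa>_def)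
    qed
  qed simp
qed

section \<open>Integration along kernels\<close>

lemma bind_integral_nonneg:
  fixes h :: "'b \<Rightarrow> real"
  assumes N[measurable]: "N \<in> M \<rightarrow>\<^sub>M subprob_algebra B" and h[measurable]: "h \<in> borel_measurable B"
    and int: "integrable (M \<bind> N) h" and nn: "\<And>y. 0 \<le> h y"
  shows "AE x in M. integrable (N x) h" "integrable M (\<lambda>x. \<integral>y. h y \<partial>N x)"
    "(\<integral>y. h y \<partial>(M \<bind> N)) = (\<integral>x. \<integral>y. h y \<partial>N x \<partial>M)"
proof -
  have hN[measurable]: "h \<in> borel_measurable (N x)" if "x \<in> space M" for x
    using that subprob_measurableD(2)[OF N] by (simp cong: measurable_cong_sets)
  have eq: "(\<integral>\<^sup>+y. ennreal (h y) \<partial>(M \<bind> N)) = (\<integral>\<^sup>+x. \<integral>\<^sup>+y. ennreal (h y) \<partial>N x \<partial>M)"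
    by (rule nn_integral_bind[OF _ N]) simp
  have fin: "(\<integral>\<^sup>+y. ennreal (h y) \<partial>(M \<bind> N)) < \<infinity>"
    using int nn by (simp add: integrable_iff_bounded)
  have "AE x in M. (\<integral>\<^sup>+y. ennreal (h y) \<partial>N x) \<noteq> \<infinity>"
    using fin unfolding eq by (intro nn_integral_PInf_AE) auto
  then have ae: "AE x in M. x \<in> space M \<and> (\<integral>\<^sup>+y. ennreal (h y) \<partial>N x) < \<infinity>"
    using AE_space by eventually_elim (simp add: less_top)
  from ae show "AE x in M. integrable (N x) h"
    by eventually_elim (simp add: integrable_iff_bounded nn hN)
  have inner: "(\<integral>y. h y \<partial>N x) = enn2real (\<integral>\<^sup>+y. ennreal (h y) \<partial>N x)" if "x \<in> space M" for x
    using that by (intro integral_eq_nn_integral) (auto simp: nn hN)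
  have meas: "(\<lambda>x. \<integral>y. h y \<partial>N x) \<in> borel_measurable M" by measurable
  have eq2: "(\<integral>\<^sup>+x. ennreal (\<integral>y. h y \<partial>N x) \<partial>M) = (\<integral>\<^sup>+y. ennreal (h y) \<partial>(M \<bind> N))"
    unfolding eq by (intro nn_integral_cong_AE, use ae in eventually_elim) (simp add: inner)
  show "integrable M (\<lambda>x. \<integral>y. h y \<partial>N x)"
    using fin by (simp add: integrable_iff_bounded meas nn eq2)
  show "(\<integral>y. h y \<partial>(M \<bind> N)) = (\<integral>x. \<integral>y. h y \<partial>N x \<partial>M)"
    using int by (subst (1 2) integral_eq_nn_integral) (auto simp: meas nn eq2)
qed

text \<open>Fubini for a kernel and an unbounded integrand. Integrability of the inner integrals holds only almost everywhere,
and where it fails the Bochner integral is \<open>0\<close>; this is why the positive and negative parts are integrated separately.\<close>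

lemma bind_integral:
  fixes h :: "'b \<Rightarrow> real"
  assumes N[measurable]: "N \<in> M \<rightarrow>\<^sub>M subprob_algebra B" and h[measurable]: "h \<in> borel_measurable B"
    and int: "integrable (M \<bind> N) h"
  shows "AE x in M. integrable (N x) h" "integrable M (\<lambda>x. \<integral>y. h y \<partial>N x)"
    "(\<integral>y. h y \<partial>(M \<bind> N)) = (\<integral>x. \<integral>y. h y \<partial>N x \<partial>M)"
proof -
  define p n where "p y = max 0 (h y)" and "n y = max 0 (- h y)" for y
  have pn: "h y = p y - n y" "0 \<le> p y" "0 \<le> n y" for y by (auto simp: p_def n_def)
  have m[measurable]: "p \<in> borel_measurable B" "n \<in> borel_measurable B"
    unfolding p_def n_def by measurable
  have i: "integrable (M \<bind> N) p" "integrable (M \<bind> N) n"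
    unfolding p_def n_def using int by simp_all
  note P = bind_integral_nonneg[OF N m(1) i(1) pn(2)] and R = bind_integral_nonneg[OF N m(2) i(2) pn(3)]
  have h_eq: "h = (\<lambda>y. p y - n y)" by (simp add: pn fun_eq_iff)
  have ae: "AE x in M. integrable (N x) p \<and> integrable (N x) n"
    using P(1) R(1) by eventually_elim simp
  then show "AE x in M. integrable (N x) h"
    unfolding h_eq by eventually_elim simp
  have eq: "AE x in M. (\<integral>y. p y \<partial>N x) - (\<integral>y. n y \<partial>N x) = (\<integral>y. h y \<partial>N x)"
    unfolding h_eq using ae by eventually_elim simp
  have meas: "(\<lambda>x. \<integral>y. h y \<partial>N x) \<in> borel_measurable M"
    "(\<lambda>x. (\<integral>y. p y \<partial>N x) - (\<integral>y. n y \<partial>N x)) \<in> borel_measurable M" by measurable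
  show "integrable M (\<lambda>x. \<integral>y. h y \<partial>N x)"
    using integrable_cong_AE[OF meas(2) meas(1) eq] P(2) R(2) by simp
  have "(\<integral>y. h y \<partial>(M \<bind> N)) = (\<integral>y. p y \<partial>(M \<bind> N)) - (\<integral>y. n y \<partial>(M \<bind> N))"
    unfolding h_eq using i by simp
  also have "\<dots> = (\<integral>x. (\<integral>y. p y \<partial>N x) - (\<integral>y. n y \<partial>N x) \<partial>M)"
    using P R by simp
  also have "\<dots> = (\<integral>x. \<integral>y. h y \<partial>N x \<partial>M)"
    by (rule integral_cong_AE[OF meas(2) meas(1) eq])
  finally show "(\<integral>y. h y \<partial>(M \<bind> N)) = (\<integral>x. \<integral>y. h y \<partial>N x \<partial>M)" .
qed

lemma (in prob_space) integral_power2_le: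
  fixes f :: "'a \<Rightarrow> real"
  assumes f: "f \<in> L2 M" shows "(\<integral>x. f x \<partial>M)\<^sup>2 \<le> (\<integral>x. (f x)\<^sup>2 \<partial>M)"
  using variance_positive[of f] variance_eq[OF L2_integrable[OF prob_space_axioms f] L2_integrable_power2[OF f]]
  by simp

text \<open>Jensen's inequality: conditional expectation is a contraction.\<close>

lemma L2_kernel:
  fixes f :: "'b \<Rightarrow> real"
  assumes N: "N \<in> M \<rightarrow>\<^sub>M prob_algebra B" and M: "prob_space M" and f: "f \<in> L2 (M \<bind> N)"
  shows "AE x in M. f \<in> L2 (N x)" "(\<lambda>x. \<integral>y. f y \<partial>N x) \<in> L2 M"
    "(\<integral>x. (\<integral>y. f y \<partial>N x)\<^sup>2 \<partial>M) \<le> (\<integral>y. (f y)\<^sup>2 \<partial>(M \<bind> N))"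
    "integrable M (\<lambda>x. \<integral>y. (f y)\<^sup>2 \<partial>N x)"
    "(\<integral>y. (f y)\<^sup>2 \<partial>(M \<bind> N)) = (\<integral>x. \<integral>y. (f y)\<^sup>2 \<partial>N x \<partial>M)"
proof -
  interpret M: prob_space M by fact
  note N'[measurable] = measurable_prob_algebraD[OF N]
  have sets: "sets (M \<bind> N) = sets B"
    using M.not_empty by (intro sets_bind[OF subprob_measurableD(2)[OF N']]) auto
  have fB[measurable]: "f \<in> borel_measurable B"
    using L2_measurable[OF f] by (simp add: measurable_cong_sets[OF sets refl])
  note sq = bind_integral[OF N' borel_measurable_power[OF fB] L2_integrable_power2[OF f]]
  have in_N: "prob_space (N x)" "sets (N x) = sets B" if "x \<in> space M" for x
    using measurable_space[OF N that] by (auto simp: space_prob_algebra)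
  show ae: "AE x in M. f \<in> L2 (N x)"
    using sq(1) AE_space
    by eventually_elim (auto simp: L2_def in_N(2) cong: measurable_cong_sets)
  show sqi: "integrable M (\<lambda>x. \<integral>y. (f y)\<^sup>2 \<partial>N x)" and
    eq: "(\<integral>y. (f y)\<^sup>2 \<partial>(M \<bind> N)) = (\<integral>x. \<integral>y. (f y)\<^sup>2 \<partial>N x \<partial>M)" by fact+
  have le: "AE x in M. (\<integral>y. f y \<partial>N x)\<^sup>2 \<le> (\<integral>y. (f y)\<^sup>2 \<partial>N x)"
    using ae AE_space by eventually_elim (intro prob_space.integral_power2_le in_N)
  have int: "integrable M (\<lambda>x. (\<integral>y. f y \<partial>N x)\<^sup>2)"
    by (rule Bochner_Integration.integrable_bound[OF sqi]) (use le in \<open>auto elim: eventually_mono\<close>)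
  then show "(\<lambda>x. \<integral>y. f y \<partial>N x) \<in> L2 M" by (simp add: L2_def)
  show "(\<integral>x. (\<integral>y. f y \<partial>N x)\<^sup>2 \<partial>M) \<le> (\<integral>y. (f y)\<^sup>2 \<partial>(M \<bind> N))"
    unfolding eq by (rule integral_mono_AE[OF int sqi le])
qed

text \<open>The semidirect product of a law and a kernel. Inner products \<open>\<langle>f, K g\<rangle>\<close> become integrals of \<open>f x * g y\<close> against it,
so that identities between them reduce to identities between measures.\<close>

definition graph_law :: "'a measure \<Rightarrow> 'b measure \<Rightarrow> ('a \<Rightarrow> 'b measure) \<Rightarrow> ('a \<times> 'b) measure" where
  "graph_law M B K = M \<bind> (\<lambda>x. K x \<bind> (\<lambda>y. return (M \<Otimes>\<^sub>M B) (x, y)))"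

locale graph_kernel = prob_space M for M :: "'a measure" +
  fixes B :: "'b measure" and K :: "'a \<Rightarrow> 'b measure"
  assumes K: "K \<in> M \<rightarrow>\<^sub>M prob_algebra B"
begin

lemma K_subprob[measurable]: "K \<in> M \<rightarrow>\<^sub>M subprob_algebra B"
  by (rule measurable_prob_algebraD[OF K])

lemma prob_K: "x \<in> space M \<Longrightarrow> prob_space (K x)"
  and sets_K: "x \<in> space M \<Longrightarrow> sets (K x) = sets B"
  using measurable_space[OF K] by (auto simp: space_prob_algebra)

lemma pair_kernel_eq_distr:
  assumes x: "x \<in> space M"
  shows "K x \<bind> (\<lambda>y. return (M \<Otimes>\<^sub>M B) (x, y)) = distr (K x) (M \<Otimes>\<^sub>M B) (Pair x)"
proof -
  have "Pair x \<in> B \<rightarrow>\<^sub>M M \<Otimes>\<^sub>M B" using x by simp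
  then have "Pair x \<in> K x \<rightarrow>\<^sub>M M \<Otimes>\<^sub>M B" by (simp cong: measurable_cong_sets add: sets_K[OF x])
  then show ?thesis
    using prob_space.not_empty[OF prob_K[OF x]] by (simp add: bind_return_distr')
qed

lemma pair_kernel[measurable]: "(\<lambda>x. K x \<bind> (\<lambda>y. return (M \<Otimes>\<^sub>M B) (x, y))) \<in> M \<rightarrow>\<^sub>M prob_algebra (M \<Otimes>\<^sub>M B)"
  by (rule measurable_bind_prob_space2[OF K]) (simp add: measurable_split_conv)

lemma pair_kernel_subprob[measurable]:
  "(\<lambda>x. K x \<bind> (\<lambda>y. return (M \<Otimes>\<^sub>M B) (x, y))) \<in> M \<rightarrow>\<^sub>M subprob_algebra (M \<Otimes>\<^sub>M B)"
  by (rule measurable_prob_algebraD[OF pair_kernel])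

lemma sets_graph_law: "sets (graph_law M B K) = sets (M \<Otimes>\<^sub>M B)"
  unfolding graph_law_def
  using not_empty by (intro sets_bind[OF subprob_measurableD(2)[OF pair_kernel_subprob]]) auto

lemma in_prob_algebra: "M \<in> space (prob_algebra M)"
  by (simp add: space_prob_algebra prob_space_axioms)

lemma prob_graph_law: "prob_space (graph_law M B K)"
  unfolding graph_law_def by (rule prob_space_bind'[OF in_prob_algebra pair_kernel])

lemma nn_integral_graph_law:
  assumes F[measurable]: "F \<in> borel_measurable (M \<Otimes>\<^sub>M B)"
  shows "(\<integral>\<^sup>+z. F z \<partial>graph_law M B K) = (\<integral>\<^sup>+x. \<integral>\<^sup>+y. F (x, y) \<partial>K x \<partial>M)"
  unfolding graph_law_def nn_integral_bind[OF F pair_kernel_subprob]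
proof (intro nn_integral_cong)
  fix x assume x: "x \<in> space M"
  then have "Pair x \<in> K x \<rightarrow>\<^sub>M M \<Otimes>\<^sub>M B"
    by (simp cong: measurable_cong_sets add: sets_K[OF x])
  then show "(\<integral>\<^sup>+z. F z \<partial>(K x \<bind> (\<lambda>y. return (M \<Otimes>\<^sub>M B) (x, y)))) = (\<integral>\<^sup>+y. F (x, y) \<partial>K x)"
    unfolding pair_kernel_eq_distr[OF x] by (simp add: nn_integral_distr)
qed

lemma integral_graph_law:
  fixes F :: "'a \<times> 'b \<Rightarrow> real"
  assumes F[measurable]: "F \<in> borel_measurable (M \<Otimes>\<^sub>M B)" and int: "integrable (graph_law M B K) F"
  shows "AE x in M. integrable (K x) (\<lambda>y. F (x, y))"
    "integrable M (\<lambda>x. \<integral>y. F (x, y) \<partial>K x)"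
    "(\<integral>z. F z \<partial>graph_law M B K) = (\<integral>x. \<integral>y. F (x, y) \<partial>K x \<partial>M)"
proof -
  let ?K = "\<lambda>x. K x \<bind> (\<lambda>y. return (M \<Otimes>\<^sub>M B) (x, y))"
  have P: "Pair x \<in> K x \<rightarrow>\<^sub>M M \<Otimes>\<^sub>M B" if "x \<in> space M" for x
    using that by (simp cong: measurable_cong_sets add: sets_K)
  have 1: "integrable (?K x) F \<longleftrightarrow> integrable (K x) (\<lambda>y. F (x, y))"
    and 2: "(\<integral>z. F z \<partial>?K x) = (\<integral>y. F (x, y) \<partial>K x)" if "x \<in> space M" for x
    unfolding pair_kernel_eq_distr[OF that] using P[OF that]
    by (simp_all add: integrable_distr_eq integral_distr)
  note bi = bind_integral[OF pair_kernel_subprob F int[unfolded graph_law_def]]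
  show "AE x in M. integrable (K x) (\<lambda>y. F (x, y))"
    using bi(1) AE_space by eventually_elim (simp add: 1)
  show "integrable M (\<lambda>x. \<integral>y. F (x, y) \<partial>K x)"
    using bi(2) by (simp add: 2 cong: Bochner_Integration.integrable_cong)
  show "(\<integral>z. F z \<partial>graph_law M B K) = (\<integral>x. \<integral>y. F (x, y) \<partial>K x \<partial>M)"
    unfolding graph_law_def bi(3) by (intro Bochner_Integration.integral_cong refl 2)
qed

lemma emeasure_graph_law_Times:
  assumes a[measurable]: "a \<in> sets M" and b[measurable]: "b \<in> sets B"
  shows "emeasure (graph_law M B K) (a \<times> b) = (\<integral>\<^sup>+x. emeasure (K x) b * indicator a x \<partial>M)"
proof -
  have "emeasure (graph_law M B K) (a \<times> b) = (\<integral>\<^sup>+z. indicator (a \<times> b) z \<partial>graph_law M B K)"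
    by (subst nn_integral_indicator) (auto simp: sets_graph_law)
  also have "\<dots> = (\<integral>\<^sup>+x. \<integral>\<^sup>+y. indicator (a \<times> b) (x, y) \<partial>K x \<partial>M)"
    by (rule nn_integral_graph_law) simp
  also have "\<dots> = (\<integral>\<^sup>+x. emeasure (K x) b * indicator a x \<partial>M)"
  proof (rule nn_integral_cong)
    fix x assume x: "x \<in> space M"
    have "(\<integral>\<^sup>+y. indicator (a \<times> b) (x, y) \<partial>K x) = (\<integral>\<^sup>+y. indicator a x * indicator b y \<partial>K x)"
      by (intro nn_integral_cong) (auto simp: indicator_def)
    also have "\<dots> = indicator a x * emeasure (K x) b"
      using x by (subst nn_integral_cmult_indicator) (auto simp: sets_K)
    finally show "(\<integral>\<^sup>+y. indicator (a \<times> b) (x, y) \<partial>K x) = emeasure (K x) b * indicator a x"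
      by (simp add: mult.commute)
  qed
  finally show ?thesis .
qed

lemma bind_eq_distr_graph_law: "M \<bind> K = distr (graph_law M B K) B snd"
  and distr_fst_graph_law: "distr (graph_law M B K) M fst = M"
proof -
  have [measurable_cong]: "sets (graph_law M B K) = sets (M \<Otimes>\<^sub>M B)" by (rule sets_graph_law)
  have sets_bK: "sets (M \<bind> K) = sets B"
    using not_empty by (intro sets_bind[OF subprob_measurableD(2)[OF K_subprob]]) auto
  show "M \<bind> K = distr (graph_law M B K) B snd"
  proof (rule measure_eqI)
    show "sets (M \<bind> K) = sets (distr (graph_law M B K) B snd)" by (simp add: sets_bK)
    fix A assume "A \<in> sets (M \<bind> K)"
    then have A[measurable]: "A \<in> sets B" by (simp add: sets_bK)
    have "emeasure (distr (graph_law M B K) B snd) A = (\<integral>\<^sup>+z. indicator A (snd z) \<partial>graph_law M B K)"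
      by (subst nn_integral_indicator[symmetric]) (auto simp: nn_integral_distr simp del: nn_integral_indicator)
    also have "\<dots> = (\<integral>\<^sup>+x. emeasure (K x) A \<partial>M)"
      by (subst nn_integral_graph_law) (auto simp: sets_K intro!: nn_integral_cong)
    also have "\<dots> = emeasure (M \<bind> K) A"
      by (rule emeasure_bind[OF not_empty K_subprob A, symmetric])
    finally show "emeasure (M \<bind> K) A = emeasure (distr (graph_law M B K) B snd) A" ..
  qed
  show "distr (graph_law M B K) M fst = M"
  proof (rule measure_eqI)
    fix A assume "A \<in> sets (distr (graph_law M B K) M fst)"
    then have A[measurable]: "A \<in> sets M" by simp
    have "emeasure (distr (graph_law M B K) M fst) A = (\<integral>\<^sup>+z. indicator A (fst z) \<partial>graph_law M B K)"
      by (subst nn_integral_indicator[symmetric]) (auto simp: nn_integral_distr simp del: nn_integral_indicator)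
    also have "\<dots> = (\<integral>\<^sup>+x. indicator A x \<partial>M)"
      by (subst nn_integral_graph_law)
         (auto simp: prob_space.emeasure_space_1[OF prob_K] simp del: nn_integral_indicator intro!: nn_integral_cong)
    finally show "emeasure (distr (graph_law M B K) M fst) A = emeasure M A" by simp
  qed simp
qed

lemma integrable_graph_law_mult:
  fixes f :: "'a \<Rightarrow> real" and g :: "'b \<Rightarrow> real"
  assumes f: "f \<in> L2 M" and g: "g \<in> L2 (M \<bind> K)"
  shows "integrable (graph_law M B K) (\<lambda>z. f (fst z) * g (snd z))"
    "(\<integral>z. f (fst z) * g (snd z) \<partial>graph_law M B K) = (\<integral>x. f x * (\<integral>y. g y \<partial>K x) \<partial>M)"
proof -
  have [measurable_cong]: "sets (graph_law M B K) = sets (M \<Otimes>\<^sub>M B)" by (rule sets_graph_law)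
  have [measurable]: "f \<in> borel_measurable M" "g \<in> borel_measurable B"
    using L2_measurable[OF f] L2_measurable[OF g] by (auto simp: bind_eq_distr_graph_law)
  have "(\<lambda>z. f (fst z)) \<in> L2 (graph_law M B K)"
    using L2_integrable_power2[OF f] distr_fst_graph_law
      integrable_distr[of fst "graph_law M B K" M "\<lambda>x. (f x)\<^sup>2"] by (simp add: L2_def)
  moreover have "(\<lambda>z. g (snd z)) \<in> L2 (graph_law M B K)"
    using L2_integrable_power2[OF g] bind_eq_distr_graph_law
      integrable_distr[of snd "graph_law M B K" B "\<lambda>x. (g x)\<^sup>2"] by (simp add: L2_def)
  ultimately show int: "integrable (graph_law M B K) (\<lambda>z. f (fst z) * g (snd z))"
    by (rule L2_integrable_mult)
  show "(\<integral>z. f (fst z) * g (snd z) \<partial>graph_law M B K) = (\<integral>x. f x * (\<integral>y. g y \<partial>K x) \<partial>M)"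
    by (subst integral_graph_law(3)[OF _ int]) simp_all
qed

end

lemma measure_eqI_rectangles:
  assumes M: "finite_measure M" and sM: "sets M = sets (A \<Otimes>\<^sub>M B)" and sN: "sets N = sets (A \<Otimes>\<^sub>M B)"
    and eq: "\<And>a b. a \<in> sets A \<Longrightarrow> b \<in> sets B \<Longrightarrow> emeasure M (a \<times> b) = emeasure N (a \<times> b)"
  shows "M = N"
proof (rule measure_eqI_generator_eq[OF Int_stable_pair_measure_generator[of A B],
      where A = "\<lambda>_. space A \<times> space B" and \<Omega> = "space A \<times> space B"])
  show "emeasure M (space A \<times> space B) \<noteq> \<infinity>"
    using finite_measure.emeasure_finite[OF M] by (simp add: top_unique)
qed (use eq in \<open>auto simp: sM sN sets_pair_measure dest: sets.sets_into_space\<close>)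

section \<open>Stationary chains and reversible kernels\<close>

lemma kernel_pow_cong:
  assumes "sets E = sets E'" shows "kernel_pow E P k = kernel_pow E' P k"
proof (induction k)
  case 0 show ?case using return_cong[OF assms] by (simp add: fun_eq_iff)
qed simp

text \<open>Kept apart from the powers of the kernel so that the results here apply to every power as well.\<close>

locale stationary_kernel = prob_space \<mu> for \<mu> :: "'e measure" +
  fixes P :: "'e \<Rightarrow> 'e measure"
  assumes kernel: "P \<in> \<mu> \<rightarrow>\<^sub>M prob_algebra \<mu>" and invariant: "\<mu> \<bind> P = \<mu>"
begin

lemma kernel_subprob[measurable]: "P \<in> \<mu> \<rightarrow>\<^sub>M subprob_algebra \<mu>"
  by (rule measurable_prob_algebraD[OF kernel])

lemma prob_P: "x \<in> space \<mu> \<Longrightarrow> prob_space (P x)"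
  and sets_P: "x \<in> space \<mu> \<Longrightarrow> sets (P x) = sets \<mu>"
  using measurable_space[OF kernel] by (auto simp: space_prob_algebra)

sublocale graph_kernel \<mu> \<mu> P
  by unfold_locales (rule kernel)

lemma kernel_op_L2:
  assumes f: "f \<in> L2 \<mu>"
  shows "kernel_op P f \<in> L2 \<mu>" "ip \<mu> (kernel_op P f) (kernel_op P f) \<le> ip \<mu> f f"
    "AE x in \<mu>. f \<in> L2 (P x)"
  using L2_kernel[OF kernel prob_space_axioms, of f] f
  by (auto simp: invariant kernel_op_def[abs_def] ip_def power2_eq_square)

lemma ip_kernel_op:
  assumes f: "f \<in> L2 \<mu>" and g: "g \<in> L2 \<mu>"
  shows "ip \<mu> f (kernel_op P g) = (\<integral>z. f (fst z) * g (snd z) \<partial>graph_law \<mu> \<mu> P)"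
  using integrable_graph_law_mult(2)[of f g] f g by (simp add: invariant ip_def kernel_op_def)

lemma kernel_op_lincomb:
  assumes f: "f \<in> L2 \<mu>" and g: "g \<in> L2 \<mu>"
  shows "AE x in \<mu>. kernel_op P (\<lambda>y. a * f y + g y) x = a * kernel_op P f x + kernel_op P g x"
  using kernel_op_L2(3)[OF f] kernel_op_L2(3)[OF g] AE_space
proof eventually_elim
  case (elim x)
  then show ?case
    using L2_integrable[OF prob_P, of x f] L2_integrable[OF prob_P, of x g] by (simp add: kernel_op_def)
qed

text \<open>Invariance keeps null sets null, so operators of kernels respect almost everywhere equality.\<close>

lemma AE_kernel_step: "AE x in \<mu>. Q x \<Longrightarrow> AE x in \<mu>. AE y in P x. Q y"
proof -
  assume "AE x in \<mu>. Q x"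
  then obtain N where N: "{x \<in> space \<mu>. \<not> Q x} \<subseteq> N" "N \<in> sets \<mu>" "emeasure \<mu> N = 0"
    by (auto elim!: AE_E)
  have "AE x in \<mu> \<bind> P. x \<notin> N"
    unfolding invariant using N by (intro AE_not_in) (auto intro: null_setsI)
  then have "AE x in \<mu>. AE y in P x. y \<notin> N"
    using N by (subst (asm) AE_bind[OF kernel_subprob]) auto
  then show ?thesis using AE_space
  proof eventually_elim
    case (elim x)
    show ?case
      using elim(1) AE_space
      by eventually_elim (use N sets_eq_imp_space_eq[OF sets_P[OF elim(2)]] in auto)
  qed
qed

lemma kernel_op_cong_AE:
  assumes f[measurable]: "f \<in> borel_measurable \<mu>" and g[measurable]: "g \<in> borel_measurable \<mu>" and eq: "AE x in \<mu>. f x = g x"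
  shows "AE x in \<mu>. kernel_op P f x = kernel_op P g x"
  using AE_kernel_step[OF eq] AE_space
proof eventually_elim
  case (elim x)
  then show ?case
    unfolding kernel_op_def by (intro integral_cong_AE) (simp_all cong: measurable_cong_sets add: sets_P)
qed

lemma ip_kernel_op_center:
  assumes f: "f \<in> L2 \<mu>" and m: "m = (\<integral>x. f x \<partial>\<mu>)"
  shows "ip \<mu> (\<lambda>x. f x - m) (kernel_op P (\<lambda>x. f x - m)) = ip \<mu> f (kernel_op P f) - m\<^sup>2"
proof -
  let ?f = "\<lambda>x. f x - m"
  have c: "(\<lambda>x. m) \<in> L2 \<mu>" "?f \<in> L2 \<mu>"
    using f L2_const[OF prob_space_axioms] by (auto intro: L2_diff)
  have fi: "integrable \<mu> f" by (rule L2_integrable[OF prob_space_axioms f])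
  have "AE x in \<mu>. kernel_op P ?f x = kernel_op P f x - m"
    using kernel_op_L2(3)[OF f] AE_space
  proof eventually_elim
    case (elim x)
    interpret px: prob_space "P x" by (rule prob_P[OF elim(2)])
    show ?case
      using L2_integrable[OF px.prob_space_axioms elim(1)] by (simp add: kernel_op_def px.prob_space)
  qed
  then have "ip \<mu> ?f (kernel_op P ?f) = ip \<mu> ?f (\<lambda>x. kernel_op P f x - m)"
    using L2_measurable[OF kernel_op_L2(1)[OF c(2)]] L2_measurable[OF kernel_op_L2(1)[OF f]] L2_measurable[OF f]
    by (intro ip_cong_AE) auto
  also have "\<dots> = ip \<mu> ?f (kernel_op P f) - ip \<mu> ?f (\<lambda>_. m)"
    using f c by (intro ip_diff_right kernel_op_L2)
  also have "ip \<mu> ?f (\<lambda>_. m) = 0"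
    using fi by (simp add: ip_def m prob_space)
  also have "ip \<mu> ?f (kernel_op P f) = ip \<mu> f (kernel_op P f) - ip \<mu> (\<lambda>_. m) (kernel_op P f)"
    using f c by (intro ip_diff_left kernel_op_L2)
  also have "ip \<mu> (\<lambda>_. m) (kernel_op P f) = m * m"
    unfolding ip_def kernel_op_def m
    using bind_integral(3)[OF kernel_subprob L2_measurable[OF f]] fi by (simp add: invariant)
  finally show ?thesis by (simp add: power2_eq_square)
qed

end

locale stationary_chain = stationary_kernel \<mu> P for \<mu> :: "'e measure" and P
begin

abbreviation "pow \<equiv> kernel_pow \<mu> P"

lemma pow_kernel: "pow k \<in> \<mu> \<rightarrow>\<^sub>M prob_algebra \<mu>"
  by (induction k) (auto intro: measurable_bind_prob_space kernel)

lemma pow_subprob[measurable]: "pow k \<in> \<mu> \<rightarrow>\<^sub>M subprob_algebra \<mu>"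
  by (rule measurable_prob_algebraD[OF pow_kernel])

lemma prob_pow: "x \<in> space \<mu> \<Longrightarrow> prob_space (pow k x)"
  and sets_pow: "x \<in> space \<mu> \<Longrightarrow> sets (pow k x) = sets \<mu>"
  using measurable_space[OF pow_kernel] by (auto simp: space_prob_algebra)

lemma invariant_pow: "\<mu> \<bind> pow k = \<mu>"
proof (induction k)
  case 0 then show ?case by (simp add: bind_return'')
next
  case (Suc k) then show ?case
    using bind_assoc[OF kernel_subprob pow_subprob, of k] by (simp add: invariant)
qed

sublocale pow: stationary_kernel \<mu> "kernel_pow \<mu> P k" for k
  by unfold_locales (rule pow_kernel invariant_pow)+

lemma pow_Suc_right: "x \<in> space \<mu> \<Longrightarrow> pow (Suc k) x = pow k x \<bind> P"
proof (induction k arbitrary: x)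
  case 0
  then show ?case by (simp add: bind_return''[OF sets_P] bind_return[OF kernel_subprob])
next
  case (Suc k)
  have "pow (Suc (Suc k)) x = P x \<bind> (\<lambda>y. pow k y \<bind> P)"
    unfolding kernel_pow.simps(2)[of \<mu> P "Suc k"] fun_eq_iff
    using Suc.IH sets_eq_imp_space_eq[OF sets_P[OF Suc.prems]] by (intro bind_cong) auto
  also have "\<dots> = (P x \<bind> pow k) \<bind> P"
  proof (rule bind_assoc[symmetric])
    show "pow k \<in> P x \<rightarrow>\<^sub>M subprob_algebra \<mu>"
      using pow_subprob by (simp cong: measurable_cong_sets add: sets_P[OF Suc.prems])
  qed (rule kernel_subprob)
  finally show ?case by simp
qed

lemma kernel_op_pow_Suc:
  assumes f: "f \<in> L2 \<mu>"
  shows "AE x in \<mu>. kernel_op (pow (Suc k)) f x = kernel_op P (kernel_op (pow k) f) x"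
  using pow.kernel_op_L2(3)[OF f, of "Suc k"] AE_space
proof eventually_elim
  case (elim x)
  have "integrable (pow (Suc k) x) f"
    using elim prob_pow[OF elim(2), of "Suc k"] by (intro L2_integrable) auto
  moreover have "pow k \<in> P x \<rightarrow>\<^sub>M subprob_algebra \<mu>"
    using pow_subprob by (simp cong: measurable_cong_sets add: sets_P[OF elim(2)])
  ultimately show ?case
    using bind_integral(3)[of "pow k" "P x" \<mu> f] L2_measurable[OF f] by (simp add: kernel_op_def)
qed

lemma funpow_L2: "f \<in> L2 \<mu> \<Longrightarrow> (kernel_op P ^^ k) f \<in> L2 \<mu>"
  by (induction k) (auto intro: kernel_op_L2)

lemma kernel_op_pow_eq_funpow:
  assumes f: "f \<in> L2 \<mu>"
  shows "AE x in \<mu>. kernel_op (pow k) f x = (kernel_op P ^^ k) f x"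
proof (induction k)
  case 0
  show ?case using AE_space
    by eventually_elim (use L2_measurable[OF f] in \<open>simp add: kernel_op_def integral_return\<close>)
next
  case (Suc k)
  have "AE x in \<mu>. kernel_op P (kernel_op (pow k) f) x = kernel_op P ((kernel_op P ^^ k) f) x"
    using L2_measurable[OF pow.kernel_op_L2(1)[OF f]] L2_measurable[OF funpow_L2[OF f]]
    by (rule kernel_op_cong_AE) (rule Suc)
  with kernel_op_pow_Suc[OF f, of k] show ?case by eventually_elim simp
qed

text \<open>For a centred \<open>f\<close> this is the covariance between the values of \<open>f\<close> at two times of the stationary chain that are \<open>k\<close> steps apart.\<close>

definition acov :: "('e \<Rightarrow> real) \<Rightarrow> nat \<Rightarrow> real" where
  "acov f k = ip \<mu> f (kernel_op (pow k) f)"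

lemma acov_center:
  "f \<in> L2 \<mu> \<Longrightarrow> m = (\<integral>x. f x \<partial>\<mu>) \<Longrightarrow> acov (\<lambda>x. f x - m) k = acov f k - m\<^sup>2"
  unfolding acov_def by (rule pow.ip_kernel_op_center)

lemma acov_0: "f \<in> L2 \<mu> \<Longrightarrow> acov (\<lambda>x. f x - (\<integral>x. f x \<partial>\<mu>)) 0 = var_of \<mu> f"
proof -
  assume f: "f \<in> L2 \<mu>"
  have "acov f 0 = ip \<mu> f f"
    unfolding acov_def ip_def using L2_measurable[OF f]
    by (intro Bochner_Integration.integral_cong refl) (simp add: kernel_op_def integral_return)
  then show ?thesis
    unfolding acov_center[OF f refl] by (simp add: var_of_def ip_def power2_eq_square)
qed

lemma chain_Ionescu_Tulcea: "Ionescu_Tulcea (chain_step \<mu> P) (\<lambda>_. \<mu>)"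
  by (rule Ionescu_Tulcea_chain[OF prob_space_axioms kernel])

sublocale IT: Ionescu_Tulcea "chain_step \<mu> P" "\<lambda>_. \<mu>"
  by (rule chain_Ionescu_Tulcea)

lemma chain_law_eq: "chain_law \<mu> P = IT.PF.lim"
  by (simp add: chain_law_def)

lemma sets_chain_law[measurable_cong]: "sets (chain_law \<mu> P) = sets (PiM UNIV (\<lambda>_. \<mu>))"
  unfolding chain_law_eq by (rule IT.PF.sets_lim)

lemma CI_atLeastLessThan: "IT.CI {0..<n} = IT.C 0 n (\<lambda>_. undefined)"
proof -
  have "IT.up_to {0..<n} = n"
  proof (rule antisym)
    show "IT.up_to {0..<n} \<le> n" by (simp add: IT.up_to_iff)
    show "n \<le> IT.up_to {0..<n}" using IT.up_to_less[of "{0..<n}"] by (metis atLeastLessThan_iff finite_atLeastLessThan le0 less_irrefl linorder_not_le)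
  qed
  then show ?thesis
    unfolding IT.CI_def using IT.distr_C[of n n "\<lambda>_. undefined" 0] by simp
qed

text \<open>An integrand that looks at finitely many coordinates can be integrated on a finite stage of the Ionescu-Tulcea construction.\<close>

lemma nn_integral_chain_law:
  assumes G[measurable]: "G \<in> borel_measurable (PiM {0..<n} (\<lambda>_. \<mu>))"
  shows "(\<integral>\<^sup>+\<omega>. G (restrict \<omega> {0..<n}) \<partial>chain_law \<mu> P) = (\<integral>\<^sup>+\<omega>. G \<omega> \<partial>IT.C 0 n (\<lambda>_. undefined))"
proof -
  have [measurable]: "(\<lambda>\<omega>. restrict \<omega> {0..<n}) \<in> PiM UNIV (\<lambda>_. \<mu>) \<rightarrow>\<^sub>M PiM {0..<n} (\<lambda>_. \<mu>)"
    by (rule measurable_restrict_subset) simp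
  have "IT.C 0 n (\<lambda>_. undefined) = distr (chain_law \<mu> P) (PiM {0..<n} (\<lambda>_. \<mu>)) (\<lambda>\<omega>. restrict \<omega> {0..<n})"
    using IT.distr_lim[of "{0..<n}"] by (simp add: CI_atLeastLessThan chain_law_eq)
  then show ?thesis by (simp add: nn_integral_distr)
qed

lemma measurable_coordinate[measurable]: "(\<lambda>\<omega>. \<omega> i) \<in> chain_law \<mu> P \<rightarrow>\<^sub>M \<mu>"
  using measurable_component_singleton[of i UNIV "\<lambda>_. \<mu>"] by (simp cong: measurable_cong_sets add: sets_chain_law)

lemma nn_integral_initial:
  assumes G[measurable]: "G \<in> borel_measurable \<mu>"
  shows "(\<integral>\<^sup>+\<omega>. G (\<omega> 0) \<partial>chain_law \<mu> P) = (\<integral>\<^sup>+x. G x \<partial>\<mu>)"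
proof -
  have "(\<integral>\<^sup>+\<omega>. G (\<omega> 0) \<partial>chain_law \<mu> P) = (\<integral>\<^sup>+\<omega>. G (\<omega> 0) \<partial>IT.C 0 1 (\<lambda>_. undefined))"
    using nn_integral_chain_law[of "\<lambda>\<omega>. G (\<omega> 0)" 1] by simp
  also have "\<dots> = (\<integral>\<^sup>+\<omega>. G (\<omega> 0) \<partial>IT.eP 0 (\<lambda>_. undefined))"
    by (simp add: bind_return[OF IT.measurable_eP[of 0, simplified]] space_PiM)
  also have "\<dots> = (\<integral>\<^sup>+x. G x \<partial>\<mu>)"
    by (subst IT.nn_integral_eP) (auto simp: chain_step_def space_PiM)
  finally show ?thesis .
qed

text \<open>The Markov property, for the only integrands needed: functions of one earlier coordinate and the newest one.\<close>

lemma nn_integral_step: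
  assumes F[measurable]: "F \<in> borel_measurable (\<mu> \<Otimes>\<^sub>M \<mu>)" and i: "i \<le> n"
  shows "(\<integral>\<^sup>+\<omega>. F (\<omega> i, \<omega> (Suc n)) \<partial>chain_law \<mu> P) = (\<integral>\<^sup>+\<omega>. \<integral>\<^sup>+y. F (\<omega> i, y) \<partial>P (\<omega> n) \<partial>chain_law \<mu> P)"
proof -
  let ?C = "\<lambda>n. IT.C 0 n (\<lambda>_. undefined)"
  have c[measurable]: "(\<lambda>\<omega>. \<omega> j) \<in> PiM {0..<k} (\<lambda>_. \<mu>) \<rightarrow>\<^sub>M \<mu>" if "j < k" for j k :: nat
    using that by (intro measurable_component_singleton) simp
  have in_le: "i < Suc n" "n < Suc n" "i < Suc (Suc n)" "Suc n < Suc (Suc n)" using i by auto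
  note cc[measurable] = in_le[THEN c]
  have "(\<integral>\<^sup>+\<omega>. F (\<omega> i, \<omega> (Suc n)) \<partial>chain_law \<mu> P) = (\<integral>\<^sup>+\<omega>. F (\<omega> i, \<omega> (Suc n)) \<partial>?C (Suc (Suc n)))"
    using nn_integral_chain_law[of "\<lambda>\<omega>. F (\<omega> i, \<omega> (Suc n))" "Suc (Suc n)"] i by simp
  also have "\<dots> = (\<integral>\<^sup>+\<omega>. \<integral>\<^sup>+\<omega>'. F (\<omega>' i, \<omega>' (Suc n)) \<partial>IT.eP (Suc n) \<omega> \<partial>?C (Suc n))"
  proof -
    have "(\<lambda>\<omega>. F (\<omega> i, \<omega> (Suc n))) \<in> borel_measurable (PiM {0..<Suc (Suc n)} (\<lambda>_. \<mu>))" by measurable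
    moreover have "IT.eP (Suc n) \<in> ?C (Suc n) \<rightarrow>\<^sub>M subprob_algebra (PiM {0..<Suc (Suc n)} (\<lambda>_. \<mu>))"
    proof (subst measurable_cong_sets[OF _ refl])
      show "sets (?C (Suc n)) = sets (PiM {0..<Suc n} (\<lambda>_. \<mu>))"
        using IT.sets_C[of "\<lambda>_. undefined" 0 "Suc n"] by simp
    qed (rule IT.measurable_eP)
    ultimately show ?thesis
      unfolding IT.C.simps(2)[of 0 "Suc n"] by (subst nn_integral_bind) auto
  qed
  also have "\<dots> = (\<integral>\<^sup>+\<omega>. \<integral>\<^sup>+y. F (\<omega> i, y) \<partial>P (\<omega> n) \<partial>?C (Suc n))"
  proof (rule nn_integral_cong)
    fix \<omega> assume "\<omega> \<in> space (?C (Suc n))"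
    then have w: "\<omega> \<in> space (PiM {0..<Suc n} (\<lambda>_. \<mu>))" using IT.space_C[of "\<lambda>_. undefined" 0 "Suc n"] by simp
    show "(\<integral>\<^sup>+\<omega>'. F (\<omega>' i, \<omega>' (Suc n)) \<partial>IT.eP (Suc n) \<omega>) = (\<integral>\<^sup>+y. F (\<omega> i, y) \<partial>P (\<omega> n))"
      using i by (subst IT.nn_integral_eP[OF w]) (auto simp: chain_step_def)
  qed
  also have "\<dots> = (\<integral>\<^sup>+\<omega>. \<integral>\<^sup>+y. F (\<omega> i, y) \<partial>P (\<omega> n) \<partial>chain_law \<mu> P)"
  proof -
    have "(\<lambda>\<omega>. \<integral>\<^sup>+y. F (\<omega> i, y) \<partial>P (\<omega> n)) \<in> borel_measurable (PiM {0..<Suc n} (\<lambda>_. \<mu>))"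
      by (rule nn_integral_measurable_subprob_algebra2[where N=\<mu>]) measurable
    from nn_integral_chain_law[OF this] show ?thesis using i by simp
  qed
  finally show ?thesis .
qed

lemma nn_integral_chain_component:
  assumes G[measurable]: "G \<in> borel_measurable \<mu>"
  shows "(\<integral>\<^sup>+\<omega>. G (\<omega> i) \<partial>chain_law \<mu> P) = (\<integral>\<^sup>+x. G x \<partial>\<mu>)"
  using G
proof (induction i arbitrary: G)
  case 0 then show ?case by (rule nn_integral_initial)
next
  case (Suc i)
  note [measurable] = Suc.prems
  have "(\<integral>\<^sup>+\<omega>. G (\<omega> (Suc i)) \<partial>chain_law \<mu> P) = (\<integral>\<^sup>+\<omega>. \<integral>\<^sup>+y. G y \<partial>P (\<omega> i) \<partial>chain_law \<mu> P)"
    using nn_integral_step[of "\<lambda>z. G (snd z)" i i] by simp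
  also have "\<dots> = (\<integral>\<^sup>+x. \<integral>\<^sup>+y. G y \<partial>P x \<partial>\<mu>)"
    by (rule Suc.IH) (rule nn_integral_measurable_subprob_algebra2[where N=\<mu>], measurable)
  also have "\<dots> = (\<integral>\<^sup>+y. G y \<partial>(\<mu> \<bind> P))"
    by (rule nn_integral_bind[symmetric, OF Suc.prems kernel_subprob])
  finally show ?case by (simp add: invariant)
qed

text \<open>Induction on the lag \<open>k\<close>: the last step is integrated out, which turns \<open>F\<close> into a function of the pair with lag one less.\<close>

lemma nn_integral_chain_pair:
  assumes F: "F \<in> borel_measurable (\<mu> \<Otimes>\<^sub>M \<mu>)"
  shows "(\<integral>\<^sup>+\<omega>. F (\<omega> i, \<omega> (i + k)) \<partial>chain_law \<mu> P) = (\<integral>\<^sup>+z. F z \<partial>graph_law \<mu> \<mu> (pow k))"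
  using F
proof (induction k arbitrary: F)
  case 0
  note [measurable] = 0
  show ?case
    by (subst pow.nn_integral_graph_law[OF 0])
       (auto simp: nn_integral_chain_component[of "\<lambda>x. F (x, x)"] nn_integral_return intro!: nn_integral_cong)
next
  case (Suc k)
  note F[measurable] = Suc.prems
  have F': "(\<lambda>z. \<integral>\<^sup>+y. F (fst z, y) \<partial>P (snd z)) \<in> borel_measurable (\<mu> \<Otimes>\<^sub>M \<mu>)"
    by (rule nn_integral_measurable_subprob_algebra2[where N=\<mu>]) measurable
  have "(\<integral>\<^sup>+\<omega>. F (\<omega> i, \<omega> (i + Suc k)) \<partial>chain_law \<mu> P)
      = (\<integral>\<^sup>+\<omega>. \<integral>\<^sup>+y. F (\<omega> i, y) \<partial>P (\<omega> (i + k)) \<partial>chain_law \<mu> P)"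
    using nn_integral_step[OF F, of i "i + k"] by simp
  also have "\<dots> = (\<integral>\<^sup>+z. \<integral>\<^sup>+y. F (fst z, y) \<partial>P (snd z) \<partial>graph_law \<mu> \<mu> (pow k))"
    using Suc.IH[OF F'] by simp
  also have "\<dots> = (\<integral>\<^sup>+x. \<integral>\<^sup>+z. \<integral>\<^sup>+y. F (x, y) \<partial>P z \<partial>pow k x \<partial>\<mu>)"
    by (subst pow.nn_integral_graph_law[OF F']) simp
  also have "\<dots> = (\<integral>\<^sup>+x. \<integral>\<^sup>+y. F (x, y) \<partial>pow (Suc k) x \<partial>\<mu>)"
  proof (rule nn_integral_cong)
    fix x assume x: "x \<in> space \<mu>"
    have "P \<in> pow k x \<rightarrow>\<^sub>M subprob_algebra \<mu>"
      using kernel_subprob by (simp cong: measurable_cong_sets add: sets_pow[OF x])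
    then show "(\<integral>\<^sup>+z. \<integral>\<^sup>+y. F (x, y) \<partial>P z \<partial>pow k x) = (\<integral>\<^sup>+y. F (x, y) \<partial>pow (Suc k) x)"
      unfolding pow_Suc_right[OF x] using x by (subst nn_integral_bind) auto
  qed
  also have "\<dots> = (\<integral>\<^sup>+z. F z \<partial>graph_law \<mu> \<mu> (pow (Suc k)))"
    by (rule pow.nn_integral_graph_law[symmetric]) measurable
  finally show ?case .
qed

lemma chain_pair_law:
  "distr (chain_law \<mu> P) (\<mu> \<Otimes>\<^sub>M \<mu>) (\<lambda>\<omega>. (\<omega> i, \<omega> (i + k))) = graph_law \<mu> \<mu> (pow k)"
proof (rule measure_eqI)
  show s: "sets (distr (chain_law \<mu> P) (\<mu> \<Otimes>\<^sub>M \<mu>) (\<lambda>\<omega>. (\<omega> i, \<omega> (i + k)))) = sets (graph_law \<mu> \<mu> (pow k))"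
    by (simp add: pow.sets_graph_law)
  fix A assume "A \<in> sets (distr (chain_law \<mu> P) (\<mu> \<Otimes>\<^sub>M \<mu>) (\<lambda>\<omega>. (\<omega> i, \<omega> (i + k))))"
  then have A[measurable]: "A \<in> sets (\<mu> \<Otimes>\<^sub>M \<mu>)" by simp
  show "emeasure (distr (chain_law \<mu> P) (\<mu> \<Otimes>\<^sub>M \<mu>) (\<lambda>\<omega>. (\<omega> i, \<omega> (i + k)))) A = emeasure (graph_law \<mu> \<mu> (pow k)) A"
    using nn_integral_chain_pair[of "indicator A" i k] A
    by (subst (1 2) nn_integral_indicator[symmetric])
       (auto simp: nn_integral_distr pow.sets_graph_law simp del: nn_integral_indicator)
qed

lemma chain_covariance:
  assumes f: "f \<in> L2 \<mu>"
  shows "integrable (chain_law \<mu> P) (\<lambda>\<omega>. f (\<omega> i) * f (\<omega> j))"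
    "(\<integral>\<omega>. f (\<omega> i) * f (\<omega> j) \<partial>chain_law \<mu> P) = acov f (nat \<bar>int i - int j\<bar>)"
proof -
  note [measurable] = L2_measurable[OF f]
  have *: "integrable (chain_law \<mu> P) (\<lambda>\<omega>. f (\<omega> i) * f (\<omega> (i + k))) \<and>
    (\<integral>\<omega>. f (\<omega> i) * f (\<omega> (i + k)) \<partial>chain_law \<mu> P) = acov f k" for i k
  proof
    have g: "integrable (graph_law \<mu> \<mu> (pow k)) (\<lambda>z. f (fst z) * f (snd z))"
      using pow.integrable_graph_law_mult(1)[of f f k] f by (simp add: invariant_pow)
    then show "integrable (chain_law \<mu> P) (\<lambda>\<omega>. f (\<omega> i) * f (\<omega> (i + k)))"
      unfolding chain_pair_law[of i k, symmetric] by (subst (asm) integrable_distr_eq) auto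
    show "(\<integral>\<omega>. f (\<omega> i) * f (\<omega> (i + k)) \<partial>chain_law \<mu> P) = acov f k"
      unfolding acov_def pow.ip_kernel_op[OF f f] chain_pair_law[of i k, symmetric]
      by (subst integral_distr) auto
  qed
  have "integrable (chain_law \<mu> P) (\<lambda>\<omega>. f (\<omega> i) * f (\<omega> j)) \<and>
    (\<integral>\<omega>. f (\<omega> i) * f (\<omega> j) \<partial>chain_law \<mu> P) = acov f (nat \<bar>int i - int j\<bar>)"
  proof (cases "i \<le> j")
    case True
    then have "nat \<bar>int i - int j\<bar> = j - i" by linarith
    with True *[of i "j - i"] show ?thesis by simp
  next
    case False
    then have "nat \<bar>int i - int j\<bar> = i - j" by linarith
    moreover have "(\<lambda>\<omega>. f (\<omega> i) * f (\<omega> j)) = (\<lambda>\<omega>. f (\<omega> j) * f (\<omega> i))"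
      by (simp only: mult.commute)
    ultimately show ?thesis using False *[of j "i - j"] by simp
  qed
  then show "integrable (chain_law \<mu> P) (\<lambda>\<omega>. f (\<omega> i) * f (\<omega> j))"
    "(\<integral>\<omega>. f (\<omega> i) * f (\<omega> j) \<partial>chain_law \<mu> P) = acov f (nat \<bar>int i - int j\<bar>)"
    by blast+
qed

lemma integral_chain_component:
  assumes f: "f \<in> L2 \<mu>"
  shows "integrable (chain_law \<mu> P) (\<lambda>\<omega>. f (\<omega> i))" "(\<integral>\<omega>. f (\<omega> i) \<partial>chain_law \<mu> P) = (\<integral>x. f x \<partial>\<mu>)"
proof -
  note [measurable] = L2_measurable[OF f]
  have "distr (chain_law \<mu> P) \<mu> (\<lambda>\<omega>. \<omega> i) = \<mu>"
  proof (rule measure_eqI)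
    fix A assume "A \<in> sets (distr (chain_law \<mu> P) \<mu> (\<lambda>\<omega>. \<omega> i))"
    then have A[measurable]: "A \<in> sets \<mu>" by simp
    show "emeasure (distr (chain_law \<mu> P) \<mu> (\<lambda>\<omega>. \<omega> i)) A = emeasure \<mu> A"
      using nn_integral_chain_component[of "indicator A" i] A
      by (subst (1 2) nn_integral_indicator[symmetric])
         (auto simp: nn_integral_distr simp del: nn_integral_indicator)
  qed simp
  then show "integrable (chain_law \<mu> P) (\<lambda>\<omega>. f (\<omega> i))" "(\<integral>\<omega>. f (\<omega> i) \<partial>chain_law \<mu> P) = (\<integral>x. f x \<partial>\<mu>)"
    using integrable_distr_eq[of "\<lambda>\<omega>. \<omega> i" "chain_law \<mu> P" \<mu> f] integral_distr[of "\<lambda>\<omega>. \<omega> i" "chain_law \<mu> P" \<mu> f]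
      L2_integrable[OF prob_space_axioms f] by auto
qed

end

text \<open>The covariance matrix of the chain is a Toeplitz matrix; bordering it by one row and one column adds twice a partial sum.\<close>

lemma toeplitz_sum:
  fixes c :: "nat \<Rightarrow> real"
  shows "(\<Sum>i<M. \<Sum>j<M. c (nat \<bar>int i - int j\<bar>)) = real M * c 0 + 2 * (\<Sum>m<M. \<Sum>k<m. c (Suc k))"
proof (induction M)
  case (Suc M)
  have *: "(\<Sum>i<M. c (nat \<bar>int i - int M\<bar>)) = (\<Sum>k<M. c (Suc k))"
    unfolding sum.nat_diff_reindex[of "\<lambda>k. c (Suc k)" M, symmetric]
    by (intro sum.cong refl arg_cong[where f=c]) auto
  have **: "(\<Sum>i<M. c (nat \<bar>int M - int i\<bar>)) = (\<Sum>k<M. c (Suc k))"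
    using * by (simp only: abs_minus_commute)
  show ?case
    unfolding sum.lessThan_Suc sum.distrib * ** Suc by (simp add: algebra_simps)
qed simp

context stationary_chain begin

lemma chain_variance:
  assumes f: "f \<in> L2 \<mu>" and M: "0 < M"
  defines "m \<equiv> \<integral>x. f x \<partial>\<mu>"
  shows "var_of (chain_law \<mu> P) (\<lambda>\<omega>. (1 / sqrt (real M)) * (\<Sum>i<M. f (\<omega> i) - m))
    = acov (\<lambda>x. f x - m) 0 + 2 * cesaro (\<lambda>n. \<Sum>k<n. acov (\<lambda>x. f x - m) (Suc k)) M"
proof -
  let ?f = "\<lambda>x. f x - m"
  have f': "?f \<in> L2 \<mu>" using f L2_const[OF prob_space_axioms] by (auto intro: L2_diff)
  have m0: "(\<integral>x. ?f x \<partial>\<mu>) = 0"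
    using L2_integrable[OF prob_space_axioms f] by (simp add: m_def prob_space)
  have "(\<integral>\<omega>. (1 / sqrt (real M)) * (\<Sum>i<M. ?f (\<omega> i)) \<partial>chain_law \<mu> P) = 0"
    using integral_chain_component[OF f'] m0 by simp
  moreover have "((1 / sqrt (real M)) * (\<Sum>i<M. ?f (\<omega> i)))\<^sup>2
      = (1 / real M) * (\<Sum>i<M. \<Sum>j<M. ?f (\<omega> i) * ?f (\<omega> j))" for \<omega>
    by (simp add: power_mult_distrib power_divide power2_eq_square[of "sum _ _"] sum_product)
  moreover have "(\<integral>\<omega>. (1 / real M) * (\<Sum>i<M. \<Sum>j<M. ?f (\<omega> i) * ?f (\<omega> j)) \<partial>chain_law \<mu> P)
      = (1 / real M) * (\<Sum>i<M. \<Sum>j<M. acov ?f (nat \<bar>int i - int j\<bar>))"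
    using chain_covariance[OF f'] by simp
  ultimately show ?thesis
    using M by (simp only: var_of_def toeplitz_sum cesaro_def) (simp add: field_simps)
qed

text \<open>Stated for arbitrary stationary chains, since it has to cover the chain on the product space, which in general is not reversible.
The \<open>Suc\<close> leaves out the variance, which the diagonal of the covariance matrix contributes once and not twice.\<close>

lemma asym_var_eqI:
  assumes f: "f \<in> L2 \<mu>"
  defines "f0 \<equiv> \<lambda>x. f x - (\<integral>x. f x \<partial>\<mu>)"
  assumes R: "(\<lambda>M. ereal (cesaro (\<lambda>n. \<Sum>k<n. acov f0 (Suc k)) M)) \<longlonglongrightarrow> R"
  shows "asym_var \<mu> P f = ereal (acov f0 0) + 2 * R"
  unfolding asym_var_def
proof (rule limI)
  have "(\<lambda>M. ereal (acov f0 0) + 2 * ereal (cesaro (\<lambda>n. \<Sum>k<n. acov f0 (Suc k)) M))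
      \<longlonglongrightarrow> ereal (acov f0 0) + 2 * R"
    by (intro tendsto_add_ereal_general2 tendsto_const tendsto_cmult_ereal R) auto
  then show "(\<lambda>M. ereal (var_of (chain_law \<mu> P) (\<lambda>\<omega>. (1 / sqrt (real M)) * (\<Sum>i<M. f (\<omega> i) - (\<integral>x. f x \<partial>\<mu>)))))
      \<longlonglongrightarrow> ereal (acov f0 0) + 2 * R"
  proof (rule Lim_transform_eventually)
    show "\<forall>\<^sub>F M in sequentially. ereal (acov f0 0) + 2 * ereal (cesaro (\<lambda>n. \<Sum>k<n. acov f0 (Suc k)) M)
        = ereal (var_of (chain_law \<mu> P) (\<lambda>\<omega>. (1 / sqrt (real M)) * (\<Sum>i<M. f (\<omega> i) - (\<integral>x. f x \<partial>\<mu>))))"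
      using eventually_gt_at_top[of 0]
      by eventually_elim (simp only: chain_variance[OF f] f0_def, simp)
  qed
qed

end

text \<open>Invariance of \<open>\<mu>\<close> follows from reversibility, by testing with the whole space.\<close>

locale reversible_kernel = prob_space \<mu> for \<mu> :: "'e measure" +
  fixes P :: "'e \<Rightarrow> 'e measure"
  assumes kernel': "P \<in> \<mu> \<rightarrow>\<^sub>M prob_algebra \<mu>" and reversible: "reversible \<mu> P"
begin

sublocale stationary_chain \<mu> P
proof
  have [measurable]: "P \<in> \<mu> \<rightarrow>\<^sub>M subprob_algebra \<mu>" by (rule measurable_prob_algebraD[OF kernel'])
  have ps: "prob_space (P x)" "sets (P x) = sets \<mu>" if "x \<in> space \<mu>" for x
    using measurable_space[OF kernel' that] by (auto simp: space_prob_algebra)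
  have one: "emeasure (P x) (space \<mu>) = 1" if "x \<in> space \<mu>" for x
    using prob_space.emeasure_space_1[OF ps(1)[OF that]] sets_eq_imp_space_eq[OF ps(2)[OF that]] by simp
  have s: "sets (\<mu> \<bind> P) = sets \<mu>"
    using not_empty ps(2) by (intro sets_bind) auto
  show "\<mu> \<bind> P = \<mu>"
  proof (rule measure_eqI[OF s])
    fix B assume "B \<in> sets (\<mu> \<bind> P)"
    then have B: "B \<in> sets \<mu>" by (simp add: s)
    have "emeasure (\<mu> \<bind> P) B = (\<integral>\<^sup>+x. emeasure (P x) B \<partial>\<mu>)"
      by (rule emeasure_bind[OF not_empty _ B]) simp
    also have "\<dots> = (\<integral>\<^sup>+x. emeasure (P x) B * indicator (space \<mu>) x \<partial>\<mu>)"
      by (intro nn_integral_cong) simp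
    also have "\<dots> = (\<integral>\<^sup>+x. emeasure (P x) (space \<mu>) * indicator B x \<partial>\<mu>)"
      using reversible B unfolding reversible_def by blast
    also have "\<dots> = (\<integral>\<^sup>+x. indicator B x \<partial>\<mu>)"
      by (intro nn_integral_cong) (simp add: one)
    finally show "emeasure (\<mu> \<bind> P) B = emeasure \<mu> B" using B by simp
  qed
qed (rule kernel')

text \<open>Reversibility says that two consecutive states are exchangeable in law. Self-adjointness is this symmetry of the pair law.\<close>

lemma graph_law_swap: "distr (graph_law \<mu> \<mu> P) (\<mu> \<Otimes>\<^sub>M \<mu>) (\<lambda>(x, y). (y, x)) = graph_law \<mu> \<mu> P"
proof (rule measure_eqI_rectangles[of _ \<mu> \<mu>])
  have [measurable_cong]: "sets (graph_law \<mu> \<mu> P) = sets (\<mu> \<Otimes>\<^sub>M \<mu>)" by (rule sets_graph_law)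
  show "finite_measure (distr (graph_law \<mu> \<mu> P) (\<mu> \<Otimes>\<^sub>M \<mu>) (\<lambda>(x, y). (y, x)))"
    by (intro prob_space.finite_measure prob_space.prob_space_distr prob_graph_law) measurable
  fix a b assume ab[measurable]: "a \<in> sets \<mu>" "b \<in> sets \<mu>"
  have "emeasure (distr (graph_law \<mu> \<mu> P) (\<mu> \<Otimes>\<^sub>M \<mu>) (\<lambda>(x, y). (y, x))) (a \<times> b) = emeasure (graph_law \<mu> \<mu> P) (b \<times> a)"
  proof (subst emeasure_distr)
    have "(\<lambda>(x, y). (y, x)) -` (a \<times> b) \<inter> space (graph_law \<mu> \<mu> P) = b \<times> a"
      using sets.sets_into_space[OF ab(1)] sets.sets_into_space[OF ab(2)]
      by (auto simp: sets_eq_imp_space_eq[OF sets_graph_law] space_pair_measure)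
    then show "emeasure (graph_law \<mu> \<mu> P) ((\<lambda>(x, y). (y, x)) -` (a \<times> b) \<inter> space (graph_law \<mu> \<mu> P))
        = emeasure (graph_law \<mu> \<mu> P) (b \<times> a)" by simp
  qed auto
  then show "emeasure (distr (graph_law \<mu> \<mu> P) (\<mu> \<Otimes>\<^sub>M \<mu>) (\<lambda>(x, y). (y, x))) (a \<times> b) = emeasure (graph_law \<mu> \<mu> P) (a \<times> b)"
    using reversible ab unfolding reversible_def by (simp add: emeasure_graph_law_Times)
qed (simp_all add: sets_graph_law)

lemma ip_kernel_op_commute:
  assumes f: "f \<in> L2 \<mu>" and g: "g \<in> L2 \<mu>"
  shows "ip \<mu> f (kernel_op P g) = ip \<mu> g (kernel_op P f)"
proof -
  have [measurable_cong]: "sets (graph_law \<mu> \<mu> P) = sets (\<mu> \<Otimes>\<^sub>M \<mu>)" by (rule sets_graph_law)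
  note [measurable] = L2_measurable[OF f] L2_measurable[OF g]
  have "ip \<mu> f (kernel_op P g) = (\<integral>z. f (fst z) * g (snd z) \<partial>graph_law \<mu> \<mu> P)"
    by (rule ip_kernel_op[OF f g])
  also have "\<dots> = (\<integral>z. f (fst z) * g (snd z) \<partial>distr (graph_law \<mu> \<mu> P) (\<mu> \<Otimes>\<^sub>M \<mu>) (\<lambda>(x, y). (y, x)))"
    by (simp only: graph_law_swap)
  also have "\<dots> = (\<integral>z. g (fst z) * f (snd z) \<partial>graph_law \<mu> \<mu> P)"
    by (subst integral_distr) (auto simp: case_prod_beta mult.commute)
  finally show ?thesis by (simp add: ip_kernel_op[OF g f])
qed

sublocale op: selfadjoint_contraction \<mu> "kernel_op P"
proof
  fix f g h :: "'e \<Rightarrow> real" and a assume f: "f \<in> L2 \<mu>" and g: "g \<in> L2 \<mu>"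
  show "ip \<mu> (kernel_op P f) g = ip \<mu> f (kernel_op P g)"
    using ip_kernel_op_commute[OF f g] by (simp add: ip_commute)
  assume h: "h \<in> L2 \<mu>"
  have "ip \<mu> h (kernel_op P (\<lambda>x. a * f x + g x)) = ip \<mu> h (\<lambda>x. a * kernel_op P f x + kernel_op P g x)"
    using kernel_op_lincomb[OF f g] h f g
    by (intro ip_cong_AE L2_measurable[where \<mu>=\<mu>]) (auto intro!: L2_lincomb kernel_op_L2)
  also have "\<dots> = a * ip \<mu> h (kernel_op P f) + ip \<mu> h (kernel_op P g)"
    using f g h by (intro ip_lincomb_right kernel_op_L2)
  finally show "ip \<mu> h (kernel_op P (\<lambda>x. a * f x + g x)) = a * ip \<mu> h (kernel_op P f) + ip \<mu> h (kernel_op P g)" .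
qed (fact kernel_op_L2)+

text \<open>Both bounds hold also when \<open>f\<close> is almost everywhere constant: the gap may then be unspecified, but it is multiplied by zero.\<close>

lemma gap_bounds:
  assumes f: "f \<in> L2 \<mu>"
  shows "0 \<le> var_of \<mu> f * gap \<mu> P"
    "var_of \<mu> f * gap \<mu> P \<le> ip \<mu> f f - ip \<mu> f (kernel_op P f)"
proof -
  let ?R = "\<lambda>f. ip \<mu> f (\<lambda>x. f x - kernel_op P f x) / ip \<mu> f f"
  let ?S = "{?R f | f. f \<in> L2 \<mu> \<and> (\<integral>x. f x \<partial>\<mu>) = 0 \<and> ip \<mu> f f \<noteq> 0}"
  have dir: "ip \<mu> g (\<lambda>x. g x - kernel_op P g x) = ip \<mu> g g - ip \<mu> g (kernel_op P g)" if "g \<in> L2 \<mu>" for g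
    using that by (intro ip_diff_right kernel_op_L2)
  have R0: "0 \<le> ?R g" if "g \<in> L2 \<mu>" for g
    unfolding dir[OF that] using op.ip_op_le[OF that] ip_self_nonneg[of \<mu> g] by simp
  then have bdd: "bdd_below ?S" by (intro bdd_belowI[of _ 0]) auto
  define m where "m = (\<integral>x. f x \<partial>\<mu>)"
  let ?f = "\<lambda>x. f x - m"
  have f0: "?f \<in> L2 \<mu>" using f L2_const[OF prob_space_axioms] by (auto intro: L2_diff)
  have fi: "integrable \<mu> f" by (rule L2_integrable[OF prob_space_axioms f])
  have mean: "(\<integral>x. ?f x \<partial>\<mu>) = 0" using fi by (simp add: m_def prob_space)
  have var: "ip \<mu> ?f ?f = var_of \<mu> f"
    using variance_eq[OF fi L2_integrable_power2[OF f]]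
    by (simp add: ip_def m_def var_of_def power2_eq_square)
  have var': "var_of \<mu> f = ip \<mu> f f - m\<^sup>2"
    by (simp add: ip_def m_def var_of_def power2_eq_square)
  have num: "ip \<mu> ?f (\<lambda>x. ?f x - kernel_op P ?f x) = ip \<mu> f f - ip \<mu> f (kernel_op P f)"
    unfolding dir[OF f0] ip_kernel_op_center[OF f m_def] var var' by simp
  have "0 \<le> var_of \<mu> f * gap \<mu> P \<and> var_of \<mu> f * gap \<mu> P \<le> ip \<mu> f f - ip \<mu> f (kernel_op P f)"
  proof (cases "var_of \<mu> f = 0")
    case True
    then show ?thesis using op.ip_op_le[OF f] by simp
  next
    case False
    with ip_self_nonneg[of \<mu> ?f] have pos: "0 < var_of \<mu> f" by (simp add: var)
    have S: "?R ?f \<in> ?S" 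
      unfolding mem_Collect_eq
      by (intro exI[of _ ?f] conjI refl f0 mean) (use False in \<open>simp add: var\<close>)
    then have "0 \<le> gap \<mu> P" unfolding gap_def using R0 by (intro cInf_greatest) auto
    moreover have "gap \<mu> P \<le> ?R ?f" unfolding gap_def by (rule cInf_lower[OF S bdd])
    ultimately show ?thesis using pos unfolding num var by (simp add: field_simps)
  qed
  then show "0 \<le> var_of \<mu> f * gap \<mu> P"
    "var_of \<mu> f * gap \<mu> P \<le> ip \<mu> f f - ip \<mu> f (kernel_op P f)" by auto
qed

lemma autocov_eq_acov: "f \<in> L2 \<mu> \<Longrightarrow> op.autocov f = acov f"
proof
  fix k assume f: "f \<in> L2 \<mu>"
  show "op.autocov f k = acov f k"
    unfolding op.autocov_def acov_def using kernel_op_pow_eq_funpow[OF f, of k] f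
    by (intro ip_cong_AE L2_measurable[where \<mu>=\<mu>]) (auto intro!: op.L2_pow pow.kernel_op_L2)
qed

lemma asym_var_reversible:
  assumes f: "f \<in> L2 \<mu>"
  defines "f0 \<equiv> \<lambda>x. f x - (\<integral>x. f x \<partial>\<mu>)"
  assumes L: "(\<lambda>M. ereal (cesaro (\<lambda>m. \<Sum>k<m. acov f0 k) M)) \<longlonglongrightarrow> L"
  shows "asym_var \<mu> P f = 2 * L - ereal (var_of \<mu> f)"
proof -
  define c where "c = acov f0"
  have "(\<lambda>M. ereal (cesaro (\<lambda>m. \<Sum>k<Suc m. c k) M)) \<longlonglongrightarrow> L"
    using L unfolding c_def by (intro cesaro_Suc_tendsto) simp_all
  then have "(\<lambda>M. ereal (cesaro (\<lambda>m. \<Sum>k<Suc m. c k) M) + ereal (- c 0)) \<longlonglongrightarrow> L + ereal (- c 0)"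
    by (intro tendsto_add_ereal_general1 tendsto_const) auto
  then have "(\<lambda>M. ereal (cesaro (\<lambda>n. \<Sum>k<n. c (Suc k)) M)) \<longlonglongrightarrow> L + ereal (- c 0)"
  proof (rule Lim_transform_eventually)
    show "\<forall>\<^sub>F M in sequentially. ereal (cesaro (\<lambda>m. \<Sum>k<Suc m. c k) M) + ereal (- c 0)
        = ereal (cesaro (\<lambda>n. \<Sum>k<n. c (Suc k)) M)"
      using eventually_gt_at_top[of 0]
      by eventually_elim
         (simp add: cesaro_def sum.lessThan_Suc_shift sum.distrib add_divide_distrib del: sum.lessThan_Suc)
  qed
  from asym_var_eqI[OF f this[unfolded c_def f0_def]]
  have "asym_var \<mu> P f = ereal (c 0) + 2 * (L + ereal (- c 0))" by (simp add: c_def f0_def)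
  also have "\<dots> = 2 * L - ereal (c 0)" by (cases L) auto
  also have "c 0 = var_of \<mu> f" unfolding c_def f0_def by (rule acov_0[OF f])
  finally show ?thesis .
qed

end

section \<open>Alternating between parameter and state\<close>

lemma prob_algebra_cong: "sets M = sets N \<Longrightarrow> prob_algebra M = prob_algebra N"
  by (simp add: prob_algebra_def subprob_algebra_cong[of M N])

lemma measure_eqI_nn_integral:
  assumes s: "sets M = sets N"
    and eq: "\<And>F. F \<in> borel_measurable N \<Longrightarrow> (\<integral>\<^sup>+x. F x \<partial>M) = (\<integral>\<^sup>+x. F x \<partial>N)"
  shows "M = N"
proof (rule measure_eqI[OF s])
  fix A assume A: "A \<in> sets M"
  have "(\<integral>\<^sup>+x. indicator A x \<partial>M) = (\<integral>\<^sup>+x. indicator A x \<partial>N)"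
    using A s by (intro eq) simp
  with A s show "emeasure M A = emeasure N A" by simp
qed

text \<open>The theorem concerns \<open>Q\<close> and the kernel that draws the state exactly, \<open>Q \<theta> x = piT \<theta>\<close>. The latter satisfies
the same assumptions, so everything proved in this locale applies to \<open>\<Gamma>\<close> as well.\<close>

locale gibbs =
  fixes T :: "'t measure" and X :: "'x measure" and \<pi> :: "('t \<times> 'x) measure"
    and piT :: "'t \<Rightarrow> 'x measure" and piX :: "'x \<Rightarrow> 't measure" and Q :: "'t \<Rightarrow> 'x \<Rightarrow> 'x measure"
  assumes prob_\<pi>: "prob_space \<pi>" and sets_\<pi>: "sets \<pi> = sets (T \<Otimes>\<^sub>M X)"
    and cond_snd: "cond_snd_given_fst T X \<pi> piT" and cond_fst: "cond_fst_given_snd T X \<pi> piX"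
    and Q: "(\<lambda>(\<theta>, x). Q \<theta> x) \<in> T \<Otimes>\<^sub>M X \<rightarrow>\<^sub>M prob_algebra X"
    and reversible_Q: "\<And>\<theta>. \<theta> \<in> space T \<Longrightarrow> reversible (piT \<theta>) (Q \<theta>)"
begin

abbreviation "\<mu>T \<equiv> marg_fst T \<pi>"
abbreviation "\<mu>X \<equiv> marg_snd X \<pi>"
abbreviation "\<Phi> \<equiv> Phi T X piX Q"
abbreviation "\<Phi>x \<equiv> Phi_x T X piX Q"

lemma sets_\<mu>T[simp, measurable_cong]: "sets \<mu>T = sets T" by (simp add: marg_fst_def)
lemma sets_\<mu>X[simp, measurable_cong]: "sets \<mu>X = sets X" by (simp add: marg_snd_def)
lemma space_\<mu>T[simp]: "space \<mu>T = space T" by (simp add: marg_fst_def)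
lemma space_\<mu>X[simp]: "space \<mu>X = space X" by (simp add: marg_snd_def)

declare sets_\<pi>[measurable_cong]

lemma space_\<pi>: "space \<pi> = space T \<times> space X"
  using sets_eq_imp_space_eq[OF sets_\<pi>] by (simp add: space_pair_measure)

lemma prob_\<mu>T: "prob_space \<mu>T" unfolding marg_fst_def
  by (rule prob_space.prob_space_distr[OF prob_\<pi>]) measurable
lemma prob_\<mu>X: "prob_space \<mu>X" unfolding marg_snd_def
  by (rule prob_space.prob_space_distr[OF prob_\<pi>]) measurable

lemma piT: "piT \<in> T \<rightarrow>\<^sub>M prob_algebra X" using cond_snd by (simp add: cond_snd_given_fst_def)
lemma piX: "piX \<in> X \<rightarrow>\<^sub>M prob_algebra T" using cond_fst by (simp add: cond_fst_given_snd_def)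

lemmas subprob_kernels[measurable] =
  measurable_prob_algebraD[OF piT] measurable_prob_algebraD[OF piX]

lemma Q_subprob[measurable]: "(\<lambda>z. Q (fst z) (snd z)) \<in> T \<Otimes>\<^sub>M X \<rightarrow>\<^sub>M subprob_algebra X"
  using measurable_prob_algebraD[OF Q] by (simp add: case_prod_beta)

lemma prob_piT: "\<theta> \<in> space T \<Longrightarrow> prob_space (piT \<theta>)"
  and sets_piT: "\<theta> \<in> space T \<Longrightarrow> sets (piT \<theta>) = sets X"
  using measurable_space[OF piT] by (auto simp: space_prob_algebra)

lemma prob_piX: "x \<in> space X \<Longrightarrow> prob_space (piX x)"
  and sets_piX: "x \<in> space X \<Longrightarrow> sets (piX x) = sets T"
  using measurable_space[OF piX] by (auto simp: space_prob_algebra)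

lemma prob_Q: "\<theta> \<in> space T \<Longrightarrow> x \<in> space X \<Longrightarrow> prob_space (Q \<theta> x)"
  and sets_Q: "\<theta> \<in> space T \<Longrightarrow> x \<in> space X \<Longrightarrow> sets (Q \<theta> x) = sets X"
  using measurable_space[OF Q, of "(\<theta>, x)"] by (auto simp: space_prob_algebra space_pair_measure)

sublocale GT: graph_kernel \<mu>T X piT
  by (intro graph_kernel.intro prob_\<mu>T graph_kernel_axioms.intro) (use piT in measurable)

sublocale GX: graph_kernel \<mu>X T piX
  by (intro graph_kernel.intro prob_\<mu>X graph_kernel_axioms.intro) (use piX in measurable)

lemma \<pi>_eq_graph_law: "\<pi> = graph_law \<mu>T X piT"
proof (rule measure_eqI_rectangles[of _ T X])
  show "finite_measure \<pi>" by (rule prob_space.finite_measure[OF prob_\<pi>])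
  show "sets (graph_law \<mu>T X piT) = sets (T \<Otimes>\<^sub>M X)"
    unfolding GT.sets_graph_law by (rule sets_pair_measure_cong) simp_all
  show "emeasure \<pi> (a \<times> b) = emeasure (graph_law \<mu>T X piT) (a \<times> b)" if "a \<in> sets T" "b \<in> sets X" for a b
    using that cond_snd by (simp add: GT.emeasure_graph_law_Times cond_snd_given_fst_def)
qed (rule sets_\<pi>)

lemma graph_law_piX_eq: "distr \<pi> (X \<Otimes>\<^sub>M T) (\<lambda>(\<theta>, x). (x, \<theta>)) = graph_law \<mu>X T piX"
proof (rule measure_eqI_rectangles[of _ X T])
  show "finite_measure (distr \<pi> (X \<Otimes>\<^sub>M T) (\<lambda>(\<theta>, x). (x, \<theta>)))"
    by (intro prob_space.finite_measure prob_space.prob_space_distr[OF prob_\<pi>]) measurable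
  show "sets (graph_law \<mu>X T piX) = sets (X \<Otimes>\<^sub>M T)"
    unfolding GX.sets_graph_law by (rule sets_pair_measure_cong) simp_all
  fix a b assume ab[measurable]: "a \<in> sets X" "b \<in> sets T"
  have "(\<lambda>(\<theta>, x). (x, \<theta>)) -` (a \<times> b) \<inter> space \<pi> = b \<times> a"
    using sets.sets_into_space[OF ab(1)] sets.sets_into_space[OF ab(2)] by (auto simp: space_\<pi>)
  then show "emeasure (distr \<pi> (X \<Otimes>\<^sub>M T) (\<lambda>(\<theta>, x). (x, \<theta>))) (a \<times> b) = emeasure (graph_law \<mu>X T piX) (a \<times> b)"
    using ab cond_fst
    by (subst emeasure_distr) (auto simp: GX.emeasure_graph_law_Times cond_fst_given_snd_def)
qed simp

lemma \<mu>T_bind: "\<mu>T \<bind> piT = \<mu>X"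
  unfolding GT.bind_eq_distr_graph_law \<pi>_eq_graph_law[symmetric] by (simp add: marg_snd_def)

lemma \<mu>X_bind: "\<mu>X \<bind> piX = \<mu>T"
  unfolding GX.bind_eq_distr_graph_law graph_law_piX_eq[symmetric]
  by (subst distr_distr) (auto simp: marg_fst_def comp_def case_prod_beta)

lemma nn_integral_\<pi>_fst:
  "F \<in> borel_measurable (T \<Otimes>\<^sub>M X) \<Longrightarrow> (\<integral>\<^sup>+z. F z \<partial>\<pi>) = (\<integral>\<^sup>+\<theta>. \<integral>\<^sup>+x. F (\<theta>, x) \<partial>piT \<theta> \<partial>\<mu>T)"
  by (subst \<pi>_eq_graph_law, subst GT.nn_integral_graph_law) simp_all

lemma nn_integral_\<pi>_snd:
  assumes F[measurable]: "F \<in> borel_measurable (T \<Otimes>\<^sub>M X)"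
  shows "(\<integral>\<^sup>+z. F z \<partial>\<pi>) = (\<integral>\<^sup>+x. \<integral>\<^sup>+\<theta>. F (\<theta>, x) \<partial>piX x \<partial>\<mu>X)"
proof -
  have "(\<integral>\<^sup>+z. F z \<partial>\<pi>) = (\<integral>\<^sup>+z. F (snd z, fst z) \<partial>distr \<pi> (X \<Otimes>\<^sub>M T) (\<lambda>(\<theta>, x). (x, \<theta>)))"
    by (subst nn_integral_distr) (auto simp: case_prod_beta)
  also have "\<dots> = (\<integral>\<^sup>+x. \<integral>\<^sup>+\<theta>. F (\<theta>, x) \<partial>piX x \<partial>\<mu>X)"
    unfolding graph_law_piX_eq by (subst GX.nn_integral_graph_law) simp_all
  finally show ?thesis .
qed

text \<open>Both sides are integrals over \<open>\<pi>\<close>. The exchange moves the randomness of the parameter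
outside, where the reversibility of each \<open>Q \<theta>\<close> applies.\<close>

lemma nn_integral_exchange:
  "F \<in> borel_measurable (T \<Otimes>\<^sub>M X) \<Longrightarrow>
    (\<integral>\<^sup>+x. \<integral>\<^sup>+\<theta>. F (\<theta>, x) \<partial>piX x \<partial>\<mu>X) = (\<integral>\<^sup>+\<theta>. \<integral>\<^sup>+x. F (\<theta>, x) \<partial>piT \<theta> \<partial>\<mu>T)"
  by (simp add: nn_integral_\<pi>_fst[symmetric] nn_integral_\<pi>_snd[symmetric])

lemma graph_kernel_piX: "x \<in> space X \<Longrightarrow> graph_kernel (piX x) X (\<lambda>\<theta>. Q \<theta> x)"
proof (intro graph_kernel.intro graph_kernel_axioms.intro prob_piX)
  assume x: "x \<in> space X"
  have "(\<lambda>\<theta>. (\<theta>, x)) \<in> T \<rightarrow>\<^sub>M T \<Otimes>\<^sub>M X" using x by simp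
  from measurable_compose[OF this Q] show "(\<lambda>\<theta>. Q \<theta> x) \<in> piX x \<rightarrow>\<^sub>M prob_algebra X"
    by (simp cong: measurable_cong_sets add: sets_piX[OF x])
qed

lemma joint_law_eq_graph_law: "x \<in> space X \<Longrightarrow> joint_law T X piX Q x = graph_law (piX x) X (\<lambda>\<theta>. Q \<theta> x)"
  unfolding joint_law_def graph_law_def
  using return_cong[OF sets_pair_measure_cong[OF sets_piX refl, of x X]] by simp

lemma nn_integral_joint_law:
  assumes F[measurable]: "F \<in> borel_measurable (T \<Otimes>\<^sub>M X)" and x: "x \<in> space X"
  shows "(\<integral>\<^sup>+z. F z \<partial>joint_law T X piX Q x) = (\<integral>\<^sup>+\<theta>. \<integral>\<^sup>+y. F (\<theta>, y) \<partial>Q \<theta> x \<partial>piX x)"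
  unfolding joint_law_eq_graph_law[OF x]
  using x by (intro graph_kernel.nn_integral_graph_law graph_kernel_piX)
    (simp_all cong: measurable_cong_sets add: sets_pair_measure_cong[OF sets_piX refl])

lemma joint_law_kernel: "joint_law T X piX Q \<in> X \<rightarrow>\<^sub>M prob_algebra (T \<Otimes>\<^sub>M X)"
  unfolding joint_law_def
proof (rule measurable_bind_prob_space2[OF piX])
  have "(\<lambda>z. (snd z, fst z)) \<in> X \<Otimes>\<^sub>M T \<rightarrow>\<^sub>M T \<Otimes>\<^sub>M X" by measurable
  from measurable_compose[OF this Q]
  have q: "(\<lambda>z. Q (snd z) (fst z)) \<in> X \<Otimes>\<^sub>M T \<rightarrow>\<^sub>M prob_algebra X" by simp
  show "(\<lambda>(x, \<theta>). Q \<theta> x \<bind> (\<lambda>y. return (T \<Otimes>\<^sub>M X) (\<theta>, y))) \<in> X \<Otimes>\<^sub>M T \<rightarrow>\<^sub>M prob_algebra (T \<Otimes>\<^sub>M X)"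
    unfolding case_prod_beta by (rule measurable_bind_prob_space2[OF q]) measurable
qed

lemma Phi_eq: "\<Phi> = (\<lambda>z. joint_law T X piX Q (snd z))"
  by (simp add: Phi_def fun_eq_iff)

lemma Phi_kernel: "\<Phi> \<in> T \<Otimes>\<^sub>M X \<rightarrow>\<^sub>M prob_algebra (T \<Otimes>\<^sub>M X)"
  unfolding Phi_eq by (rule measurable_compose[OF measurable_snd joint_law_kernel])

lemma Phi_x_kernel: "\<Phi>x \<in> X \<rightarrow>\<^sub>M prob_algebra X"
  unfolding Phi_x_def[abs_def]
  by (rule measurable_compose[OF joint_law_kernel measurable_distr_prob_space]) simp

lemma sets_joint_law: "x \<in> space X \<Longrightarrow> sets (joint_law T X piX Q x) = sets (T \<Otimes>\<^sub>M X)"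
  using measurable_space[OF joint_law_kernel] by (auto simp: space_prob_algebra)

lemma nn_integral_Phi_x:
  assumes F[measurable]: "F \<in> borel_measurable X" and x: "x \<in> space X"
  shows "(\<integral>\<^sup>+y. F y \<partial>\<Phi>x x) = (\<integral>\<^sup>+\<theta>. \<integral>\<^sup>+y. F y \<partial>Q \<theta> x \<partial>piX x)"
proof -
  have "snd \<in> joint_law T X piX Q x \<rightarrow>\<^sub>M X"
    by (simp cong: measurable_cong_sets add: sets_joint_law[OF x])
  then have "(\<integral>\<^sup>+y. F y \<partial>\<Phi>x x) = (\<integral>\<^sup>+z. F (snd z) \<partial>joint_law T X piX Q x)"
    unfolding Phi_x_def by (simp add: nn_integral_distr)
  also have "\<dots> = (\<integral>\<^sup>+\<theta>. \<integral>\<^sup>+y. F y \<partial>Q \<theta> x \<partial>piX x)"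
    using nn_integral_joint_law[of "\<lambda>z. F (snd z)" x] x by simp
  finally show ?thesis .
qed

lemma reversible_fiber: "\<theta> \<in> space T \<Longrightarrow> reversible_kernel (piT \<theta>) (Q \<theta>)"
proof (intro reversible_kernel.intro reversible_kernel_axioms.intro prob_piT reversible_Q)
  assume \<theta>: "\<theta> \<in> space T"
  have "Pair \<theta> \<in> X \<rightarrow>\<^sub>M T \<Otimes>\<^sub>M X" using \<theta> by simp
  from measurable_compose[OF this Q] show "Q \<theta> \<in> piT \<theta> \<rightarrow>\<^sub>M prob_algebra (piT \<theta>)"
    unfolding prob_algebra_cong[OF sets_piT[OF \<theta>]]
    by (simp cong: measurable_cong_sets add: sets_piT[OF \<theta>])
qed

lemma borel_measurable_nn_integral_Q:
  assumes [measurable]: "F \<in> borel_measurable (T \<Otimes>\<^sub>M (X \<Otimes>\<^sub>M X))"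
  shows "(\<lambda>z. \<integral>\<^sup>+y. F (fst z, snd z, y) \<partial>Q (fst z) (snd z)) \<in> borel_measurable (T \<Otimes>\<^sub>M X)"
  by (rule nn_integral_measurable_subprob_algebra2[where N=X]) measurable

lemma nn_integral_Phi_x_pair:
  assumes [measurable]: "F \<in> borel_measurable (X \<Otimes>\<^sub>M X)"
  shows "(\<integral>\<^sup>+x. \<integral>\<^sup>+y. F (x, y) \<partial>\<Phi>x x \<partial>\<mu>X) = (\<integral>\<^sup>+\<theta>. \<integral>\<^sup>+x. \<integral>\<^sup>+y. F (x, y) \<partial>Q \<theta> x \<partial>piT \<theta> \<partial>\<mu>T)"
proof -
  have "(\<integral>\<^sup>+x. \<integral>\<^sup>+y. F (x, y) \<partial>\<Phi>x x \<partial>\<mu>X) = (\<integral>\<^sup>+x. \<integral>\<^sup>+\<theta>. \<integral>\<^sup>+y. F (x, y) \<partial>Q \<theta> x \<partial>piX x \<partial>\<mu>X)"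
    by (intro nn_integral_cong nn_integral_Phi_x) simp_all
  also have "\<dots> = (\<integral>\<^sup>+\<theta>. \<integral>\<^sup>+x. \<integral>\<^sup>+y. F (x, y) \<partial>Q \<theta> x \<partial>piT \<theta> \<partial>\<mu>T)"
    using nn_integral_exchange[OF borel_measurable_nn_integral_Q[of "\<lambda>z. F (snd z)"]] by simp
  finally show ?thesis .
qed

text \<open>After exchanging the order of integration, a step of \<open>\<Phi>x\<close> from equilibrium is a step of \<open>Q \<theta>\<close> from \<open>piT \<theta>\<close> with \<open>\<theta>\<close> averaged
over its marginal, and each of these is reversible.\<close>

sublocale phi_x: reversible_kernel \<mu>X \<Phi>x
proof (intro reversible_kernel.intro reversible_kernel_axioms.intro prob_\<mu>X)
  show "\<Phi>x \<in> \<mu>X \<rightarrow>\<^sub>M prob_algebra \<mu>X"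
    unfolding prob_algebra_cong[OF sets_\<mu>X] using Phi_x_kernel by (simp cong: measurable_cong_sets)
  have *: "(\<integral>\<^sup>+x. emeasure (\<Phi>x x) B * indicator A x \<partial>\<mu>X)
      = (\<integral>\<^sup>+\<theta>. \<integral>\<^sup>+x. emeasure (Q \<theta> x) B * indicator A x \<partial>piT \<theta> \<partial>\<mu>T)"
    if [measurable]: "A \<in> sets X" "B \<in> sets X" for A B
  proof -
    have s: "sets (\<Phi>x x) = sets X" for x by (simp add: Phi_x_def)
    have "(\<integral>\<^sup>+x. emeasure (\<Phi>x x) B * indicator A x \<partial>\<mu>X)
        = (\<integral>\<^sup>+x. \<integral>\<^sup>+y. indicator B y * indicator A x \<partial>\<Phi>x x \<partial>\<mu>X)"
      by (intro nn_integral_cong, subst nn_integral_multc) (simp_all add: s borel_measurable_indicator)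
    also have "\<dots> = (\<integral>\<^sup>+\<theta>. \<integral>\<^sup>+x. \<integral>\<^sup>+y. indicator B y * indicator A x \<partial>Q \<theta> x \<partial>piT \<theta> \<partial>\<mu>T)"
      using nn_integral_Phi_x_pair[of "\<lambda>z. indicator B (snd z) * indicator A (fst z)"] by simp
    also have "\<dots> = (\<integral>\<^sup>+\<theta>. \<integral>\<^sup>+x. emeasure (Q \<theta> x) B * indicator A x \<partial>piT \<theta> \<partial>\<mu>T)"
      using that sets_eq_imp_space_eq[OF sets_piT]
      by (intro nn_integral_cong, subst nn_integral_multc) (simp_all add: sets_Q borel_measurable_indicator)
    finally show ?thesis .
  qed
  show "reversible \<mu>X \<Phi>x"
    unfolding reversible_def
  proof (intro ballI)
    fix A B assume "A \<in> sets \<mu>X" "B \<in> sets \<mu>X"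
    then have AB: "A \<in> sets X" "B \<in> sets X" by auto
    show "(\<integral>\<^sup>+x. emeasure (\<Phi>x x) B * indicator A x \<partial>\<mu>X) = (\<integral>\<^sup>+x. emeasure (\<Phi>x x) A * indicator B x \<partial>\<mu>X)"
      unfolding *[OF AB] *[OF AB(2,1)]
    proof (rule nn_integral_cong)
      fix \<theta> assume "\<theta> \<in> space \<mu>T"
      then show "(\<integral>\<^sup>+x. emeasure (Q \<theta> x) B * indicator A x \<partial>piT \<theta>)
          = (\<integral>\<^sup>+x. emeasure (Q \<theta> x) A * indicator B x \<partial>piT \<theta>)"
        using reversible_Q[of \<theta>] AB by (simp add: reversible_def sets_piT)
    qed
  qed
qed

text \<open>A step of \<open>\<Phi>\<close> first refreshes the parameter given the state, then the state at fixed parameter; both parts preserve \<open>\<pi>\<close>.\<close>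

sublocale phi: stationary_chain \<pi> \<Phi>
proof (intro stationary_chain.intro stationary_kernel.intro stationary_kernel_axioms.intro prob_\<pi>)
  show k: "\<Phi> \<in> \<pi> \<rightarrow>\<^sub>M prob_algebra \<pi>"
    unfolding prob_algebra_cong[OF sets_\<pi>] using Phi_kernel by (simp cong: measurable_cong_sets add: sets_\<pi>)
  have ks: "\<Phi> \<in> \<pi> \<rightarrow>\<^sub>M subprob_algebra \<pi>" by (rule measurable_prob_algebraD[OF k])
  have "\<pi> \<in> space (prob_algebra \<pi>)" by (simp add: space_prob_algebra prob_\<pi>)
  then have s: "sets (\<pi> \<bind> \<Phi>) = sets \<pi>" by (rule sets_bind'[OF _ k])
  show "\<pi> \<bind> \<Phi> = \<pi>"
  proof (rule measure_eqI_nn_integral[OF s])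
    fix F :: "'t \<times> 'x \<Rightarrow> ennreal" assume F\<pi>: "F \<in> borel_measurable \<pi>"
    then have F[measurable]: "F \<in> borel_measurable (T \<Otimes>\<^sub>M X)" by simp
    have joint: "(\<lambda>x. \<integral>\<^sup>+z. F z \<partial>joint_law T X piX Q x) \<in> borel_measurable X"
      by (rule nn_integral_measurable_subprob_algebra2[where N="T \<Otimes>\<^sub>M X", OF _ measurable_prob_algebraD[OF joint_law_kernel]]) measurable
    have "(\<integral>\<^sup>+z. F z \<partial>(\<pi> \<bind> \<Phi>)) = (\<integral>\<^sup>+z. \<integral>\<^sup>+w. F w \<partial>joint_law T X piX Q (snd z) \<partial>\<pi>)"
      using nn_integral_bind[OF F\<pi> ks] by (simp add: Phi_eq)
    also have "\<dots> = (\<integral>\<^sup>+x. \<integral>\<^sup>+w. F w \<partial>joint_law T X piX Q x \<partial>\<mu>X)"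
      unfolding marg_snd_def using joint by (subst nn_integral_distr) simp_all
    also have "\<dots> = (\<integral>\<^sup>+x. \<integral>\<^sup>+\<theta>. \<integral>\<^sup>+y. F (\<theta>, y) \<partial>Q \<theta> x \<partial>piX x \<partial>\<mu>X)"
      by (intro nn_integral_cong nn_integral_joint_law) simp_all
    also have "\<dots> = (\<integral>\<^sup>+\<theta>. \<integral>\<^sup>+x. \<integral>\<^sup>+y. F (\<theta>, y) \<partial>Q \<theta> x \<partial>piT \<theta> \<partial>\<mu>T)"
      using nn_integral_exchange[OF borel_measurable_nn_integral_Q[of "\<lambda>z. F (fst z, snd (snd z))"]] by simp
    also have "\<dots> = (\<integral>\<^sup>+\<theta>. \<integral>\<^sup>+y. F (\<theta>, y) \<partial>piT \<theta> \<partial>\<mu>T)"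
    proof (rule nn_integral_cong)
      fix \<theta> assume "\<theta> \<in> space \<mu>T"
      then have \<theta>: "\<theta> \<in> space T" by simp
      interpret f: reversible_kernel "piT \<theta>" "Q \<theta>" by (rule reversible_fiber[OF \<theta>])
      have "(\<lambda>y. F (\<theta>, y)) \<in> borel_measurable X" using \<theta> by measurable
      then have "(\<lambda>y. F (\<theta>, y)) \<in> borel_measurable (piT \<theta>)"
        by (simp cong: measurable_cong_sets add: sets_piT[OF \<theta>])
      from nn_integral_bind[OF this f.kernel_subprob, symmetric]
      show "(\<integral>\<^sup>+x. \<integral>\<^sup>+y. F (\<theta>, y) \<partial>Q \<theta> x \<partial>piT \<theta>) = (\<integral>\<^sup>+y. F (\<theta>, y) \<partial>piT \<theta>)"
        by (simp add: f.invariant)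
    qed
    also have "\<dots> = (\<integral>\<^sup>+z. F z \<partial>\<pi>)" by (rule nn_integral_\<pi>_fst[symmetric]) simp
    finally show "(\<integral>\<^sup>+z. F z \<partial>(\<pi> \<bind> \<Phi>)) = (\<integral>\<^sup>+z. F z \<partial>\<pi>)" .
  qed
qed

text \<open>Equal to the pair law of \<open>Q \<theta>\<close> at equilibrium, but written with the sigma-algebra of \<open>X\<close>, which does not vary with \<open>\<theta>\<close>;
this makes it a kernel.\<close>

definition fiber_law :: "'t \<Rightarrow> ('x \<times> 'x) measure" where
  "fiber_law \<theta> = piT \<theta> \<bind> (\<lambda>x. Q \<theta> x \<bind> (\<lambda>y. return (X \<Otimes>\<^sub>M X) (x, y)))"

lemma fiber_law_eq: "\<theta> \<in> space T \<Longrightarrow> fiber_law \<theta> = graph_law (piT \<theta>) (piT \<theta>) (Q \<theta>)"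
  unfolding fiber_law_def graph_law_def
  using return_cong[OF sets_pair_measure_cong[OF sets_piT sets_piT, of \<theta> \<theta>]] by simp

lemma fiber_law_kernel: "fiber_law \<in> T \<rightarrow>\<^sub>M prob_algebra (X \<Otimes>\<^sub>M X)"
  unfolding fiber_law_def[abs_def]
proof (rule measurable_bind_prob_space2[OF piT])
  have q: "(\<lambda>z. Q (fst z) (snd z)) \<in> T \<Otimes>\<^sub>M X \<rightarrow>\<^sub>M prob_algebra X"
    using Q by (simp add: case_prod_beta)
  show "(\<lambda>(\<theta>, x). Q \<theta> x \<bind> (\<lambda>y. return (X \<Otimes>\<^sub>M X) (x, y))) \<in> T \<Otimes>\<^sub>M X \<rightarrow>\<^sub>M prob_algebra (X \<Otimes>\<^sub>M X)"
    unfolding case_prod_beta by (rule measurable_bind_prob_space2[OF q]) measurable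
qed

text \<open>The pair law of the averaged kernel is the mixture of the pair laws in the fibres. All statements about the quadratic form
of \<open>\<Phi>x\<close> come from this identity.\<close>

lemma graph_law_Phi_x: "graph_law \<mu>X \<mu>X \<Phi>x = \<mu>T \<bind> fiber_law"
proof (rule measure_eqI_nn_integral)
  have k: "fiber_law \<in> \<mu>T \<rightarrow>\<^sub>M prob_algebra (X \<Otimes>\<^sub>M X)"
    using fiber_law_kernel by (simp cong: measurable_cong_sets)
  have sb: "sets (\<mu>T \<bind> fiber_law) = sets (X \<Otimes>\<^sub>M X)"
    by (rule sets_bind'[OF GT.in_prob_algebra k])
  show "sets (graph_law \<mu>X \<mu>X \<Phi>x) = sets (\<mu>T \<bind> fiber_law)"
    unfolding phi_x.sets_graph_law sb by (rule sets_pair_measure_cong) simp_all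
  fix F :: "'x \<times> 'x \<Rightarrow> ennreal" assume "F \<in> borel_measurable (\<mu>T \<bind> fiber_law)"
  then have F[measurable]: "F \<in> borel_measurable (X \<Otimes>\<^sub>M X)" by (simp cong: measurable_cong_sets add: sb)
  have "(\<integral>\<^sup>+z. F z \<partial>graph_law \<mu>X \<mu>X \<Phi>x) = (\<integral>\<^sup>+\<theta>. \<integral>\<^sup>+x. \<integral>\<^sup>+y. F (x, y) \<partial>Q \<theta> x \<partial>piT \<theta> \<partial>\<mu>T)"
    by (subst phi_x.nn_integral_graph_law) (simp_all add: nn_integral_Phi_x_pair)
  also have "\<dots> = (\<integral>\<^sup>+\<theta>. \<integral>\<^sup>+z. F z \<partial>fiber_law \<theta> \<partial>\<mu>T)"
  proof (rule nn_integral_cong)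
    fix \<theta> assume "\<theta> \<in> space \<mu>T"
    then have \<theta>: "\<theta> \<in> space T" by simp
    interpret f: reversible_kernel "piT \<theta>" "Q \<theta>" by (rule reversible_fiber[OF \<theta>])
    have "F \<in> borel_measurable (piT \<theta> \<Otimes>\<^sub>M piT \<theta>)"
      by (simp cong: measurable_cong_sets add: sets_pair_measure_cong[OF sets_piT sets_piT] \<theta>)
    then show "(\<integral>\<^sup>+x. \<integral>\<^sup>+y. F (x, y) \<partial>Q \<theta> x \<partial>piT \<theta>) = (\<integral>\<^sup>+z. F z \<partial>fiber_law \<theta>)"
      unfolding fiber_law_eq[OF \<theta>] by (rule f.nn_integral_graph_law[symmetric])
  qed
  also have "\<dots> = (\<integral>\<^sup>+z. F z \<partial>(\<mu>T \<bind> fiber_law))"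
    by (rule nn_integral_bind[symmetric, OF F measurable_prob_algebraD[OF k]])
  finally show "(\<integral>\<^sup>+z. F z \<partial>graph_law \<mu>X \<mu>X \<Phi>x) = (\<integral>\<^sup>+z. F z \<partial>(\<mu>T \<bind> fiber_law))" .
qed

lemma L2_fibers:
  assumes g: "g \<in> L2 \<mu>X"
  shows "AE \<theta> in \<mu>T. \<theta> \<in> space T \<and> g \<in> L2 (piT \<theta>)"
    "integrable \<mu>T (\<lambda>\<theta>. ip (piT \<theta>) g g)" "ip \<mu>X g g = (\<integral>\<theta>. ip (piT \<theta>) g g \<partial>\<mu>T)"
proof -
  note k = L2_kernel[OF GT.K prob_\<mu>T, of g, unfolded \<mu>T_bind, OF g]
  show "AE \<theta> in \<mu>T. \<theta> \<in> space T \<and> g \<in> L2 (piT \<theta>)"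
    using k(1) AE_space by eventually_elim simp
  show "integrable \<mu>T (\<lambda>\<theta>. ip (piT \<theta>) g g)" "ip \<mu>X g g = (\<integral>\<theta>. ip (piT \<theta>) g g \<partial>\<mu>T)"
    using k(4,5) by (simp_all add: ip_def power2_eq_square)
qed

text \<open>The integrand is stated with \<open>fiber_law\<close> because that version is measurable in \<open>\<theta>\<close>; it agrees with the inner product where
\<open>g\<close> is square integrable on the fibre.\<close>

lemma ip_Phi_x_fibers:
  assumes g: "g \<in> L2 \<mu>X"
  shows "integrable \<mu>T (\<lambda>\<theta>. \<integral>z. g (fst z) * g (snd z) \<partial>fiber_law \<theta>)"
    "ip \<mu>X g (kernel_op \<Phi>x g) = (\<integral>\<theta>. \<integral>z. g (fst z) * g (snd z) \<partial>fiber_law \<theta> \<partial>\<mu>T)"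
    "AE \<theta> in \<mu>T. (\<integral>z. g (fst z) * g (snd z) \<partial>fiber_law \<theta>) = ip (piT \<theta>) g (kernel_op (Q \<theta>) g)"
proof -
  have k: "fiber_law \<in> \<mu>T \<rightarrow>\<^sub>M subprob_algebra (X \<Otimes>\<^sub>M X)"
    using measurable_prob_algebraD[OF fiber_law_kernel] by (simp cong: measurable_cong_sets)
  have [measurable]: "g \<in> borel_measurable X"
    using L2_measurable[OF g] by (simp cong: measurable_cong_sets)
  have int: "integrable (\<mu>T \<bind> fiber_law) (\<lambda>z. g (fst z) * g (snd z))"
    unfolding graph_law_Phi_x[symmetric]
    by (rule phi_x.integrable_graph_law_mult) (simp_all add: g phi_x.invariant)
  have m: "(\<lambda>z. g (fst z) * g (snd z)) \<in> borel_measurable (X \<Otimes>\<^sub>M X)" by measurable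
  note b = bind_integral[OF k m int]
  show "integrable \<mu>T (\<lambda>\<theta>. \<integral>z. g (fst z) * g (snd z) \<partial>fiber_law \<theta>)" by (rule b(2))
  show "ip \<mu>X g (kernel_op \<Phi>x g) = (\<integral>\<theta>. \<integral>z. g (fst z) * g (snd z) \<partial>fiber_law \<theta> \<partial>\<mu>T)"
    unfolding phi_x.ip_kernel_op[OF g g] graph_law_Phi_x by (rule b(3))
  show "AE \<theta> in \<mu>T. (\<integral>z. g (fst z) * g (snd z) \<partial>fiber_law \<theta>) = ip (piT \<theta>) g (kernel_op (Q \<theta>) g)"
    using L2_fibers(1)[OF g]
  proof eventually_elim
    case (elim \<theta>)
    then interpret f: reversible_kernel "piT \<theta>" "Q \<theta>" by (intro reversible_fiber) simp
    show ?case using elim by (simp add: fiber_law_eq f.ip_kernel_op)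
  qed
qed

lemma phi_x_pow: "kernel_pow X \<Phi>x = kernel_pow \<mu>X \<Phi>x"
  using kernel_pow_cong[of X \<mu>X] by (auto simp: fun_eq_iff)

lemma phi_pow: "kernel_pow (T \<Otimes>\<^sub>M X) \<Phi> = kernel_pow \<pi> \<Phi>"
  using kernel_pow_cong[of "T \<Otimes>\<^sub>M X" \<pi>] by (auto simp: fun_eq_iff sets_\<pi>)

lemma Phi_x_pow_kernel: "kernel_pow X \<Phi>x k \<in> X \<rightarrow>\<^sub>M prob_algebra X"
  by (induction k) (auto intro: measurable_bind_prob_space Phi_x_kernel)

lemma Phi_pow_kernel: "kernel_pow (T \<Otimes>\<^sub>M X) \<Phi> k \<in> T \<Otimes>\<^sub>M X \<rightarrow>\<^sub>M prob_algebra (T \<Otimes>\<^sub>M X)"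
  by (induction k) (auto intro: measurable_bind_prob_space Phi_kernel)

lemma distr_fst_joint_law: "x \<in> space X \<Longrightarrow> distr (joint_law T X piX Q x) T fst = piX x"
proof -
  assume x: "x \<in> space X"
  interpret graph_kernel "piX x" X "\<lambda>\<theta>. Q \<theta> x" by (rule graph_kernel_piX[OF x])
  show ?thesis
    using distr_fst_graph_law unfolding joint_law_eq_graph_law[OF x]
    by (simp add: distr_cong[OF refl sets_piX[OF x] refl])
qed

text \<open>The parameter drawn in step \<open>k + 1\<close> depends only on the state after \<open>k\<close> steps, and these states form a chain with kernel \<open>\<Phi>x\<close>.
Hence the exponent is one less on the right.\<close>

lemma distr_fst_Phi_pow:
  assumes "z \<in> space (T \<Otimes>\<^sub>M X)"
  shows "distr (kernel_pow (T \<Otimes>\<^sub>M X) \<Phi> (Suc k) z) T fst = kernel_pow X \<Phi>x k (snd z) \<bind> piX"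
  using assms
proof (induction k arbitrary: z)
  case 0
  then have x: "snd z \<in> space X" by (auto simp: space_pair_measure)
  have "\<Phi> z \<bind> return (T \<Otimes>\<^sub>M X) = \<Phi> z"
    using measurable_space[OF Phi_kernel 0] by (intro bind_return'') (simp add: space_prob_algebra)
  with x show ?case
    using bind_return[OF subprob_kernels(2) x] by (simp add: Phi_eq distr_fst_joint_law)
next
  case (Suc k)
  let ?P = "kernel_pow (T \<Otimes>\<^sub>M X) \<Phi>" and ?R = "kernel_pow X \<Phi>x"
  have x: "snd z \<in> space X" using Suc.prems by (auto simp: space_pair_measure)
  have \<Phi>z: "sets (\<Phi> z) = sets (T \<Otimes>\<^sub>M X)" "prob_space (\<Phi> z)"
    using measurable_space[OF Phi_kernel Suc.prems] by (auto simp: space_prob_algebra)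
  have ne: "space (\<Phi> z) \<noteq> {}" by (rule prob_space.not_empty[OF \<Phi>z(2)])
  have pm: "?P (Suc k) \<in> \<Phi> z \<rightarrow>\<^sub>M subprob_algebra (T \<Otimes>\<^sub>M X)"
    using measurable_prob_algebraD[OF Phi_pow_kernel[of "Suc k"]] by (simp cong: measurable_cong_sets add: \<Phi>z(1))
  have rm: "?R k \<in> X \<rightarrow>\<^sub>M subprob_algebra X"
    by (rule measurable_prob_algebraD[OF Phi_x_pow_kernel])
  have rm': "?R k \<in> \<Phi>x (snd z) \<rightarrow>\<^sub>M subprob_algebra X"
    using rm by (simp cong: measurable_cong_sets add: Phi_x_def)
  have "distr (?P (Suc (Suc k)) z) T fst = distr (\<Phi> z \<bind> ?P (Suc k)) T fst" by simp
  also have "\<dots> = \<Phi> z \<bind> (\<lambda>w. distr (?P (Suc k) w) T fst)"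
    by (rule distr_bind[OF pm ne]) simp
  also have "\<dots> = \<Phi> z \<bind> (\<lambda>w. ?R k (snd w) \<bind> piX)"
    using Suc.IH sets_eq_imp_space_eq[OF \<Phi>z(1)] by (intro bind_cong refl) auto
  also have "\<dots> = distr (\<Phi> z) X snd \<bind> (\<lambda>y. ?R k y \<bind> piX)"
  proof (rule bind_distr[symmetric, OF _ _ ne])
    show "snd \<in> \<Phi> z \<rightarrow>\<^sub>M X" by (simp cong: measurable_cong_sets add: \<Phi>z(1))
    show "(\<lambda>y. ?R k y \<bind> piX) \<in> X \<rightarrow>\<^sub>M subprob_algebra T"
      by (rule measurable_bind2[OF rm subprob_kernels(2)])
  qed
  also have "distr (\<Phi> z) X snd = \<Phi>x (snd z)" by (simp add: Phi_eq Phi_x_def)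
  also have "\<Phi>x (snd z) \<bind> (\<lambda>y. ?R k y \<bind> piX) = (\<Phi>x (snd z) \<bind> ?R k) \<bind> piX"
    by (rule bind_assoc[symmetric, OF rm' subprob_kernels(2)])
  finally show ?case by simp
qed

lemma cond_mean_L2: "f \<in> L2 \<mu>T \<Longrightarrow> cond_mean piX f \<in> L2 \<mu>X"
  using L2_kernel(2)[OF GX.K prob_\<mu>X, of f] by (simp add: \<mu>X_bind cond_mean_def[abs_def])

lemma integral_cond_mean:
  "f \<in> borel_measurable T \<Longrightarrow> integrable \<mu>T f \<Longrightarrow> (\<integral>x. cond_mean piX f x \<partial>\<mu>X) = (\<integral>\<theta>. f \<theta> \<partial>\<mu>T)"
  using bind_integral(3)[OF GX.K_subprob, of f] by (simp add: \<mu>X_bind cond_mean_def)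

lemma L2_fst: "f \<in> L2 \<mu>T \<Longrightarrow> (\<lambda>z. f (fst z)) \<in> L2 \<pi>"
proof -
  assume f: "f \<in> L2 \<mu>T"
  then have [measurable]: "f \<in> borel_measurable T"
    using L2_measurable[OF f] by (simp cong: measurable_cong_sets)
  show ?thesis using L2_integrable_power2[OF f]
    by (simp add: L2_def marg_fst_def integrable_distr_eq)
qed

lemma integral_fst: "f \<in> borel_measurable T \<Longrightarrow> (\<integral>z. f (fst z) \<partial>\<pi>) = (\<integral>\<theta>. f \<theta> \<partial>\<mu>T)" for f :: "'t \<Rightarrow> real"
  by (simp add: marg_fst_def integral_distr)

text \<open>Averaging \<open>f\<close> over the last parameter, given the state before it, produces its conditional mean.\<close>

lemma kernel_op_Phi_pow:
  assumes f: "f \<in> L2 \<mu>T"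
  shows "AE z in \<pi>. kernel_op (kernel_pow (T \<Otimes>\<^sub>M X) \<Phi> (Suc k)) (\<lambda>z. f (fst z)) z
    = kernel_op (kernel_pow X \<Phi>x k) (cond_mean piX f) (snd z)"
proof -
  have fm[measurable]: "f \<in> borel_measurable T"
    using L2_measurable[OF f] by (simp cong: measurable_cong_sets)
  let ?N = "\<lambda>x. kernel_pow X \<Phi>x k x \<bind> piX"
  have N: "?N \<in> \<mu>X \<rightarrow>\<^sub>M prob_algebra T"
    using measurable_bind_prob_space[OF Phi_x_pow_kernel piX] by (simp cong: measurable_cong_sets)
  have "\<mu>X \<bind> ?N = (\<mu>X \<bind> kernel_pow X \<Phi>x k) \<bind> piX"
    using measurable_prob_algebraD[OF Phi_x_pow_kernel[of k]]
    by (intro bind_assoc[symmetric, OF _ subprob_kernels(2)]) (simp cong: measurable_cong_sets)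
  also have "\<dots> = \<mu>T" by (simp add: phi_x_pow phi_x.invariant_pow \<mu>X_bind)
  finally have "AE x in \<mu>X. f \<in> L2 (?N x)"
    using L2_kernel(1)[OF N prob_\<mu>X] f by simp
  then have "AE x in \<mu>X. x \<in> space X \<and> f \<in> L2 (?N x)"
    using AE_space by eventually_elim simp
  then have "AE x in \<mu>X. x \<in> space X \<and> (\<integral>\<theta>. f \<theta> \<partial>?N x) = kernel_op (kernel_pow X \<Phi>x k) (cond_mean piX f) x"
  proof eventually_elim
    case (elim x)
    then have x: "x \<in> space X" by simp
    have R: "sets (kernel_pow X \<Phi>x k x) = sets X"
      using measurable_space[OF Phi_x_pow_kernel x] by (simp add: space_prob_algebra)
    have pN: "prob_space (?N x)" using measurable_space[OF N] x by (simp add: space_prob_algebra)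
    have "piX \<in> kernel_pow X \<Phi>x k x \<rightarrow>\<^sub>M subprob_algebra T"
      using subprob_kernels(2) by (simp cong: measurable_cong_sets add: R)
    from bind_integral(3)[OF this fm] L2_integrable[OF pN] elim show ?case
      by (simp add: kernel_op_def cond_mean_def)
  qed
  then have "AE z in \<pi>. snd z \<in> space X \<and>
      (\<integral>\<theta>. f \<theta> \<partial>?N (snd z)) = kernel_op (kernel_pow X \<Phi>x k) (cond_mean piX f) (snd z)"
    unfolding marg_snd_def by (rule AE_distrD[rotated]) simp
  then show ?thesis using AE_space
  proof eventually_elim
    case (elim z)
    then have z: "z \<in> space (T \<Otimes>\<^sub>M X)" by (simp add: space_\<pi> space_pair_measure)
    have s: "sets (kernel_pow (T \<Otimes>\<^sub>M X) \<Phi> (Suc k) z) = sets (T \<Otimes>\<^sub>M X)"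
      using measurable_space[OF Phi_pow_kernel z, of "Suc k"] by (simp add: space_prob_algebra)
    have "fst \<in> kernel_pow (T \<Otimes>\<^sub>M X) \<Phi> (Suc k) z \<rightarrow>\<^sub>M T"
      by (simp cong: measurable_cong_sets add: s del: kernel_pow.simps)
    then have "kernel_op (kernel_pow (T \<Otimes>\<^sub>M X) \<Phi> (Suc k)) (\<lambda>z. f (fst z)) z = (\<integral>\<theta>. f \<theta> \<partial>?N (snd z))"
      unfolding kernel_op_def distr_fst_Phi_pow[OF z, symmetric] by (subst integral_distr) simp_all
    with elim show ?case by simp
  qed
qed

lemma ip_fst_snd:
  assumes f: "f \<in> L2 \<mu>T" and h: "h \<in> L2 \<mu>X"
  shows "ip \<pi> (\<lambda>z. f (fst z)) (\<lambda>z. h (snd z)) = ip \<mu>X (cond_mean piX f) h"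
proof -
  have [measurable]: "f \<in> borel_measurable T" "h \<in> borel_measurable X"
    using L2_measurable[OF f] L2_measurable[OF h] by (simp_all cong: measurable_cong_sets)
  have "ip \<pi> (\<lambda>z. f (fst z)) (\<lambda>z. h (snd z)) = (\<integral>z. h (fst z) * f (snd z) \<partial>graph_law \<mu>X T piX)"
    unfolding graph_law_piX_eq[symmetric] ip_def
    by (subst integral_distr) (simp_all add: case_prod_beta mult.commute)
  also have "\<dots> = (\<integral>x. h x * cond_mean piX f x \<partial>\<mu>X)"
    unfolding cond_mean_def using f h by (intro GX.integrable_graph_law_mult) (simp_all add: \<mu>X_bind)
  finally show ?thesis by (simp add: ip_def mult.commute)
qed

lemma ip_Phi_pow:
  assumes f: "f \<in> L2 \<mu>T"
  shows "ip \<pi> (\<lambda>z. f (fst z)) (kernel_op (kernel_pow (T \<Otimes>\<^sub>M X) \<Phi> (Suc k)) (\<lambda>z. f (fst z)))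
    = ip \<mu>X (cond_mean piX f) (kernel_op (kernel_pow X \<Phi>x k) (cond_mean piX f))"
proof -
  have h: "kernel_op (kernel_pow X \<Phi>x k) (cond_mean piX f) \<in> L2 \<mu>X"
    unfolding phi_x_pow by (rule phi_x.pow.kernel_op_L2(1)[OF cond_mean_L2[OF f]])
  have hm: "kernel_op (kernel_pow X \<Phi>x k) (cond_mean piX f) \<in> borel_measurable X"
    using L2_measurable[OF h] by (simp cong: measurable_cong_sets)
  have "ip \<pi> (\<lambda>z. f (fst z)) (kernel_op (kernel_pow (T \<Otimes>\<^sub>M X) \<Phi> (Suc k)) (\<lambda>z. f (fst z)))
      = ip \<pi> (\<lambda>z. f (fst z)) (\<lambda>z. kernel_op (kernel_pow X \<Phi>x k) (cond_mean piX f) (snd z))"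
  proof (rule ip_cong_AE[OF _ kernel_op_Phi_pow[OF f]])
    show "kernel_op (kernel_pow (T \<Otimes>\<^sub>M X) \<Phi> (Suc k)) (\<lambda>z. f (fst z)) \<in> borel_measurable \<pi>"
      unfolding phi_pow by (rule L2_measurable[OF phi.pow.kernel_op_L2(1)[OF L2_fst[OF f]]])
    show "(\<lambda>z. kernel_op (kernel_pow X \<Phi>x k) (cond_mean piX f) (snd z)) \<in> borel_measurable \<pi>"
      using measurable_compose[OF measurable_snd hm] by (simp cong: measurable_cong_sets add: sets_\<pi>)
  qed (simp_all add: L2_measurable[OF L2_fst[OF f]])
  also have "\<dots> = ip \<mu>X (cond_mean piX f) (kernel_op (kernel_pow X \<Phi>x k) (cond_mean piX f))"
    by (rule ip_fst_snd[OF f h])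
  finally show ?thesis .
qed

text \<open>The autocovariances of \<open>f\<close> under \<open>\<Phi>\<close> are those of its conditional mean under \<open>\<Phi>x\<close> delayed by one step. In the
double sum the delay replaces the partial sum up to \<open>m\<close> by the one up to \<open>m - 1\<close>, whose Cesaro limit is the same.\<close>

lemma asym_var_limit:
  assumes f: "f \<in> L2 \<mu>T"
  obtains L where "0 \<le> L"
    "((\<lambda>l. ereal (\<Sum>k. l ^ k * phi_x.op.autocov (\<lambda>x. cond_mean piX f x - (\<integral>\<theta>. f \<theta> \<partial>\<mu>T)) k)) \<longlongrightarrow> L) (at_left 1)"
    "asym_var \<mu>X \<Phi>x (cond_mean piX f) = 2 * L - ereal (var_of \<mu>X (cond_mean piX f))"
    "asym_var \<pi> \<Phi> (\<lambda>z. f (fst z)) = ereal (var_of \<mu>T f) + 2 * L"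
proof -
  have fm: "f \<in> borel_measurable T"
    using L2_measurable[OF f] by (simp cong: measurable_cong_sets)
  define m where "m = (\<integral>\<theta>. f \<theta> \<partial>\<mu>T)"
  have fbar: "cond_mean piX f \<in> L2 \<mu>X" by (rule cond_mean_L2[OF f])
  have m1: "m = (\<integral>x. cond_mean piX f x \<partial>\<mu>X)"
    using integral_cond_mean[OF fm L2_integrable[OF prob_\<mu>T f]] by (simp add: m_def)
  have m2: "m = (\<integral>z. f (fst z) \<partial>\<pi>)"
    using integral_fst[OF fm] by (simp add: m_def)
  let ?c = "\<lambda>x. cond_mean piX f x - m" and ?F = "\<lambda>z. f (fst z) - m"
  have c: "?c \<in> L2 \<mu>X" using fbar L2_const[OF prob_\<mu>X] by (intro L2_diff)
  obtain L where L: "0 \<le> L"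
    "(\<lambda>M. ereal (cesaro (\<lambda>n. \<Sum>k<n. phi_x.op.autocov ?c k) M)) \<longlonglongrightarrow> L"
    "((\<lambda>l. ereal (\<Sum>k. l ^ k * phi_x.op.autocov ?c k)) \<longlongrightarrow> L) (at_left 1)"
    by (rule phi_x.op.abel_cesaro_limit[OF c])
  note L2 = L(2)[unfolded phi_x.autocov_eq_acov[OF c]]
  have cov: "phi.acov ?F (Suc k) = phi_x.acov ?c k" for k
    using ip_Phi_pow[OF f, of k]
    unfolding phi.acov_center[OF L2_fst[OF f] m2] phi_x.acov_center[OF fbar m1] phi.acov_def phi_x.acov_def
      phi_pow phi_x_pow by simp
  show thesis
  proof (rule that[OF L(1) L(3)[unfolded m_def]])
    show "asym_var \<mu>X \<Phi>x (cond_mean piX f) = 2 * L - ereal (var_of \<mu>X (cond_mean piX f))"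
      by (rule phi_x.asym_var_reversible[OF fbar]) (use L2 in \<open>simp add: m1\<close>)
    have "asym_var \<pi> \<Phi> (\<lambda>z. f (fst z)) = ereal (phi.acov ?F 0) + 2 * L"
      using phi.asym_var_eqI[OF L2_fst[OF f], of L] L2 by (simp add: m2[symmetric] cov)
    also have "phi.acov ?F 0 = var_of \<pi> (\<lambda>z. f (fst z))"
      unfolding m2 by (rule phi.acov_0[OF L2_fst[OF f]])
    also have "\<dots> = var_of \<mu>T f"
      using integral_fst[OF fm] integral_fst[of "\<lambda>x. (f x)\<^sup>2"] fm by (simp add: var_of_def)
    finally show "asym_var \<pi> \<Phi> (\<lambda>z. f (fst z)) = ereal (var_of \<mu>T f) + 2 * L" .
  qed
qed

lemma integral_Phi_pow_eq_cond_mean: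
  assumes \<nu>: "\<nu> \<in> space (prob_algebra X)" and \<theta>0: "\<theta>0 \<in> space T" and f: "f \<in> borel_measurable T"
    and int: "integrable (distr \<nu> (T \<Otimes>\<^sub>M X) (\<lambda>x. (\<theta>0, x)) \<bind> kernel_pow (T \<Otimes>\<^sub>M X) \<Phi> (Suc k)) (\<lambda>z. f (fst z))"
  shows "(\<integral>z. f (fst z) \<partial>(distr \<nu> (T \<Otimes>\<^sub>M X) (\<lambda>x. (\<theta>0, x)) \<bind> kernel_pow (T \<Otimes>\<^sub>M X) \<Phi> (Suc k)))
    = (\<integral>x. cond_mean piX f x \<partial>(\<nu> \<bind> kernel_pow X \<Phi>x k))"
proof -
  have s\<nu>: "sets \<nu> = sets X" and p\<nu>: "prob_space \<nu>" using \<nu> by (auto simp: space_prob_algebra)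
  have sp\<nu>: "space \<nu> = space X" by (rule sets_eq_imp_space_eq[OF s\<nu>])
  have ne: "space \<nu> \<noteq> {}" by (rule prob_space.not_empty[OF p\<nu>])
  let ?P = "kernel_pow (T \<Otimes>\<^sub>M X) \<Phi> (Suc k)" and ?R = "kernel_pow X \<Phi>x k"
  have pair: "(\<lambda>x. (\<theta>0, x)) \<in> \<nu> \<rightarrow>\<^sub>M T \<Otimes>\<^sub>M X"
    using \<theta>0 by (simp cong: measurable_cong_sets add: s\<nu>)
  have pm: "?P \<in> T \<Otimes>\<^sub>M X \<rightarrow>\<^sub>M subprob_algebra (T \<Otimes>\<^sub>M X)" by (rule measurable_prob_algebraD[OF Phi_pow_kernel])
  have rm: "?R \<in> \<nu> \<rightarrow>\<^sub>M subprob_algebra X"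
    using measurable_prob_algebraD[OF Phi_x_pow_kernel] by (simp cong: measurable_cong_sets add: s\<nu>)
  define \<rho> where "\<rho> = distr \<nu> (T \<Otimes>\<^sub>M X) (\<lambda>x. (\<theta>0, x)) \<bind> ?P"
  have \<rho>: "\<rho> = \<nu> \<bind> (\<lambda>x. ?P (\<theta>0, x))"
    unfolding \<rho>_def by (rule bind_distr[OF pair pm ne])
  have pm': "(\<lambda>x. ?P (\<theta>0, x)) \<in> \<nu> \<rightarrow>\<^sub>M subprob_algebra (T \<Otimes>\<^sub>M X)"
    by (rule measurable_compose[OF pair pm])
  have s\<rho>: "sets \<rho> = sets (T \<Otimes>\<^sub>M X)"
    unfolding \<rho> using ne by (intro sets_bind[OF subprob_measurableD(2)[OF pm']]) auto
  have fst\<rho>: "fst \<in> \<rho> \<rightarrow>\<^sub>M T" by (simp cong: measurable_cong_sets add: s\<rho>)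
  have "distr \<rho> T fst = \<nu> \<bind> (\<lambda>x. distr (?P (\<theta>0, x)) T fst)"
    unfolding \<rho> by (rule distr_bind[OF pm' ne]) simp
  also have "\<dots> = \<nu> \<bind> (\<lambda>x. ?R x \<bind> piX)"
    using \<theta>0 by (intro bind_cong refl) (simp add: distr_fst_Phi_pow space_pair_measure sp\<nu> del: kernel_pow.simps)
  also have "\<dots> = (\<nu> \<bind> ?R) \<bind> piX"
    by (rule bind_assoc[symmetric, OF rm subprob_kernels(2)])
  finally have d: "distr \<rho> T fst = (\<nu> \<bind> ?R) \<bind> piX" .
  have "sets (\<nu> \<bind> ?R) = sets X"
    using ne by (intro sets_bind[OF subprob_measurableD(2)[OF rm]]) auto
  then have k: "piX \<in> (\<nu> \<bind> ?R) \<rightarrow>\<^sub>M subprob_algebra T"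
    using subprob_kernels(2) by (simp cong: measurable_cong_sets)
  have "integrable (distr \<rho> T fst) f"
    using int unfolding \<rho>_def[symmetric] by (simp add: integrable_distr_eq[OF fst\<rho> f])
  then have "(\<integral>\<theta>. f \<theta> \<partial>distr \<rho> T fst) = (\<integral>x. cond_mean piX f x \<partial>(\<nu> \<bind> ?R))"
    unfolding d cond_mean_def by (rule bind_integral(3)[OF k f])
  then show ?thesis
    unfolding \<rho>_def[symmetric] by (simp add: integral_distr[OF fst\<rho> f])
qed

end

section \<open>Comparison with the exact Gibbs sampler\<close>

lemma Gam_eq_Phi: "Gam T X piX piT = Phi T X piX (\<lambda>\<theta> _. piT \<theta>)"
  by (simp add: Gam_def Phi_def)

lemma Gam_x_eq_Phi_x: "Gam_x T X piX piT = Phi_x T X piX (\<lambda>\<theta> _. piT \<theta>)"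
  by (simp add: Gam_x_def Phi_x_def fun_eq_iff)

context gibbs begin

lemma gibbs_independent: "gibbs T X \<pi> piT piX (\<lambda>\<theta> _. piT \<theta>)"
proof (rule gibbs.intro[OF prob_\<pi> sets_\<pi> cond_snd cond_fst])
  show "(\<lambda>(\<theta>, x). piT \<theta>) \<in> T \<Otimes>\<^sub>M X \<rightarrow>\<^sub>M prob_algebra X"
    using measurable_compose[OF measurable_fst piT, of X] by (simp add: case_prod_beta)
  show "reversible (piT \<theta>) (\<lambda>_. piT \<theta>)" if "\<theta> \<in> space T" for \<theta>
    unfolding reversible_def
    by (intro ballI) (simp only: nn_integral_cmult_indicator, rule mult.commute)
qed

abbreviation "\<Gamma>x \<equiv> Gam_x T X piX piT"

text \<open>For exact draws, the state before and after the step are independent on each fibre.\<close>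

lemma dirichlet_Gam_x:
  assumes g: "g \<in> L2 \<mu>X"
  shows "ip \<mu>X g g - ip \<mu>X g (kernel_op \<Gamma>x g) = (\<integral>\<theta>. var_of (piT \<theta>) g \<partial>\<mu>T)"
proof -
  interpret G: gibbs T X \<pi> piT piX "\<lambda>\<theta> _. piT \<theta>" by (rule gibbs_independent)
  have [measurable]: "g \<in> borel_measurable X"
    using L2_measurable[OF g] by (simp cong: measurable_cong_sets)
  let ?I = "\<lambda>\<theta>. \<integral>z. g (fst z) * g (snd z) \<partial>G.fiber_law \<theta>"
  have int: "integrable \<mu>T (\<lambda>\<theta>. ip (piT \<theta>) g g - ?I \<theta>)"
    using L2_fibers(2)[OF g] G.ip_Phi_x_fibers(1)[OF g] by simp
  have "ip \<mu>X g g - ip \<mu>X g (kernel_op \<Gamma>x g) = (\<integral>\<theta>. ip (piT \<theta>) g g - ?I \<theta> \<partial>\<mu>T)"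
    unfolding Gam_x_eq_Phi_x G.ip_Phi_x_fibers(2)[OF g] L2_fibers(3)[OF g]
    using L2_fibers(2)[OF g] G.ip_Phi_x_fibers(1)[OF g] by simp
  also have "\<dots> = (\<integral>\<theta>. var_of (piT \<theta>) g \<partial>\<mu>T)"
  proof (rule integral_cong_AE)
    show "(\<lambda>\<theta>. ip (piT \<theta>) g g - ?I \<theta>) \<in> borel_measurable \<mu>T"
      using int by (rule borel_measurable_integrable)
    show "(\<lambda>\<theta>. var_of (piT \<theta>) g) \<in> borel_measurable \<mu>T"
      unfolding var_of_def by measurable
    show "AE \<theta> in \<mu>T. ip (piT \<theta>) g g - ?I \<theta> = var_of (piT \<theta>) g"
      using G.ip_Phi_x_fibers(3)[OF g]
      by eventually_elim (simp add: var_of_def ip_def kernel_op_def power2_eq_square)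
  qed
  finally show ?thesis .
qed

lemma dirichlet_Phi_x:
  assumes g: "g \<in> L2 \<mu>X"
  obtains d where "integrable \<mu>T d" "ip \<mu>X g g - ip \<mu>X g (kernel_op \<Phi>x g) = (\<integral>\<theta>. d \<theta> \<partial>\<mu>T)"
    "AE \<theta> in \<mu>T. d \<theta> = ip (piT \<theta>) g g - ip (piT \<theta>) g (kernel_op (Q \<theta>) g)"
proof (rule that)
  let ?I = "\<lambda>\<theta>. \<integral>z. g (fst z) * g (snd z) \<partial>fiber_law \<theta>"
  show "integrable \<mu>T (\<lambda>\<theta>. ip (piT \<theta>) g g - ?I \<theta>)"
    using L2_fibers(2)[OF g] ip_Phi_x_fibers(1)[OF g] by simp
  show "ip \<mu>X g g - ip \<mu>X g (kernel_op \<Phi>x g) = (\<integral>\<theta>. ip (piT \<theta>) g g - ?I \<theta> \<partial>\<mu>T)"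
    unfolding ip_Phi_x_fibers(2)[OF g] L2_fibers(3)[OF g]
    using L2_fibers(2)[OF g] ip_Phi_x_fibers(1)[OF g] by simp
  show "AE \<theta> in \<mu>T. ip (piT \<theta>) g g - ?I \<theta> = ip (piT \<theta>) g g - ip (piT \<theta>) g (kernel_op (Q \<theta>) g)"
    using ip_Phi_x_fibers(3)[OF g] by eventually_elim simp
qed

text \<open>If the map \<open>\<theta> \<mapsto> gap (piT \<theta>) (Q \<theta>)\<close> is not measurable, the integral of the product may be \<open>0\<close> by default. Both bounds remain true then,
because the dominating function is integrable and nonnegative.\<close>

lemma integral_fiber_gap:
  assumes g: "g \<in> L2 \<mu>X"
  shows "0 \<le> (\<integral>\<theta>. var_of (piT \<theta>) g * gap (piT \<theta>) (Q \<theta>) \<partial>\<mu>T)"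
    "(\<integral>\<theta>. var_of (piT \<theta>) g * gap (piT \<theta>) (Q \<theta>) \<partial>\<mu>T) \<le> ip \<mu>X g g - ip \<mu>X g (kernel_op \<Phi>x g)"
proof -
  obtain d where d: "integrable \<mu>T d" "ip \<mu>X g g - ip \<mu>X g (kernel_op \<Phi>x g) = (\<integral>\<theta>. d \<theta> \<partial>\<mu>T)"
    "AE \<theta> in \<mu>T. d \<theta> = ip (piT \<theta>) g g - ip (piT \<theta>) g (kernel_op (Q \<theta>) g)"
    by (rule dirichlet_Phi_x[OF g])
  have ae: "AE \<theta> in \<mu>T. 0 \<le> var_of (piT \<theta>) g * gap (piT \<theta>) (Q \<theta>) \<and> var_of (piT \<theta>) g * gap (piT \<theta>) (Q \<theta>) \<le> d \<theta>"
    using d(3) L2_fibers(1)[OF g]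
  proof eventually_elim
    case (elim \<theta>)
    then interpret f: reversible_kernel "piT \<theta>" "Q \<theta>" by (intro reversible_fiber) simp
    show ?case using f.gap_bounds[of g] elim by simp
  qed
  show "0 \<le> (\<integral>\<theta>. var_of (piT \<theta>) g * gap (piT \<theta>) (Q \<theta>) \<partial>\<mu>T)"
    by (rule integral_nonneg_AE) (use ae in eventually_elim, simp)
  show "(\<integral>\<theta>. var_of (piT \<theta>) g * gap (piT \<theta>) (Q \<theta>) \<partial>\<mu>T) \<le> ip \<mu>X g g - ip \<mu>X g (kernel_op \<Phi>x g)"
    unfolding d(2) by (rule integral_mono_AE'[OF d(1)]) (use ae in \<open>eventually_elim, simp\<close>)+
qed

lemma integral_var_nonneg: "g \<in> L2 \<mu>X \<Longrightarrow> 0 \<le> (\<integral>\<theta>. var_of (piT \<theta>) g \<partial>\<mu>T)"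
proof (rule integral_nonneg_AE)
  assume "g \<in> L2 \<mu>X"
  from L2_fibers(1)[OF this] show "AE \<theta> in \<mu>T. 0 \<le> var_of (piT \<theta>) g"
    by eventually_elim (simp add: var_of_def prob_space.integral_power2_le prob_piT)
qed

text \<open>When the variance integral of \<open>g\<close> vanishes, \<open>g\<close> does not compete in the infimum; the claim is then that the quadratic form of
\<open>I - \<Phi>x\<close> is nonnegative.\<close>

lemma gap_ratio_dirichlet:
  assumes pos: "0 < gap_ratio T X \<pi> piT Q" and g: "g \<in> L2 \<mu>X"
  shows "gap_ratio T X \<pi> piT Q * (ip \<mu>X g g - ip \<mu>X g (kernel_op \<Gamma>x g))
    \<le> ip \<mu>X g g - ip \<mu>X g (kernel_op \<Phi>x g)"
proof -
  define num den where "num g = (\<integral>\<theta>. var_of (piT \<theta>) g * gap (piT \<theta>) (Q \<theta>) \<partial>\<mu>T)"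
    and "den g = (\<integral>\<theta>. var_of (piT \<theta>) g \<partial>\<mu>T)" for g
  note nb = integral_fiber_gap[folded num_def] and db = integral_var_nonneg[folded den_def]
  show ?thesis
  proof (cases "den g = 0")
    case True
    then show ?thesis
      using nb[OF g] unfolding dirichlet_Gam_x[OF g] den_def[symmetric] by simp
  next
    case False
    let ?S = "{num g / den g | g. g \<in> L2 \<mu>X \<and> den g \<noteq> 0}"
    have "bdd_below ?S" using nb(1) db by (intro bdd_belowI[of _ 0]) auto
    then have "Inf ?S \<le> num g / den g" using g False by (intro cInf_lower) blast+
    then have "gap_ratio T X \<pi> piT Q \<le> num g / den g" by (simp add: gap_ratio_def num_def den_def)
    then have "gap_ratio T X \<pi> piT Q * den g \<le> num g"
      using False db[OF g] by (simp add: field_simps)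
    also have "\<dots> \<le> ip \<mu>X g g - ip \<mu>X g (kernel_op \<Phi>x g)" by (rule nb(2)[OF g])
    finally show ?thesis by (simp add: dirichlet_Gam_x[OF g] den_def)
  qed
qed

text \<open>Positivity is used on each fibre for the centred function; centring subtracts exactly the quadratic form of an exact draw.\<close>

lemma positive_dirichlet:
  assumes pos: "\<And>\<theta>. \<theta> \<in> space T \<Longrightarrow> positive_kernel (piT \<theta>) (Q \<theta>)" and g: "g \<in> L2 \<mu>X"
  shows "ip \<mu>X g g - ip \<mu>X g (kernel_op \<Phi>x g) \<le> ip \<mu>X g g - ip \<mu>X g (kernel_op \<Gamma>x g)"
proof -
  interpret G: gibbs T X \<pi> piT piX "\<lambda>\<theta> _. piT \<theta>" by (rule gibbs_independent)
  have "ip \<mu>X g (kernel_op \<Gamma>x g) \<le> ip \<mu>X g (kernel_op \<Phi>x g)"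
    unfolding Gam_x_eq_Phi_x G.ip_Phi_x_fibers(2)[OF g] ip_Phi_x_fibers(2)[OF g]
  proof (rule integral_mono_AE[OF G.ip_Phi_x_fibers(1)[OF g] ip_Phi_x_fibers(1)[OF g]])
    show "AE \<theta> in \<mu>T. (\<integral>z. g (fst z) * g (snd z) \<partial>G.fiber_law \<theta>) \<le> (\<integral>z. g (fst z) * g (snd z) \<partial>fiber_law \<theta>)"
      using G.ip_Phi_x_fibers(3)[OF g] ip_Phi_x_fibers(3)[OF g] L2_fibers(1)[OF g]
    proof eventually_elim
      case (elim \<theta>)
      then interpret f: reversible_kernel "piT \<theta>" "Q \<theta>" by (intro reversible_fiber) simp
      define m where "m = (\<integral>x. g x \<partial>piT \<theta>)"
      have "(\<lambda>x. g x - m) \<in> L2 (piT \<theta>)"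
        using elim L2_const[OF f.prob_space_axioms] by (intro L2_diff) auto
      then have "0 \<le> ip (piT \<theta>) g (kernel_op (Q \<theta>) g) - m\<^sup>2"
        using pos[of \<theta>] elim f.ip_kernel_op_center[of g m] by (auto simp: positive_kernel_def m_def)
      moreover have "ip (piT \<theta>) g (kernel_op (\<lambda>_. piT \<theta>) g) = m\<^sup>2"
        by (simp add: ip_def kernel_op_def m_def power2_eq_square)
      ultimately show ?case using elim by simp
    qed
  qed
  then show ?thesis by simp
qed

text \<open>Both implications are the resolvent comparison, with the two kernels in opposite roles. The first uses the ratio of gaps
as the constant, the second the constant \<open>1\<close>.\<close>

lemma asym_var_limits:
  assumes f: "f \<in> L2 \<mu>T"
  obtains L L' where "0 \<le> L" "0 \<le> L'"
    "asym_var \<mu>X \<Phi>x (cond_mean piX f) = 2 * L - ereal (var_of \<mu>X (cond_mean piX f))"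
    "asym_var \<pi> \<Phi> (\<lambda>z. f (fst z)) = ereal (var_of \<mu>T f) + 2 * L"
    "asym_var \<mu>X \<Gamma>x (cond_mean piX f) = 2 * L' - ereal (var_of \<mu>X (cond_mean piX f))"
    "asym_var \<pi> (Gam T X piX piT) (\<lambda>z. f (fst z)) = ereal (var_of \<mu>T f) + 2 * L'"
    "0 < gap_ratio T X \<pi> piT Q \<Longrightarrow> ereal (gap_ratio T X \<pi> piT Q) * L \<le> L'"
    "(\<And>\<theta>. \<theta> \<in> space T \<Longrightarrow> positive_kernel (piT \<theta>) (Q \<theta>)) \<Longrightarrow> L' \<le> L"
proof -
  interpret G: gibbs T X \<pi> piT piX "\<lambda>\<theta> _. piT \<theta>" by (rule gibbs_independent)
  obtain L where L: "0 \<le> L"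
    "((\<lambda>l. ereal (\<Sum>k. l ^ k * phi_x.op.autocov (\<lambda>x. cond_mean piX f x - (\<integral>\<theta>. f \<theta> \<partial>\<mu>T)) k)) \<longlongrightarrow> L) (at_left 1)"
    "asym_var \<mu>X \<Phi>x (cond_mean piX f) = 2 * L - ereal (var_of \<mu>X (cond_mean piX f))"
    "asym_var \<pi> \<Phi> (\<lambda>z. f (fst z)) = ereal (var_of \<mu>T f) + 2 * L"
    by (rule asym_var_limit[OF f])
  obtain L' where L': "0 \<le> L'"
    "((\<lambda>l. ereal (\<Sum>k. l ^ k * G.phi_x.op.autocov (\<lambda>x. cond_mean piX f x - (\<integral>\<theta>. f \<theta> \<partial>\<mu>T)) k)) \<longlongrightarrow> L') (at_left 1)"
    "asym_var \<mu>X G.\<Phi>x (cond_mean piX f) = 2 * L' - ereal (var_of \<mu>X (cond_mean piX f))"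
    "asym_var \<pi> G.\<Phi> (\<lambda>z. f (fst z)) = ereal (var_of \<mu>T f) + 2 * L'"
    by (rule G.asym_var_limit[OF f])
  have c: "(\<lambda>x. cond_mean piX f x - (\<integral>\<theta>. f \<theta> \<partial>\<mu>T)) \<in> L2 \<mu>X"
    using cond_mean_L2[OF f] L2_const[OF prob_\<mu>X] by (intro L2_diff)
  note P = phi_x.op.selfadjoint_contraction_axioms and R = G.phi_x.op.selfadjoint_contraction_axioms
  show thesis
  proof (rule that[OF L(1) L'(1) L(3,4) L'(3,4)[folded Gam_eq_Phi Gam_x_eq_Phi_x]])
    assume pos: "0 < gap_ratio T X \<pi> piT Q"
    show "ereal (gap_ratio T X \<pi> piT Q) * L \<le> L'"
      by (rule resolvent_limit_comparison[OF P R pos gap_ratio_dirichlet[OF pos, unfolded Gam_x_eq_Phi_x] c L(2) L'(2)])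
  next
    assume pos: "\<And>\<theta>. \<theta> \<in> space T \<Longrightarrow> positive_kernel (piT \<theta>) (Q \<theta>)"
    have "ereal 1 * L' \<le> L"
      by (rule resolvent_limit_comparison[OF R P _ _ c L'(2) L(2)])
         (use positive_dirichlet[OF pos] in \<open>simp_all add: Gam_x_eq_Phi_x\<close>)
    then show "L' \<le> L" by (simp add: one_ereal_def[symmetric])
  qed
qed

lemma geometric_bound_transfer:
  assumes bound: "\<And>k. 1 \<le> k \<Longrightarrow>
      ennreal \<bar>(\<integral>y. cond_mean piX f y \<partial>(\<nu> \<bind> kernel_pow X \<Phi>x k)) - (\<integral>y. cond_mean piX f y \<partial>\<mu>X)\<bar>
        \<le> C * ennreal (\<rho> ^ k)"
    and \<nu>: "\<nu> \<in> space (prob_algebra X)" and \<theta>0: "\<theta>0 \<in> space T" and f: "f \<in> borel_measurable T" and k: "2 \<le> k"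
    and int\<pi>: "integrable \<pi> (\<lambda>z. f (fst z))"
    and int: "integrable (distr \<nu> (T \<Otimes>\<^sub>M X) (\<lambda>x. (\<theta>0, x)) \<bind> kernel_pow (T \<Otimes>\<^sub>M X) \<Phi> k) (\<lambda>z. f (fst z))"
  shows "ennreal \<bar>(\<integral>z. f (fst z) \<partial>(distr \<nu> (T \<Otimes>\<^sub>M X) (\<lambda>x. (\<theta>0, x)) \<bind> kernel_pow (T \<Otimes>\<^sub>M X) \<Phi> k)) - (\<integral>z. f (fst z) \<partial>\<pi>)\<bar>
    \<le> C * ennreal (\<rho> ^ (k - 1))"
proof -
  obtain j where j: "k = Suc j" "1 \<le> j" using k by (cases k) auto
  have "integrable \<mu>T f" using int\<pi> f by (simp add: marg_fst_def integrable_distr_eq)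
  then have "(\<integral>z. f (fst z) \<partial>\<pi>) = (\<integral>y. cond_mean piX f y \<partial>\<mu>X)"
    using integral_fst[OF f] integral_cond_mean[OF f] by simp
  then show ?thesis
    using bound[OF j(2)] integral_Phi_pow_eq_cond_mean[OF \<nu> \<theta>0 f int[unfolded j]] by (simp add: j del: kernel_pow.simps)
qed

end

theorem theorem27:
  fixes T :: "'t measure" and X :: "'x measure" and \<pi> :: "('t \<times> 'x) measure"
    and piT :: "'t \<Rightarrow> 'x measure" and piX :: "'x \<Rightarrow> 't measure"
    and Q :: "'t \<Rightarrow> 'x \<Rightarrow> 'x measure"
  assumes "prob_space \<pi>" and "sets \<pi> = sets (T \<Otimes>\<^sub>M X)"
    and "cond_snd_given_fst T X \<pi> piT" and "cond_fst_given_snd T X \<pi> piX"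
    and "(\<lambda>(\<theta>, x). Q \<theta> x) \<in> T \<Otimes>\<^sub>M X \<rightarrow>\<^sub>M prob_algebra X"
    and "\<And>\<theta>. \<theta> \<in> space T \<Longrightarrow> reversible (piT \<theta>) (Q \<theta>)"
  shows
    "(\<forall>(G :: ('x \<Rightarrow> real) set) (normG :: ('x \<Rightarrow> real) \<Rightarrow> ennreal) (W :: 'x measure \<Rightarrow> ennreal) (\<rho> :: real).
        (\<forall>g\<in>G. integrable (marg_snd X \<pi>) g) \<and> 0 \<le> \<rho> \<and> \<rho> < 1 \<and>
        (\<forall>\<nu>\<in>space (prob_algebra X). \<forall>g\<in>G. \<forall>k\<ge>1.
           ennreal \<bar>(\<integral>y. g y \<partial>(\<nu> \<bind> kernel_pow X (Phi_x T X piX Q) k)) - (\<integral>y. g y \<partial>marg_snd X \<pi>)\<bar>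
             \<le> normG g * W \<nu> * ennreal (\<rho> ^ k)) \<longrightarrow>
        (\<forall>\<nu>\<in>space (prob_algebra X). \<forall>\<theta>0\<in>space T. \<forall>f\<in>borel_measurable T. \<forall>k\<ge>2.
           (let \<nu>\<Phi>k = distr \<nu> (T \<Otimes>\<^sub>M X) (\<lambda>x. (\<theta>0, x)) \<bind> kernel_pow (T \<Otimes>\<^sub>M X) (Phi T X piX Q) k in
            cond_mean piX f \<in> G \<and> integrable \<pi> (\<lambda>z. f (fst z)) \<and> integrable \<nu>\<Phi>k (\<lambda>z. f (fst z)) \<longrightarrow>
            ennreal \<bar>(\<integral>z. f (fst z) \<partial>\<nu>\<Phi>k) - (\<integral>z. f (fst z) \<partial>\<pi>)\<bar>
              \<le> normG (cond_mean piX f) * W \<nu> * ennreal (\<rho> ^ (k - 1)))))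
   \<and> (\<forall>f\<in>L2 (marg_fst T \<pi>).
        cond_mean piX f \<in> L2 (marg_snd X \<pi>) \<and>
        (\<forall>k\<ge>1. ip \<pi> (\<lambda>z. f (fst z))
                    (kernel_op (kernel_pow (T \<Otimes>\<^sub>M X) (Phi T X piX Q) k) (\<lambda>z. f (fst z)))
              = ip (marg_snd X \<pi>) (cond_mean piX f)
                    (kernel_op (kernel_pow X (Phi_x T X piX Q) (k - 1)) (cond_mean piX f))) \<and>
        asym_var \<pi> (Phi T X piX Q) (\<lambda>z. f (fst z))
          = ereal (var_of (marg_fst T \<pi>) f) + ereal (var_of (marg_snd X \<pi>) (cond_mean piX f))
            + asym_var (marg_snd X \<pi>) (Phi_x T X piX Q) (cond_mean piX f))
   \<and> (let \<rho> = gap_ratio T X \<pi> piT Q in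
        \<rho> > 0 \<longrightarrow> (\<forall>f\<in>L2 (marg_fst T \<pi>).
        asym_var \<pi> (Phi T X piX Q) (\<lambda>z. f (fst z))
          \<le> ereal (var_of (marg_fst T \<pi>) f)
             + ereal (inverse \<rho>) * ereal (var_of (marg_snd X \<pi>) (cond_mean piX f))
             + ereal (inverse \<rho>) * asym_var (marg_snd X \<pi>) (Gam_x T X piX piT) (cond_mean piX f) \<and>
        ereal (var_of (marg_fst T \<pi>) f)
             + ereal (inverse \<rho>) * ereal (var_of (marg_snd X \<pi>) (cond_mean piX f))
             + ereal (inverse \<rho>) * asym_var (marg_snd X \<pi>) (Gam_x T X piX piT) (cond_mean piX f)
          \<le> ereal (1 - inverse \<rho>) * ereal (var_of (marg_fst T \<pi>) f)
             + ereal (inverse \<rho>) * asym_var \<pi> (Gam T X piX piT) (\<lambda>z. f (fst z))))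
   \<and> ((\<forall>\<theta>\<in>space T. positive_kernel (piT \<theta>) (Q \<theta>)) \<longrightarrow>
        (\<forall>f\<in>L2 (marg_fst T \<pi>).
           asym_var \<pi> (Gam T X piX piT) (\<lambda>z. f (fst z))
             \<le> asym_var \<pi> (Phi T X piX Q) (\<lambda>z. f (fst z))))"
proof -
  interpret gibbs T X \<pi> piT piX Q
    using assms by (intro gibbs.intro)
  show ?thesis
  proof (intro conjI)
    show "\<forall>(G :: ('x \<Rightarrow> real) set) (normG :: ('x \<Rightarrow> real) \<Rightarrow> ennreal) (W :: 'x measure \<Rightarrow> ennreal) (\<rho> :: real).
        (\<forall>g\<in>G. integrable (marg_snd X \<pi>) g) \<and> 0 \<le> \<rho> \<and> \<rho> < 1 \<and>
        (\<forall>\<nu>\<in>space (prob_algebra X). \<forall>g\<in>G. \<forall>k\<ge>1.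
           ennreal \<bar>(\<integral>y. g y \<partial>(\<nu> \<bind> kernel_pow X (Phi_x T X piX Q) k)) - (\<integral>y. g y \<partial>marg_snd X \<pi>)\<bar>
             \<le> normG g * W \<nu> * ennreal (\<rho> ^ k)) \<longrightarrow>
        (\<forall>\<nu>\<in>space (prob_algebra X). \<forall>\<theta>0\<in>space T. \<forall>f\<in>borel_measurable T. \<forall>k\<ge>2.
           (let \<nu>\<Phi>k = distr \<nu> (T \<Otimes>\<^sub>M X) (\<lambda>x. (\<theta>0, x)) \<bind> kernel_pow (T \<Otimes>\<^sub>M X) (Phi T X piX Q) k in
            cond_mean piX f \<in> G \<and> integrable \<pi> (\<lambda>z. f (fst z)) \<and> integrable \<nu>\<Phi>k (\<lambda>z. f (fst z)) \<longrightarrow>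
            ennreal \<bar>(\<integral>z. f (fst z) \<partial>\<nu>\<Phi>k) - (\<integral>z. f (fst z) \<partial>\<pi>)\<bar>
              \<le> normG (cond_mean piX f) * W \<nu> * ennreal (\<rho> ^ (k - 1))))"
      unfolding Let_def
      by (intro allI impI ballI geometric_bound_transfer) blast+
  next
    show "\<forall>f\<in>L2 (marg_fst T \<pi>).
        cond_mean piX f \<in> L2 (marg_snd X \<pi>) \<and>
        (\<forall>k\<ge>1. ip \<pi> (\<lambda>z. f (fst z))
                    (kernel_op (kernel_pow (T \<Otimes>\<^sub>M X) (Phi T X piX Q) k) (\<lambda>z. f (fst z)))
              = ip (marg_snd X \<pi>) (cond_mean piX f)
                    (kernel_op (kernel_pow X (Phi_x T X piX Q) (k - 1)) (cond_mean piX f))) \<and>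
        asym_var \<pi> (Phi T X piX Q) (\<lambda>z. f (fst z))
          = ereal (var_of (marg_fst T \<pi>) f) + ereal (var_of (marg_snd X \<pi>) (cond_mean piX f))
            + asym_var (marg_snd X \<pi>) (Phi_x T X piX Q) (cond_mean piX f)"
    proof (intro ballI conjI allI impI)
      fix f assume f: "f \<in> L2 \<mu>T"
      show "cond_mean piX f \<in> L2 \<mu>X" by (rule cond_mean_L2[OF f])
      show "ip \<pi> (\<lambda>z. f (fst z)) (kernel_op (kernel_pow (T \<Otimes>\<^sub>M X) \<Phi> k) (\<lambda>z. f (fst z)))
          = ip \<mu>X (cond_mean piX f) (kernel_op (kernel_pow X \<Phi>x (k - 1)) (cond_mean piX f))"
        if "1 \<le> k" for k
        using ip_Phi_pow[OF f, of "k - 1"] that by (simp del: kernel_pow.simps)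
      obtain L where "0 \<le> L"
        "asym_var \<mu>X \<Phi>x (cond_mean piX f) = 2 * L - ereal (var_of \<mu>X (cond_mean piX f))"
        "asym_var \<pi> \<Phi> (\<lambda>z. f (fst z)) = ereal (var_of \<mu>T f) + 2 * L"
        by (rule asym_var_limits[OF f])
      then show "asym_var \<pi> \<Phi> (\<lambda>z. f (fst z))
          = ereal (var_of \<mu>T f) + ereal (var_of \<mu>X (cond_mean piX f)) + asym_var \<mu>X \<Phi>x (cond_mean piX f)"
        by (cases L) auto
    qed
  next
    show "let \<rho> = gap_ratio T X \<pi> piT Q in
        \<rho> > 0 \<longrightarrow> (\<forall>f\<in>L2 (marg_fst T \<pi>).
        asym_var \<pi> (Phi T X piX Q) (\<lambda>z. f (fst z))
          \<le> ereal (var_of (marg_fst T \<pi>) f)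
             + ereal (inverse \<rho>) * ereal (var_of (marg_snd X \<pi>) (cond_mean piX f))
             + ereal (inverse \<rho>) * asym_var (marg_snd X \<pi>) (Gam_x T X piX piT) (cond_mean piX f) \<and>
        ereal (var_of (marg_fst T \<pi>) f)
             + ereal (inverse \<rho>) * ereal (var_of (marg_snd X \<pi>) (cond_mean piX f))
             + ereal (inverse \<rho>) * asym_var (marg_snd X \<pi>) (Gam_x T X piX piT) (cond_mean piX f)
          \<le> ereal (1 - inverse \<rho>) * ereal (var_of (marg_fst T \<pi>) f)
             + ereal (inverse \<rho>) * asym_var \<pi> (Gam T X piX piT) (\<lambda>z. f (fst z)))"
      unfolding Let_def
    proof (intro impI ballI)
      fix f assume pos: "0 < gap_ratio T X \<pi> piT Q" and f: "f \<in> L2 \<mu>T"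
      define \<rho> where "\<rho> = gap_ratio T X \<pi> piT Q"
      define C c where "C = var_of \<mu>T f" and "c = var_of \<mu>X (cond_mean piX f)"
      have \<rho>: "0 < \<rho>" using pos by (simp add: \<rho>_def)
      obtain L L' where L: "0 \<le> L" "0 \<le> L'" "asym_var \<pi> \<Phi> (\<lambda>z. f (fst z)) = ereal C + 2 * L"
        "asym_var \<mu>X \<Gamma>x (cond_mean piX f) = 2 * L' - ereal c"
        "asym_var \<pi> (Gam T X piX piT) (\<lambda>z. f (fst z)) = ereal C + 2 * L'"
        "ereal \<rho> * L \<le> L'"
        unfolding \<rho>_def C_def c_def by (rule asym_var_limits[OF f]) (use pos in blast)
      show "asym_var \<pi> \<Phi> (\<lambda>z. f (fst z)) \<le> ereal (var_of \<mu>T f)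
          + ereal (inverse (gap_ratio T X \<pi> piT Q)) * ereal (var_of \<mu>X (cond_mean piX f))
          + ereal (inverse (gap_ratio T X \<pi> piT Q)) * asym_var \<mu>X \<Gamma>x (cond_mean piX f) \<and>
        ereal (var_of \<mu>T f)
          + ereal (inverse (gap_ratio T X \<pi> piT Q)) * ereal (var_of \<mu>X (cond_mean piX f))
          + ereal (inverse (gap_ratio T X \<pi> piT Q)) * asym_var \<mu>X \<Gamma>x (cond_mean piX f)
        \<le> ereal (1 - inverse (gap_ratio T X \<pi> piT Q)) * ereal (var_of \<mu>T f)
          + ereal (inverse (gap_ratio T X \<pi> piT Q)) * asym_var \<pi> (Gam T X piX piT) (\<lambda>z. f (fst z))"
        unfolding \<rho>_def[symmetric] C_def[symmetric] c_def[symmetric] L(3,4,5)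
        using L(1,2,6) \<rho> by (cases L; cases L') (auto simp: field_simps)
    qed
  next
    show "(\<forall>\<theta>\<in>space T. positive_kernel (piT \<theta>) (Q \<theta>)) \<longrightarrow>
        (\<forall>f\<in>L2 (marg_fst T \<pi>).
           asym_var \<pi> (Gam T X piX piT) (\<lambda>z. f (fst z))
             \<le> asym_var \<pi> (Phi T X piX Q) (\<lambda>z. f (fst z)))"
    proof (intro impI ballI)
      fix f assume pos: "\<forall>\<theta>\<in>space T. positive_kernel (piT \<theta>) (Q \<theta>)" and f: "f \<in> L2 \<mu>T"
      obtain L L' where L: "asym_var \<pi> \<Phi> (\<lambda>z. f (fst z)) = ereal (var_of \<mu>T f) + 2 * L"
        "asym_var \<pi> (Gam T X piX piT) (\<lambda>z. f (fst z)) = ereal (var_of \<mu>T f) + 2 * L'" "L' \<le> L"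
        by (rule asym_var_limits[OF f]) (use pos in blast)
      show "asym_var \<pi> (Gam T X piX piT) (\<lambda>z. f (fst z)) \<le> asym_var \<pi> \<Phi> (\<lambda>z. f (fst z))"
        unfolding L(1,2) using L(3) by (intro add_left_mono ereal_mult_left_mono) auto
    qed
  qed
qed

end
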